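(* Assume the standing setup below and $\beta_n n^{-\alpha}\to\gamma\in(0,\infty)$. Let $\mathcal M_\gamma$ be a Poisson point process on $[0,\infty)\times\mathbb S_q^{d-2}$ with intensity measure $\frac{C(q)}{\alpha\gamma^{1/\alpha}}\,y^{1/\alpha-1}\,dy\,\nu_q(d\theta)$. Then $\sqrt{\beta_n}\,\mathcal Y_n(q)\to V\Xi$ in distribution, where $$\Xi=\frac{\int_0^\infty\int_{\mathbb S_q^{d-2}}e^{-y}\sqrt{2y}\,\theta\,\mathcal M_\gamma(dy,d\theta)}{\int_0^\infty\int_{\mathbb S_q^{d-2}}e^{-y}\,\mathcal M_\gamma(dy,d\theta)}$$ (the denominator is a.s. finite and strictly positive). In particular $\mathcal Y_n(q)\to0$ and $\mathrm{ATT}(n)\to Vq$ in probability.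
   Context: Standing setup: Fix an integer $d\ge 2$; let $\mathbb S^{d-1}\subset\mathbb R^d$ be the unit sphere with surface measure $\sigma$. Fix $q\in\mathbb S^{d-1}$. Let $x_1,x_2,\dots$ be i.i.d. random vectors on $\mathbb S^{d-1}$ with law $\rho(x)\,d\sigma(x)$, where $\rho$ is a $C^2$ probability density on $\mathbb S^{d-1}$ with $\rho(q)>0$. Let $(\beta_n)_{n\ge1}$ be positive reals and set $\alpha=2/(d-1)$. Define $T_i=1-\langle q,x_i\rangle$, $Z_n=\sum_{j=1}^n e^{-\beta_nT_j}$, $A_i=e^{-\beta_nT_i}/Z_n$. Let $V\in\mathbb R^{d\times d}$ be fixed, $\mathrm{ATT}(n)=V\sum_{j=1}^nA_jx_j$ and $\mathcal Y_n(q)=\mathrm{ATT}(n)-Vq=V\sum_{i=1}^nA_i(x_i-q)$. Let $C(q)=\frac{2^{1/\alpha}\sigma_{d-2}}{d-1}\rho(q)$ with $\sigma_{d-2}$ the surface area of $\mathbb S^{d-2}$. Let $\mathbb S_q^{d-2}=\{\theta\in\mathbb R^d:\langle\theta,q\rangle=0,\ \|\theta\|=1\}$ and let $\nu_q$ be the uniform probability measure on $\mathbb S_q^{d-2}$. *)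

theory Defs
  imports "HOL-Analysis.Analysis" "HOL-Probability.Probability"
begin

text \<open>Surface measure on the unit sphere of a Euclidean space, defined via the cone
  construction: sigma(A) = d * lambda({t u | 0 < t \<le> 1, u \<in> A \<inter> S^(d-1)}).\<close>
definition sphere_surface_measure :: "('a::euclidean_space) measure" where
  "sphere_surface_measure = measure_of UNIV (sets borel)
     (\<lambda>A. of_nat DIM('a) * emeasure lborel
            {t *\<^sub>R u | t u. 0 < t \<and> t \<le> 1 \<and> u \<in> A \<inter> sphere 0 1})"

text \<open>Surface area of the unit sphere S^k in R^(k+1).\<close>
definition sphere_area :: "nat \<Rightarrow> real" where
  "sphere_area k = 2 * pi powr ((real k + 1) / 2) / Gamma ((real k + 1) / 2)"

definition C2_on :: "'a::euclidean_space set \<Rightarrow> ('a \<Rightarrow> real) \<Rightarrow> bool" where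
  "C2_on S f \<longleftrightarrow> (\<exists>U f' f''. open U \<and> S \<subseteq> U \<and>
      (\<forall>u\<in>U. (f has_derivative blinfun_apply (f' u)) (at u) \<and>
               (f' has_derivative blinfun_apply (f'' u)) (at u)) \<and>
      continuous_on U (f'' :: 'a \<Rightarrow> ('a \<Rightarrow>\<^sub>L ('a \<Rightarrow>\<^sub>L real))))"

definition orth_sphere :: "'a::euclidean_space \<Rightarrow> 'a set" where
  "orth_sphere q = {\<theta>. \<theta> \<bullet> q = 0 \<and> norm \<theta> = 1}"

definition uniform_on_orth_sphere :: "'a::euclidean_space \<Rightarrow> 'a measure \<Rightarrow> bool" where
  "uniform_on_orth_sphere q \<nu> \<longleftrightarrow> prob_space \<nu> \<and> sets \<nu> = sets borel \<and>
     emeasure \<nu> (UNIV - orth_sphere q) = 0 \<and>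
     (\<forall>U. orthogonal_transformation U \<and> U q = q \<longrightarrow> distr \<nu> borel U = \<nu>)"

definition poisson_point_process :: "'w measure \<Rightarrow> 'e measure \<Rightarrow> ('w \<Rightarrow> 'e measure) \<Rightarrow> bool" where
  "poisson_point_process P \<mu> N \<longleftrightarrow> prob_space P \<and>
     (\<forall>\<omega>\<in>space P. sets (N \<omega>) = sets \<mu>) \<and>
     (\<forall>A\<in>sets \<mu>. (\<lambda>\<omega>. emeasure (N \<omega>) A) \<in> borel_measurable P) \<and>
     (\<forall>A\<in>sets \<mu>. emeasure \<mu> A < \<infinity> \<longrightarrow>
        (\<forall>k::nat. measure P {\<omega>\<in>space P. emeasure (N \<omega>) A = of_nat k} =
           exp (- enn2real (emeasure \<mu> A)) * enn2real (emeasure \<mu> A) ^ k / fact k)) \<and>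
     (\<forall>A\<in>sets \<mu>. emeasure \<mu> A = \<infinity> \<longrightarrow> (AE \<omega> in P. emeasure (N \<omega>) A = \<infinity>)) \<and>
     (\<forall>(F::nat \<Rightarrow> 'e set) I. finite I \<longrightarrow> disjoint_family_on F I \<longrightarrow> (\<forall>i\<in>I. F i \<in> sets \<mu>) \<longrightarrow>
        prob_space.indep_vars P (\<lambda>_. borel) (\<lambda>i \<omega>. emeasure (N \<omega>) (F i)) I)"

definition conv_in_distribution ::
  "'w measure \<Rightarrow> (nat \<Rightarrow> 'w \<Rightarrow> 'b::{metric_space,second_countable_topology}) \<Rightarrow> 'p measure \<Rightarrow> ('p \<Rightarrow> 'b) \<Rightarrow> bool" where
  "conv_in_distribution M X P Y \<longleftrightarrow> (\<forall>n. X n \<in> borel_measurable M) \<and> Y \<in> borel_measurable P \<and>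
     (\<forall>f::'b \<Rightarrow> real. continuous_on UNIV f \<and> bounded (range f) \<longrightarrow>
        (\<lambda>n. \<integral>z. f z \<partial>(distr M borel (X n))) \<longlonglongrightarrow> (\<integral>z. f z \<partial>(distr P borel Y)))"

definition conv_in_probability ::
  "'w measure \<Rightarrow> (nat \<Rightarrow> 'w \<Rightarrow> 'b::{metric_space,second_countable_topology}) \<Rightarrow> 'b \<Rightarrow> bool" where
  "conv_in_probability M X c \<longleftrightarrow> (\<forall>n. X n \<in> borel_measurable M) \<and>
     (\<forall>e>0. (\<lambda>n. measure M {\<omega>\<in>space M. dist (X n \<omega>) c > e}) \<longlonglongrightarrow> 0)"

definition attn_Z :: "(nat \<Rightarrow> real) \<Rightarrow> real^'n \<Rightarrow> (nat \<Rightarrow> 'w \<Rightarrow> real^'n) \<Rightarrow> nat \<Rightarrow> 'w \<Rightarrow> real" where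
  "attn_Z \<beta> q x n \<omega> = (\<Sum>j=1..n. exp (- \<beta> n * (1 - q \<bullet> x j \<omega>)))"

definition attn_A :: "(nat \<Rightarrow> real) \<Rightarrow> real^'n \<Rightarrow> (nat \<Rightarrow> 'w \<Rightarrow> real^'n) \<Rightarrow> nat \<Rightarrow> nat \<Rightarrow> 'w \<Rightarrow> real" where
  "attn_A \<beta> q x n i \<omega> = exp (- \<beta> n * (1 - q \<bullet> x i \<omega>)) / attn_Z \<beta> q x n \<omega>"

definition ATT :: "real^'n^'n \<Rightarrow> (nat \<Rightarrow> real) \<Rightarrow> real^'n \<Rightarrow> (nat \<Rightarrow> 'w \<Rightarrow> real^'n) \<Rightarrow> nat \<Rightarrow> 'w \<Rightarrow> real^'n" where
  "ATT V \<beta> q x n \<omega> = V *v (\<Sum>j=1..n. attn_A \<beta> q x n j \<omega> *\<^sub>R x j \<omega>)"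

definition attn_Y :: "real^'n^'n \<Rightarrow> (nat \<Rightarrow> real) \<Rightarrow> real^'n \<Rightarrow> (nat \<Rightarrow> 'w \<Rightarrow> real^'n) \<Rightarrow> nat \<Rightarrow> 'w \<Rightarrow> real^'n" where
  "attn_Y V \<beta> q x n \<omega> = V *v (\<Sum>i=1..n. attn_A \<beta> q x n i \<omega> *\<^sub>R (x i \<omega> - q))"

definition alpha_dim :: "'n::finite itself \<Rightarrow> real" where
  "alpha_dim _ = 2 / (real CARD('n) - 1)"

definition C_const :: "'n::finite itself \<Rightarrow> (real^'n \<Rightarrow> real) \<Rightarrow> real^'n \<Rightarrow> real" where
  "C_const t \<rho> q = 2 powr (1 / alpha_dim t) * sphere_area (CARD('n) - 2) / (real CARD('n) - 1) * \<rho> q"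

definition ppp_intensity :: "'n::finite itself \<Rightarrow> (real^'n \<Rightarrow> real) \<Rightarrow> real^'n \<Rightarrow> real \<Rightarrow> (real^'n) measure \<Rightarrow> (real \<times> (real^'n)) measure" where
  "ppp_intensity t \<rho> q \<gamma> \<nu> = density (lborel \<Otimes>\<^sub>M \<nu>)
     (\<lambda>(y, \<theta>). ennreal (indicator {0..} y * (C_const t \<rho> q / (alpha_dim t * \<gamma> powr (1 / alpha_dim t)))
                          * y powr (1 / alpha_dim t - 1)))"

definition ppp_num :: "(real \<times> (real^'n)) measure \<Rightarrow> real^'n" where
  "ppp_num m = (\<integral>p. (exp (- fst p) * sqrt (2 * fst p)) *\<^sub>R snd p \<partial>m)"

definition ppp_den :: "(real \<times> (real^'n)) measure \<Rightarrow> ennreal" where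
  "ppp_den m = (\<integral>\<^sup>+p. ennreal (exp (- fst p)) \<partial>m)"

definition ppp_Xi :: "(real \<times> (real^'n)) measure \<Rightarrow> real^'n" where
  "ppp_Xi m = (1 / enn2real (ppp_den m)) *\<^sub>R ppp_num m"

end

(* Put T_i = 1 - <q,x_i>. The pair (denominator, numerator) of sqrt(beta_n) * Y_n is a sum of i.i.d.
   vectors exp(- beta_n T_i) (1, sqrt(beta_n) (x_i - q)). After adding the norm of the displacement
   to each coordinate these vectors are nonnegative, so weak convergence can be read off from real
   Laplace transforms (Stone-Weierstrass in the variables exp(- s_k)). The transform of the sum is
   (1 - p_n)^n, where n p_n converges to the exponent of the Laplace functional of the Poisson
   process. For n p_n one needs the law of beta_n T_i and of the direction of x_i near q: rotation
   invariance makes height and direction independent, and the law of the height follows from the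
   area of a small spherical cap, bounded between two solid cones. The limit is transferred to the
   ratio because the limiting denominator is almost surely positive: the intensity is infinite. *)

theory Submission
  imports Defs
begin

section \<open>Weak convergence from Laplace transforms\<close>

text \<open>The obstacle is that n times the law of the height beta_n T_i converges to a measure of
  infinite mass. Limits of heights are therefore taken after tilting by exp(-y/2), which leaves
  finite measures; the summands decay fast enough to pay for the tilt. The weak limit theorem
  \<open>limit\<close> is used three times: with constant sequences, where it acts as a uniqueness
  theorem and splits the surface measure into height and direction; for the tilted heights; and for
  the sums. It needs no separate tightness argument, since mass escaping to infinity or to a
  vanishing denominator is dominated by Laplace exponentials whose integrals converge too. With m =
  d - 1 one has 1/\<alpha> = m/2. A cap of height e has area close to vol(B^m) (2e)^(m/2), and n
  beta_n^(-m/2) tends to \<gamma>^(-m/2). Differentiating the resulting multiple of y^(m/2) gives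
  the power 1/\<alpha> - 1 and, after multiplication by rho(q), the constant C(q)/(\<alpha>
  \<gamma>^(1/\<alpha>)). The factor sqrt(2y) is a rescaled chord length: |u - q|^2 = 2(1 - <q,u>)
  on the sphere.\<close>

lemma integral_diff_abs_le:
  fixes f g k :: "'w \<Rightarrow> real"
  assumes "integrable M f" "integrable M g" "integrable M k" "AE w in M. \<bar>f w - g w\<bar> \<le> k w"
  shows "\<bar>(\<integral>w. f w \<partial>M) - (\<integral>w. g w \<partial>M)\<bar> \<le> (\<integral>w. k w \<partial>M)"
proof -
  have "(\<integral>w. f w \<partial>M) - (\<integral>w. g w \<partial>M) = (\<integral>w. f w - g w \<partial>M)" using assms by simp
  also have "\<bar>\<dots>\<bar> \<le> (\<integral>w. \<bar>f w - g w\<bar> \<partial>M)" by (rule integral_abs_bound)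
  also have "\<dots> \<le> (\<integral>w. k w \<partial>M)" using assms by (intro integral_mono_AE) auto
  finally show ?thesis .
qed

text \<open>This map takes the nonnegative orthant into the compact unit cube and sends infinity to
  the face 0; polynomials in the image are combinations of Laplace exponentials.\<close>

definition exp_coords :: "'a::euclidean_space \<Rightarrow> 'a" where
  "exp_coords s = (\<Sum>b\<in>Basis. exp (- (s \<bullet> b)) *\<^sub>R b)"

lemma inner_exp_coords: "b \<in> Basis \<Longrightarrow> exp_coords s \<bullet> b = exp (- (s \<bullet> b))"
  by (simp add: exp_coords_def)

lemma continuous_on_exp_coords: "continuous_on A exp_coords"
  unfolding exp_coords_def by (intro continuous_intros)

lemma exp_coords_measurable [measurable]: "exp_coords \<in> borel_measurable borel"
  by (intro borel_measurable_continuous_onI continuous_on_exp_coords)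

lemma exp_coords_cbox: "(\<And>b. b \<in> Basis \<Longrightarrow> 0 \<le> s \<bullet> b) \<Longrightarrow> exp_coords s \<in> cbox 0 One"
  by (simp add: mem_box inner_exp_coords)

text \<open>The measures are merely finite and may vary with n, because besides probabilities the
  locale is applied to the surface measure and to exponentially tilted measures. The case
  \<open>u = 0\<close> of \<open>laplace\<close> contains the convergence of total masses.\<close>

locale laplace_limit =
  fixes M :: "nat \<Rightarrow> 'w measure" and S :: "nat \<Rightarrow> 'w \<Rightarrow> 'a::euclidean_space"
    and L :: "'p measure" and Z :: "'p \<Rightarrow> 'a"
  assumes finM: "\<And>n. finite_measure (M n)" and finL: "finite_measure L"
    and measS [measurable]: "\<And>n. S n \<in> borel_measurable (M n)"
    and measZ [measurable]: "Z \<in> borel_measurable L"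
    and posS: "\<And>n. AE w in M n. \<forall>b\<in>Basis. 0 \<le> S n w \<bullet> b"
    and posZ: "AE w in L. \<forall>b\<in>Basis. 0 \<le> Z w \<bullet> b"
    and laplace: "\<And>u. (\<And>b. b \<in> Basis \<Longrightarrow> 0 \<le> u \<bullet> b) \<Longrightarrow>
       (\<lambda>n. \<integral>w. exp (- (u \<bullet> S n w)) \<partial>M n) \<longlonglongrightarrow> (\<integral>w. exp (- (u \<bullet> Z w)) \<partial>L)"
begin

lemma integrable_bdd_S:
  fixes g :: "'a \<Rightarrow> real"
  assumes [measurable]: "g \<in> borel_measurable borel"
    and B: "\<And>s. (\<And>b. b \<in> Basis \<Longrightarrow> 0 \<le> s \<bullet> b) \<Longrightarrow> \<bar>g s\<bar> \<le> B"
  shows "integrable (M n) (\<lambda>w. g (S n w))"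
proof -
  interpret finite_measure "M n" by (rule finM)
  show ?thesis
    by (rule integrable_const_bound[where B=B]) (use posS[of n] B in \<open>auto elim!: eventually_mono\<close>)
qed

lemma integrable_bdd_Z:
  fixes g :: "'a \<Rightarrow> real"
  assumes [measurable]: "g \<in> borel_measurable borel"
    and B: "\<And>s. (\<And>b. b \<in> Basis \<Longrightarrow> 0 \<le> s \<bullet> b) \<Longrightarrow> \<bar>g s\<bar> \<le> B"
  shows "integrable L (\<lambda>w. g (Z w))"
proof -
  interpret finite_measure L by (rule finL)
  show ?thesis
    by (rule integrable_const_bound[where B=B]) (use posZ B in \<open>auto elim!: eventually_mono\<close>)
qed

text \<open>Quantifying over all \<open>u\<close> makes the class closed under multiplication by coordinates of
  \<open>exp_coords\<close>, hence by polynomials in them.\<close>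

definition lim_test :: "('a \<Rightarrow> real) \<Rightarrow> bool" where
  "lim_test g \<longleftrightarrow> g \<in> borel_measurable borel \<and>
     (\<exists>B. \<forall>s. (\<forall>b\<in>Basis. 0 \<le> s \<bullet> b) \<longrightarrow> \<bar>g s\<bar> \<le> B) \<and>
     (\<forall>u. (\<forall>b\<in>Basis. 0 \<le> u \<bullet> b) \<longrightarrow>
       (\<lambda>n. \<integral>w. g (S n w) * exp (- (u \<bullet> S n w)) \<partial>M n) \<longlonglongrightarrow> (\<integral>w. g (Z w) * exp (- (u \<bullet> Z w)) \<partial>L))"

lemma exp_le_one:
  assumes "\<And>b. b \<in> Basis \<Longrightarrow> 0 \<le> s \<bullet> b" "\<And>b. b \<in> Basis \<Longrightarrow> 0 \<le> u \<bullet> b"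
  shows "exp (- (u \<bullet> (s::'a))) \<le> 1"
proof -
  have "0 \<le> u \<bullet> s"
    by (subst euclidean_inner) (intro sum_nonneg mult_nonneg_nonneg assms)
  thus ?thesis by simp
qed

lemma lim_test_integrable:
  assumes "lim_test g" "\<And>b. b \<in> Basis \<Longrightarrow> 0 \<le> u \<bullet> b"
  shows "integrable (M n) (\<lambda>w. g (S n w) * exp (- (u \<bullet> S n w)))"
    and "integrable L (\<lambda>w. g (Z w) * exp (- (u \<bullet> Z w)))"
proof -
  obtain B where B: "\<And>s. (\<And>b. b \<in> Basis \<Longrightarrow> 0 \<le> s \<bullet> b) \<Longrightarrow> \<bar>g s\<bar> \<le> B"
    using assms unfolding lim_test_def by metis
  have [measurable]: "g \<in> borel_measurable borel" using assms by (auto simp: lim_test_def)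
  have "\<bar>g s * exp (- (u \<bullet> s))\<bar> \<le> B" if s: "\<And>b. b \<in> Basis \<Longrightarrow> 0 \<le> s \<bullet> b" for s
  proof -
    have "\<bar>g s * exp (- (u \<bullet> s))\<bar> \<le> \<bar>g s\<bar> * 1"
      unfolding abs_mult using exp_le_one[OF s assms(2)] by (intro mult_left_mono) auto
    thus ?thesis using B[OF s] by simp
  qed
  thus "integrable (M n) (\<lambda>w. g (S n w) * exp (- (u \<bullet> S n w)))"
    and "integrable L (\<lambda>w. g (Z w) * exp (- (u \<bullet> Z w)))"
    using integrable_bdd_S[of "\<lambda>s. g s * exp (- (u \<bullet> s))" B n]
      integrable_bdd_Z[of "\<lambda>s. g s * exp (- (u \<bullet> s))" B] by auto
qed

lemma lim_test_one: "lim_test (\<lambda>s. 1)"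
  by (auto simp: lim_test_def laplace)

lemma lim_test_cmult:
  assumes "lim_test g" shows "lim_test (\<lambda>s. c * g s)"
proof -
  obtain B where B: "\<forall>s. (\<forall>b\<in>Basis. 0 \<le> s \<bullet> b) \<longrightarrow> \<bar>g s\<bar> \<le> B"
    using assms by (auto simp: lim_test_def)
  hence "\<forall>s. (\<forall>b\<in>Basis. 0 \<le> s \<bullet> b) \<longrightarrow> \<bar>c * g s\<bar> \<le> \<bar>c\<bar> * B"
    by (auto simp: abs_mult intro!: mult_left_mono)
  thus ?thesis using assms
    by (auto simp: lim_test_def mult.assoc intro!: tendsto_mult_left)
qed

lemma lim_test_add:
  assumes "lim_test f" "lim_test g" shows "lim_test (\<lambda>s. f s + g s)"
proof -
  obtain B where B: "\<And>s. (\<forall>b\<in>Basis. 0 \<le> s \<bullet> b) \<Longrightarrow> \<bar>f s\<bar> \<le> B"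
    using assms by (auto simp: lim_test_def)
  obtain C where C: "\<And>s. (\<forall>b\<in>Basis. 0 \<le> s \<bullet> b) \<Longrightarrow> \<bar>g s\<bar> \<le> C"
    using assms by (auto simp: lim_test_def)
  have 1: "\<bar>f s + g s\<bar> \<le> B + C" if "\<forall>b\<in>Basis. 0 \<le> s \<bullet> b" for s
    using B[OF that] C[OF that] by linarith
  show ?thesis
    unfolding lim_test_def
  proof (intro conjI allI impI)
    show "(\<lambda>s. f s + g s) \<in> borel_measurable borel" using assms by (auto simp: lim_test_def)
    show "\<exists>B. \<forall>s. (\<forall>b\<in>Basis. 0 \<le> s \<bullet> b) \<longrightarrow> \<bar>f s + g s\<bar> \<le> B" using 1 by auto
    fix u :: 'a assume u: "\<forall>b\<in>Basis. 0 \<le> u \<bullet> b"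
    show "(\<lambda>n. \<integral>w. (f (S n w) + g (S n w)) * exp (- (u \<bullet> S n w)) \<partial>M n)
         \<longlonglongrightarrow> (\<integral>w. (f (Z w) + g (Z w)) * exp (- (u \<bullet> Z w)) \<partial>L)"
      using assms u
      by (simp add: distrib_right lim_test_integrable Bochner_Integration.integral_add)
         (auto simp: lim_test_def intro!: tendsto_add)
  qed
qed

text \<open>The extra factor moves the Laplace parameter from \<open>u\<close> to
  \<open>u + b\<close>, which stays in the nonnegative orthant.\<close>

lemma lim_test_exp:
  assumes "lim_test g" "b \<in> Basis" shows "lim_test (\<lambda>s. exp (- (s \<bullet> b)) * g s)"
proof -
  obtain B where B: "\<And>s. (\<forall>b\<in>Basis. 0 \<le> s \<bullet> b) \<Longrightarrow> \<bar>g s\<bar> \<le> B"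
    using assms by (auto simp: lim_test_def)
  have 1: "\<bar>exp (- (s \<bullet> b)) * g s\<bar> \<le> B" if s: "\<forall>b\<in>Basis. 0 \<le> s \<bullet> b" for s
  proof -
    have "\<bar>exp (- (s \<bullet> b)) * g s\<bar> \<le> 1 * \<bar>g s\<bar>"
      unfolding abs_mult using s assms(2) by (intro mult_right_mono) auto
    thus ?thesis using B[OF s] by simp
  qed
  have 2: "exp (- (s \<bullet> b)) * g s * exp (- (u \<bullet> s)) = g s * exp (- ((u + b) \<bullet> s))" for s u
    by (simp add: inner_simps exp_add exp_diff inner_commute[of b] exp_minus field_simps)
  have "0 \<le> (u + b) \<bullet> b'" if "\<forall>b\<in>Basis. 0 \<le> u \<bullet> b" "b' \<in> Basis" for u b'
    using that assms(2) by (auto simp: inner_simps inner_Basis)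
  thus ?thesis using assms 1 unfolding lim_test_def 2 by auto
qed

lemma lim_test_sum:
  assumes "finite I" "\<And>i. i \<in> I \<Longrightarrow> lim_test (g i)" shows "lim_test (\<lambda>s. \<Sum>i\<in>I. g i s)"
  using assms
proof induction
  case empty
  show ?case using lim_test_cmult[OF lim_test_one, of 0] by simp
next
  case (insert i I)
  thus ?case using lim_test_add[of "g i" "\<lambda>s. \<Sum>i\<in>I. g i s"] by simp
qed

text \<open>The spare factor \<open>g\<close> carries the product case: the second polynomial is
  absorbed into \<open>g\<close>, and the first one then acts on the result.\<close>

lemma lim_test_poly:
  assumes "real_polynomial_function p" "lim_test g"
  shows "lim_test (\<lambda>s. p (exp_coords s) * g s)"
  using assms
proof (induction arbitrary: g)
  case (linear f)
  have "f (exp_coords s) * g s = (\<Sum>b\<in>Basis. f b * (exp (- (s \<bullet> b)) * g s))" for s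
  proof -
    interpret bounded_linear f by fact
    show ?thesis by (simp add: exp_coords_def sum scaleR sum_distrib_left sum_distrib_right mult_ac)
  qed
  thus ?case using linear by (auto intro!: lim_test_sum lim_test_cmult lim_test_exp)
next
  case (const c)
  thus ?case by (rule lim_test_cmult)
next
  case (add f1 f2)
  thus ?case by (auto simp: distrib_right intro!: lim_test_add)
next
  case (mult f1 f2)
  thus ?case using mult.IH(1)[OF mult.IH(2)[OF mult.prems]] by (simp add: mult.assoc)
qed

lemma poly_limit:
  assumes "real_polynomial_function p"
  shows "(\<lambda>n. \<integral>w. p (exp_coords (S n w)) \<partial>M n) \<longlonglongrightarrow> (\<integral>w. p (exp_coords (Z w)) \<partial>L)"
  using lim_test_poly[OF assms lim_test_one] by (auto simp: lim_test_def dest: spec[of _ 0])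

lemma mass_limit: "(\<lambda>n. measure (M n) (space (M n))) \<longlonglongrightarrow> measure L (space L)"
  using laplace[of 0] by simp

text \<open>Polynomial approximation on the cube, where \<open>exp_coords\<close> takes its values.
  The total masses converge, hence are bounded by one constant \<open>C\<close>, so a uniform error
  \<open>d\<close> costs at most \<open>d * C\<close> both along the sequence and in the
  limit.\<close>

lemma continuous_limit:
  assumes F: "continuous_on UNIV (F :: 'a \<Rightarrow> real)"
  shows "(\<lambda>n. \<integral>w. F (exp_coords (S n w)) \<partial>M n) \<longlonglongrightarrow> (\<integral>w. F (exp_coords (Z w)) \<partial>L)"
proof -
  have [measurable]: "F \<in> borel_measurable borel" using F by (rule borel_measurable_continuous_onI)
  obtain C where C: "C > 0" "\<And>n. measure (M n) (space (M n)) \<le> C" "measure L (space L) \<le> C"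
  proof -
    obtain K where K: "K > 0" "\<And>n. norm (measure (M n) (space (M n))) \<le> K"
      using convergent_imp_Bseq[OF convergentI[OF mass_limit]] unfolding Bseq_def by blast
    show ?thesis
      by (rule that[of "max K (measure L (space L))"]) (use K in \<open>auto simp: le_max_iff_disj\<close>)
  qed
  have cube: "\<bar>F t\<bar> \<le> (SUP t\<in>cbox 0 One. \<bar>F t\<bar>)" if "t \<in> cbox 0 (One::'a)" for t
    by (rule cSUP_upper[OF that])
       (intro bounded_imp_bdd_above compact_imp_bounded compact_continuous_image continuous_intros
          continuous_on_subset[OF F] compact_cbox; simp)
  define BF where "BF = (SUP t\<in>cbox 0 (One::'a). \<bar>F t\<bar>)"
  have FB: "\<bar>F (exp_coords s)\<bar> \<le> BF" if "\<And>b. b \<in> Basis \<Longrightarrow> 0 \<le> s \<bullet> b" for s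
    unfolding BF_def by (intro cube exp_coords_cbox that)
  have intF: "integrable (M n) (\<lambda>w. F (exp_coords (S n w)))" "integrable L (\<lambda>w. F (exp_coords (Z w)))" for n
    using integrable_bdd_S[of "\<lambda>s. F (exp_coords s)", OF _ FB]
      integrable_bdd_Z[of "\<lambda>s. F (exp_coords s)", OF _ FB] by auto
  show ?thesis
  proof (rule LIMSEQ_I)
    fix e :: real assume e: "e > 0"
    define d where "d = e / (4 * C)"
    have d: "d > 0" "d * C = e / 4" using e C by (auto simp: d_def)
    obtain p where p: "real_polynomial_function p" "\<And>t. t \<in> cbox 0 One \<Longrightarrow> \<bar>F t - p t\<bar> < d"
      using Stone_Weierstrass_real_polynomial_function[OF compact_cbox continuous_on_subset[OF F] d(1)]
      by (metis subset_UNIV)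
    have tst: "lim_test (\<lambda>s. p (exp_coords s))" using lim_test_poly[OF p(1) lim_test_one] by simp
    have intp: "integrable (M n) (\<lambda>w. p (exp_coords (S n w)))" "integrable L (\<lambda>w. p (exp_coords (Z w)))" for n
      using lim_test_integrable[OF tst, of 0] by auto
    have ap: "\<bar>F (exp_coords s) - p (exp_coords s)\<bar> \<le> d" if "\<forall>b\<in>Basis. 0 \<le> s \<bullet> b" for s
      using p(2)[OF exp_coords_cbox[of s]] that by (auto intro: less_imp_le)
    have 1: "\<bar>(\<integral>w. F (exp_coords (S n w)) \<partial>M n) - (\<integral>w. p (exp_coords (S n w)) \<partial>M n)\<bar> \<le> e / 4" for n
    proof -
      interpret finite_measure "M n" by (rule finM)
      have "\<bar>(\<integral>w. F (exp_coords (S n w)) \<partial>M n) - (\<integral>w. p (exp_coords (S n w)) \<partial>M n)\<bar> \<le> (\<integral>w. d \<partial>M n)"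
        by (rule integral_diff_abs_le[OF intF(1) intp(1)])
           (use posS[of n] ap in \<open>auto elim!: eventually_mono\<close>)
      also have "\<dots> \<le> d * C" using C(2)[of n] d(1) by (simp add: mult.commute)
      finally show ?thesis using d(2) by simp
    qed
    have 2: "\<bar>(\<integral>w. F (exp_coords (Z w)) \<partial>L) - (\<integral>w. p (exp_coords (Z w)) \<partial>L)\<bar> \<le> e / 4"
    proof -
      interpret finite_measure L by (rule finL)
      have "\<bar>(\<integral>w. F (exp_coords (Z w)) \<partial>L) - (\<integral>w. p (exp_coords (Z w)) \<partial>L)\<bar> \<le> (\<integral>w. d \<partial>L)"
        by (rule integral_diff_abs_le[OF intF(2) intp(2)])
           (use posZ ap in \<open>auto elim!: eventually_mono\<close>)
      also have "\<dots> \<le> d * C" using C(3) d(1) by (simp add: mult.commute)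
      finally show ?thesis using d(2) by simp
    qed
    obtain N where N: "\<And>n. n \<ge> N \<Longrightarrow>
        norm ((\<integral>w. p (exp_coords (S n w)) \<partial>M n) - (\<integral>w. p (exp_coords (Z w)) \<partial>L)) < e / 4"
      using LIMSEQ_D[OF poly_limit[OF p(1)], of "e/4"] e by auto
    show "\<exists>no. \<forall>n\<ge>no. norm ((\<integral>w. F (exp_coords (S n w)) \<partial>M n) - (\<integral>w. F (exp_coords (Z w)) \<partial>L)) < e"
      using N 1 2 e by (intro exI[of _ N]) (auto simp: real_norm_def abs_less_iff abs_le_iff; smt (verit))
  qed
qed

text \<open>Dominates the indicator of the complement of a compact set on which the test functions
  of \<open>limit\<close> are continuous; it is a combination of Laplace exponentials.\<close>

definition tail_bound :: "'a \<Rightarrow> real \<Rightarrow> 'a \<Rightarrow> real" where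
  "tail_bound b0 k s = exp 1 * exp (- (k * (s \<bullet> b0))) + (\<Sum>b\<in>Basis. 2 * (1 - exp (- (s \<bullet> b / k))))"

text \<open>The constants are fitted to the two ways of leaving the good region. If
  \<open>s \<bullet> b0 < 1 / k\<close>, the first exponential is at least exp(-1), which
  \<open>exp 1\<close> lifts to 1. If some coordinate exceeds \<open>k\<close>, then 1 - exp(-1) is
  at least 1/2, which the factor 2 lifts to 1.\<close>

lemma tail_bound_ge:
  assumes "\<And>b. b \<in> Basis \<Longrightarrow> 0 \<le> s \<bullet> b" "k > 0" "b0 \<in> Basis"
  shows "0 \<le> tail_bound b0 k s"
    and "s \<bullet> b0 < 1 / k \<or> (\<exists>b\<in>Basis. k < s \<bullet> b) \<Longrightarrow> 1 \<le> tail_bound b0 k s"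
proof -
  have nn: "0 \<le> 2 * (1 - exp (- (s \<bullet> b / k)))" if "b \<in> Basis" for b using assms that by simp
  hence nns: "0 \<le> (\<Sum>b\<in>Basis. 2 * (1 - exp (- (s \<bullet> b / k))))" by (intro sum_nonneg) auto
  thus "0 \<le> tail_bound b0 k s" by (simp add: tail_bound_def)
  assume "s \<bullet> b0 < 1 / k \<or> (\<exists>b\<in>Basis. k < s \<bullet> b)"
  thus "1 \<le> tail_bound b0 k s"
  proof
    assume "s \<bullet> b0 < 1 / k"
    hence "k * (s \<bullet> b0) \<le> 1" using assms by (simp add: field_simps)
    hence "1 \<le> exp 1 * exp (- (k * (s \<bullet> b0)))" by (simp flip: exp_add)
    thus ?thesis using nns by (simp add: tail_bound_def)
  next
    assume "\<exists>b\<in>Basis. k < s \<bullet> b"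
    then obtain b where b: "b \<in> Basis" "k < s \<bullet> b" by auto
    have "exp (- (s \<bullet> b / k)) \<le> exp (-1)" using b assms by (simp add: field_simps)
    also have "exp (-1) \<le> (1/2::real)" using exp_ge_add_one_self[of 1] by (simp add: exp_minus field_simps)
    finally have "1 \<le> 2 * (1 - exp (- (s \<bullet> b / k)))" by simp
    also have "\<dots> \<le> (\<Sum>b\<in>Basis. 2 * (1 - exp (- (s \<bullet> b / k))))"
      using nn by (intro member_le_sum b) auto
    finally have "1 \<le> (\<Sum>b\<in>Basis. 2 * (1 - exp (- (s \<bullet> b / k))))" .
    thus ?thesis by (simp add: tail_bound_def add_increasing)
  qed
qed

lemma tail_bound_le:
  assumes "\<And>b. b \<in> Basis \<Longrightarrow> 0 \<le> s \<bullet> b" "k > 0" "b0 \<in> Basis"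
  shows "tail_bound b0 k s \<le> exp 1 + 2 * DIM('a)"
proof -
  have "exp 1 * exp (- (k * (s \<bullet> b0))) \<le> exp 1 * 1"
    using assms by (intro mult_left_mono) auto
  moreover have "(\<Sum>b\<in>Basis. 2 * (1 - exp (- (s \<bullet> b / k)))) \<le> (\<Sum>b\<in>(Basis::'a set). 2)"
    by (intro sum_mono) auto
  ultimately show ?thesis unfolding tail_bound_def sum_constant by linarith
qed

lemma tail_bound_lim_test:
  assumes "k > 0" "b0 \<in> Basis" shows "lim_test (tail_bound b0 k)"
proof -
  \<comment> \<open>Exponents such as 1/k are out of reach of \<open>lim_test_exp\<close>, which
    shifts by whole basis vectors; the Laplace hypothesis at \<open>u + c *\<^sub>R b\<close>
    supplies them directly.\<close>
  have scale: "lim_test (\<lambda>s. exp (- (c * (s \<bullet> b))))" if "c > 0" "b \<in> Basis" for c b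
  proof -
    have "exp (- (c * (s \<bullet> b))) * exp (- (u \<bullet> s)) = exp (- ((u + c *\<^sub>R b) \<bullet> s))" for s u
      by (simp add: inner_simps exp_add exp_diff inner_commute[of b] exp_minus field_simps)
    moreover have "0 \<le> (u + c *\<^sub>R b) \<bullet> b'" if "\<forall>b\<in>Basis. 0 \<le> u \<bullet> b" "b' \<in> Basis" for u b'
      using that \<open>c > 0\<close> \<open>b \<in> Basis\<close> by (auto simp: inner_simps inner_Basis)
    moreover have "\<exists>B. \<forall>s. (\<forall>b\<in>Basis. 0 \<le> s \<bullet> b) \<longrightarrow> \<bar>exp (- (c * (s \<bullet> b)))\<bar> \<le> B"
      using that by (intro exI[of _ 1]) auto
    ultimately show ?thesis by (auto simp: lim_test_def laplace)
  qed
  have "tail_bound b0 k = (\<lambda>s. exp 1 * exp (- (k * (s \<bullet> b0))) +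
          (\<Sum>b\<in>Basis. 2 * (1 + (-1) * exp (- ((1/k) * (s \<bullet> b))))))"
    by (auto simp: tail_bound_def)
  moreover have "lim_test \<dots>"
    by (intro lim_test_add lim_test_cmult lim_test_sum scale lim_test_one assms finite_Basis) (use assms in auto)
  ultimately show ?thesis by simp
qed

text \<open>Strict positivity of the \<open>b0\<close> coordinate of the limit kills the first
  exponential, and finiteness of the coordinates kills the sum. Hence the limit concentrates on the
  sets where the tail bound is small.\<close>

lemma tail_bound_integral_tendsto_0:
  assumes b0: "b0 \<in> Basis" and pos: "AE w in L. 0 < Z w \<bullet> b0"
  shows "(\<lambda>k. \<integral>w. tail_bound b0 (real (Suc k)) (Z w) \<partial>L) \<longlonglongrightarrow> 0"
proof -
  interpret finite_measure L by (rule finL)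
  have "(\<lambda>k. \<integral>w. tail_bound b0 (real (Suc k)) (Z w) \<partial>L) \<longlonglongrightarrow> (\<integral>w. 0 \<partial>L)"
  proof (rule integral_dominated_convergence[where w="\<lambda>_. exp 1 + 2 * DIM('a)"])
    show "AE w in L. (\<lambda>k. tail_bound b0 (real (Suc k)) (Z w)) \<longlonglongrightarrow> 0"
      using pos
    proof eventually_elim
      case (elim w)
      have k: "filterlim (\<lambda>k. real (Suc k)) at_top sequentially"
        by (rule filterlim_compose[OF filterlim_real_sequentially filterlim_Suc])
      have "(\<lambda>k. exp (- (real (Suc k) * (Z w \<bullet> b0)))) \<longlonglongrightarrow> 0"
        by (rule filterlim_compose[OF exp_at_bot])
           (simp only: filterlim_uminus_at_bot minus_minus, rule filterlim_at_top_mult_tendsto_pos[OF tendsto_const elim k])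
      moreover have "(\<lambda>k. exp (- (Z w \<bullet> b / real (Suc k)))) \<longlonglongrightarrow> exp (- 0)" for b
        by (intro tendsto_exp tendsto_minus real_tendsto_divide_at_top[OF tendsto_const k])
      ultimately have "(\<lambda>k. tail_bound b0 (real (Suc k)) (Z w)) \<longlonglongrightarrow> exp 1 * 0 + (\<Sum>b\<in>(Basis::'a set). 2 * (1 - exp (-0)))"
        unfolding tail_bound_def by (intro tendsto_add tendsto_sum tendsto_mult tendsto_diff tendsto_const)
      thus ?case by simp
    qed
    show "AE w in L. norm (tail_bound b0 (real (Suc k)) (Z w)) \<le> exp 1 + 2 * DIM('a)" for k
      using posZ by eventually_elim (use tail_bound_le[of _ "real (Suc k)"] tail_bound_ge[of _ "real (Suc k)"] b0 in auto)
  qed (auto simp: tail_bound_def)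
  thus ?thesis by simp
qed

text \<open>The test function may be discontinuous where the \<open>b0\<close> coordinate vanishes,
  which is what a quotient with denominator \<open>s \<bullet> b0\<close> requires. On a compact set
  \<open>h\<close> agrees with a continuous function of \<open>exp_coords\<close>; off it the error
  is at most \<open>2 * B * tail_bound b0 k s\<close>. The integral of that bound converges along
  the sequence, so tightness is inherited from the limit.\<close>

theorem limit:
  assumes b0: "b0 \<in> Basis" and pos: "AE w in L. 0 < Z w \<bullet> b0"
    and [measurable]: "h \<in> borel_measurable borel"
    and cont: "continuous_on {s. 0 < s \<bullet> b0 \<and> (\<forall>b\<in>Basis. 0 \<le> s \<bullet> b)} h"
    and B: "\<And>s. \<bar>h s\<bar> \<le> (B::real)"
  shows "(\<lambda>n. \<integral>w. h (S n w) \<partial>M n) \<longlonglongrightarrow> (\<integral>w. h (Z w) \<partial>L)"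
proof (rule LIMSEQ_I)
  fix e :: real assume e: "e > 0"
  have B0: "B \<ge> 0" using B[of 0] by linarith
  \<comment> \<open>The error \<open>2 * B\<close> times this quantity is at most e/4;
    \<open>B + 1\<close> rather than \<open>B\<close> guards against \<open>B = 0\<close>.\<close>
  obtain k0 where "norm ((\<integral>w. tail_bound b0 (real (Suc k0)) (Z w) \<partial>L) - 0) < e / (8 * (B + 1))"
    using LIMSEQ_D[OF tail_bound_integral_tendsto_0[OF b0 pos], of "e / (8 * (B + 1))"] e B0 by auto
  then obtain k :: real where k: "k > 0" "(\<integral>w. tail_bound b0 k (Z w) \<partial>L) < e / (8 * (B + 1))"
    by (metis abs_less_iff diff_zero of_nat_0_less_iff real_norm_def zero_less_Suc)
  \<comment> \<open>\<open>K\<close> is the region \<open>1 / k \<le> s \<bullet> b0\<close>,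
    \<open>0 \<le> s \<bullet> b \<le> k\<close> seen in exponential coordinates, and
    \<open>li\<close> inverts \<open>exp_coords\<close> on it.\<close>
  define K where "K = {t::'a. t \<bullet> b0 \<le> exp (- (1/k)) \<and> (\<forall>b\<in>Basis. exp (- k) \<le> t \<bullet> b \<and> t \<bullet> b \<le> 1)}"
  define li where "li t = (\<Sum>b\<in>Basis. (- ln (t \<bullet> b)) *\<^sub>R b)" for t :: 'a
  have inner_li: "li t \<bullet> b = - ln (t \<bullet> b)" if "b \<in> Basis" for t b
    unfolding li_def by (subst inner_sum_left_Basis[OF that]) simp
  have pK: "t \<bullet> b > 0" if "t \<in> K" "b \<in> Basis" for t b
    using that unfolding K_def by (smt (verit) exp_gt_zero mem_Collect_eq)
  have liK: "0 < li t \<bullet> b0 \<and> (\<forall>b\<in>Basis. 0 \<le> li t \<bullet> b)" if "t \<in> K" for t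
  proof -
    have "ln (t \<bullet> b0) \<le> ln (exp (- (1/k)))"
      using pK[OF that b0] that by (subst ln_le_cancel_iff) (auto simp: K_def)
    hence "ln (t \<bullet> b0) \<le> - (1/k)" by simp
    moreover have "1 / k > 0" using k by simp
    moreover have "ln (t \<bullet> b) \<le> 0" if "b \<in> Basis" for b
      using pK[OF \<open>t \<in> K\<close> that] \<open>t \<in> K\<close> that by (simp add: K_def)
    ultimately show ?thesis using b0 inner_li by (smt (verit))
  qed
  have cl: "closed K"
  proof -
    have "K = {t. t \<bullet> b0 \<le> exp (- (1/k))} \<inter> (\<Inter>b\<in>Basis. {t. exp (- k) \<le> t \<bullet> b} \<inter> {t. t \<bullet> b \<le> 1})"
      by (auto simp: K_def)
    thus ?thesis
      by (auto intro!: closed_Int closed_INT closed_Collect_le continuous_intros)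
  qed
  have cli: "continuous_on K li"
    unfolding li_def by (intro continuous_intros) (use pK in fastforce)
  have "continuous_on K (\<lambda>t. h (li t))"
    by (rule continuous_on_compose2[OF cont cli]) (use liK in auto)
  \<comment> \<open>Tietze extension keeps the bound \<open>B\<close>, so \<open>h\<close> and
    \<open>F\<close> differ by at most \<open>2 * B\<close> outside \<open>K\<close>.\<close>
  then obtain F where F: "continuous_on UNIV F" "\<And>t. t \<in> K \<Longrightarrow> F t = h (li t)" "\<And>t. norm (F t) \<le> B"
    using Tietze[of K "\<lambda>t. h (li t)" UNIV B] cl B0 B by auto
  have [measurable]: "F \<in> borel_measurable borel" using F by (intro borel_measurable_continuous_onI)
  have tst: "lim_test (tail_bound b0 k)" using tail_bound_lim_test k b0 by auto
  have diff: "\<bar>h s - F (exp_coords s)\<bar> \<le> 2 * B * tail_bound b0 k s" if s: "\<And>b. b \<in> Basis \<Longrightarrow> 0 \<le> s \<bullet> b" for s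
  proof (cases "s \<bullet> b0 < 1 / k \<or> (\<exists>b\<in>Basis. k < s \<bullet> b)")
    case True
    have "\<bar>h s - F (exp_coords s)\<bar> \<le> 2 * B * 1" using B[of s] F(3)[of "exp_coords s"] by auto
    also have "\<dots> \<le> 2 * B * tail_bound b0 k s"
      using tail_bound_ge(2)[OF s k(1) b0 True] B0 by (intro mult_left_mono) auto
    finally show ?thesis .
  next
    case False
    hence "exp_coords s \<in> K" using s b0 by (auto simp: K_def inner_exp_coords not_less)
    moreover have "li (exp_coords s) = s"
      by (rule euclidean_eqI) (simp add: inner_li inner_exp_coords)
    ultimately show ?thesis using F(2) tail_bound_ge(1)[OF s k(1) b0] B0 by simp
  qed
  have intS: "integrable (M n) (\<lambda>w. h (S n w))" "integrable (M n) (\<lambda>w. F (exp_coords (S n w)))"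
    "integrable (M n) (\<lambda>w. tail_bound b0 k (S n w))" for n
    using integrable_bdd_S[of h B n] integrable_bdd_S[of "\<lambda>s. F (exp_coords s)" B n] B F(3)
      lim_test_integrable(1)[OF tst, of 0 n] by auto
  have intZ: "integrable L (\<lambda>w. h (Z w))" "integrable L (\<lambda>w. F (exp_coords (Z w)))"
    "integrable L (\<lambda>w. tail_bound b0 k (Z w))"
    using integrable_bdd_Z[of h B] integrable_bdd_Z[of "\<lambda>s. F (exp_coords s)" B] B F(3)
      lim_test_integrable(2)[OF tst, of 0] by auto
  have dS: "\<bar>(\<integral>w. h (S n w) \<partial>M n) - (\<integral>w. F (exp_coords (S n w)) \<partial>M n)\<bar> \<le> 2 * B * (\<integral>w. tail_bound b0 k (S n w) \<partial>M n)" for n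
  proof -
    have "\<bar>(\<integral>w. h (S n w) \<partial>M n) - (\<integral>w. F (exp_coords (S n w)) \<partial>M n)\<bar> \<le> (\<integral>w. 2 * B * tail_bound b0 k (S n w) \<partial>M n)"
      by (rule integral_diff_abs_le[OF intS(1,2)])
         (use posS[of n] diff intS in \<open>auto elim!: eventually_mono\<close>)
    thus ?thesis by simp
  qed
  have dZ: "\<bar>(\<integral>w. h (Z w) \<partial>L) - (\<integral>w. F (exp_coords (Z w)) \<partial>L)\<bar> \<le> 2 * B * (\<integral>w. tail_bound b0 k (Z w) \<partial>L)"
  proof -
    have "\<bar>(\<integral>w. h (Z w) \<partial>L) - (\<integral>w. F (exp_coords (Z w)) \<partial>L)\<bar> \<le> (\<integral>w. 2 * B * tail_bound b0 k (Z w) \<partial>L)"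
      by (rule integral_diff_abs_le[OF intZ(1,2)])
         (use posZ diff intZ in \<open>auto elim!: eventually_mono\<close>)
    thus ?thesis by simp
  qed
  have tb: "(\<lambda>n. \<integral>w. tail_bound b0 k (S n w) \<partial>M n) \<longlonglongrightarrow> (\<integral>w. tail_bound b0 k (Z w) \<partial>L)"
    using tst by (auto simp: lim_test_def dest: spec[of _ 0])
  have "eventually (\<lambda>n. (\<integral>w. tail_bound b0 k (S n w) \<partial>M n) < e / (8 * (B + 1))) sequentially"
    using order_tendstoD(2)[OF tb k(2)] .
  moreover have "eventually (\<lambda>n. dist (\<integral>w. F (exp_coords (S n w)) \<partial>M n) (\<integral>w. F (exp_coords (Z w)) \<partial>L) < e/4) sequentially"
    using tendstoD[OF continuous_limit[OF F(1)], of "e/4"] e by auto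
  ultimately have "eventually (\<lambda>n. norm ((\<integral>w. h (S n w) \<partial>M n) - (\<integral>w. h (Z w) \<partial>L)) < e) sequentially"
  proof eventually_elim
    case (elim n)
    have small: "2 * B * x \<le> e / 4" if "x < e / (8 * (B + 1))" for x
    proof -
      have "2 * B * x \<le> 2 * B * (e / (8 * (B + 1)))" using that B0 by (intro mult_left_mono) auto
      also have "\<dots> = e / 4 * (B / (B + 1))" using B0 by (simp add: field_simps)
      also have "\<dots> \<le> e / 4 * 1" using e B0 by (intro mult_left_mono) auto
      finally show ?thesis by simp
    qed
    have 1: "\<bar>(\<integral>w. h (S n w) \<partial>M n) - (\<integral>w. F (exp_coords (S n w)) \<partial>M n)\<bar> \<le> e / 4"
      using dS[of n] small[OF elim(1)] by linarith
    have 2: "\<bar>(\<integral>w. h (Z w) \<partial>L) - (\<integral>w. F (exp_coords (Z w)) \<partial>L)\<bar> \<le> e / 4"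
      using dZ small[OF k(2)] by linarith
    show ?case using 1 2 elim(2) e unfolding dist_real_def real_norm_def by linarith
  qed
  thus "\<exists>no. \<forall>n\<ge>no. norm ((\<integral>w. h (S n w) \<partial>M n) - (\<integral>w. h (Z w) \<partial>L)) < e"
    by (auto simp: eventually_sequentially)
qed

end

section \<open>The Laplace functional of a Poisson point process\<close>

text \<open>The extension of exp(-x) to infinite x by 0. Since \<open>enn2real\<close> sends \<top>
  to 0, the expression \<open>exp (- enn2real x)\<close> would give 1 there and fail to be
  continuous; with this version monotone limits can be taken before the Poisson integrals are known
  to be finite.\<close>

definition enn_exp :: "ennreal \<Rightarrow> real" where
  "enn_exp x = (if x = \<top> then 0 else exp (- enn2real x))"

lemma enn_exp_ennreal: "0 \<le> r \<Longrightarrow> enn_exp (ennreal r) = exp (- r)"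
  by (simp add: enn_exp_def)

lemma enn_exp_bounds: "0 \<le> enn_exp x" "enn_exp x \<le> 1"
  by (auto simp: enn_exp_def)

lemma enn_exp_measurable [measurable]: "enn_exp \<in> borel_measurable borel"
  unfolding enn_exp_def by measurable

lemma tendsto_enn_exp:
  assumes "(X \<longlongrightarrow> x) F" shows "((\<lambda>i. enn_exp (X i)) \<longlongrightarrow> enn_exp x) F"
proof (cases "x = \<top>")
  case False
  hence "x < \<top>" by (simp add: less_top)
  hence "eventually (\<lambda>i. X i < \<top>) F" using assms by (rule order_tendstoD(2)[rotated])
  hence "eventually (\<lambda>i. exp (- enn2real (X i)) = enn_exp (X i)) F"
    by eventually_elim (auto simp: enn_exp_def)
  moreover have "((\<lambda>i. exp (- enn2real (X i))) \<longlongrightarrow> exp (- enn2real x)) F"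
    using assms \<open>x < \<top>\<close> by (intro tendsto_intros) (auto simp: ennreal_enn2real)
  ultimately show ?thesis using False by (simp add: enn_exp_def tendsto_cong)
next
  case True
  show ?thesis
  proof (rule tendstoI)
    fix e :: real assume e: "e > 0"
    have "eventually (\<lambda>i. ennreal (max 0 (- ln e)) < X i) F"
      using assms True by (intro order_tendstoD(1)) auto
    thus "eventually (\<lambda>i. dist (enn_exp (X i)) (enn_exp x) < e) F"
    proof eventually_elim
      case (elim i)
      show ?case
      proof (cases "X i")
        case (real r)
        hence "max 0 (- ln e) < r" using elim by (metis ennreal_less_iff max.cobounded1)
        hence "- ln e < r" by simp
        hence "exp (- r) < exp (ln e)" by (subst exp_less_cancel_iff) simp
        thus ?thesis using real True e by (simp add: enn_exp_ennreal) (simp add: enn_exp_def)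
      qed (use True e in \<open>auto simp: enn_exp_def\<close>)
    qed
  qed
qed

text \<open>The Laplace transform at \<open>c\<close> of a Poisson variable with mean
  \<open>l\<close>, obtained from the exponential series at \<open>l * exp (- c)\<close>.\<close>

lemma poisson_weights_sums:
  fixes l c :: real
  shows "(\<lambda>k. exp (- (c * real k)) * (exp (- l) * l ^ k / fact k)) sums exp (- (l * (1 - exp (- c))))"
proof -
  have "(\<lambda>k. exp (- l) * ((l * exp (- c)) ^ k /\<^sub>R fact k)) sums (exp (- l) * exp (l * exp (- c)))"
    by (intro sums_mult exp_converges)
  also have "(\<lambda>k. exp (- l) * ((l * exp (- c)) ^ k /\<^sub>R fact k)) =
      (\<lambda>k. exp (- (c * real k)) * (exp (- l) * l ^ k / fact k))"
    by (auto simp: power_mult_distrib exp_of_nat_mult[symmetric] field_simps)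
  finally show ?thesis by (simp add: exp_add[symmetric] algebra_simps)
qed

text \<open>Used with the identity and with r -> 1 - exp(-r) as \<open>\<phi>\<close>. The value 0
  is left out of the sum because its level set may have infinite measure, while the other level sets
  are finite as soon as the integral is.\<close>

lemma nn_integral_simple_real:
  fixes s :: "'e \<Rightarrow> real" and \<phi> :: "real \<Rightarrow> real"
  assumes s: "simple_function \<mu> s" "\<And>x. 0 \<le> s x" and K: "sets K = sets \<mu>"
    and \<phi>: "\<phi> 0 = 0" "\<And>r. 0 \<le> r \<Longrightarrow> 0 \<le> \<phi> r"
  shows "(\<integral>\<^sup>+x. ennreal (\<phi> (s x)) \<partial>K)
     = (\<Sum>r\<in>s ` space \<mu> - {0}. ennreal (\<phi> r) * emeasure K (s -` {r} \<inter> space \<mu>))"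
proof -
  have sp: "space K = space \<mu>" by (rule sets_eq_imp_space_eq[OF K])
  have fin: "finite (s ` space \<mu>)" using s by (auto simp: simple_function_def)
  have [measurable]: "s -` {r} \<inter> space \<mu> \<in> sets K" for r
    unfolding K using simple_functionD[OF s(1)] by auto
  have "(\<integral>\<^sup>+x. ennreal (\<phi> (s x)) \<partial>K)
     = (\<integral>\<^sup>+x. (\<Sum>r\<in>s ` space \<mu> - {0}. ennreal (\<phi> r) * indicator (s -` {r} \<inter> space \<mu>) x) \<partial>K)"
  proof (rule nn_integral_cong)
    fix x assume x: "x \<in> space K"
    have "(\<Sum>r\<in>s ` space \<mu> - {0}. ennreal (\<phi> r) * indicator (s -` {r} \<inter> space \<mu>) x)
       = (\<Sum>r\<in>s ` space \<mu> - {0}. if r = s x then ennreal (\<phi> r) else 0)"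
      using x sp by (intro sum.cong) (auto simp: indicator_def)
    also have "\<dots> = ennreal (\<phi> (s x))" using fin x sp \<phi> by (auto simp: sum.delta')
    finally show "ennreal (\<phi> (s x)) = (\<Sum>r\<in>s ` space \<mu> - {0}. ennreal (\<phi> r) * indicator (s -` {r} \<inter> space \<mu>) x)" ..
  qed
  also have "\<dots> = (\<Sum>r\<in>s ` space \<mu> - {0}. ennreal (\<phi> r) * emeasure K (s -` {r} \<inter> space \<mu>))"
    by (subst nn_integral_sum) (auto intro!: sum.cong nn_integral_cmult_indicator)
  finally show ?thesis .
qed

context
  fixes P :: "'w measure" and \<mu> :: "'e measure" and N :: "'w \<Rightarrow> 'e measure"
  assumes ppp: "poisson_point_process P \<mu> N"
begin

lemma ppp_prob_space: "prob_space P"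
  and ppp_sets: "w \<in> space P \<Longrightarrow> sets (N w) = sets \<mu>"
  and ppp_measurable: "A \<in> sets \<mu> \<Longrightarrow> (\<lambda>w. emeasure (N w) A) \<in> borel_measurable P"
  using ppp by (auto simp: poisson_point_process_def)

lemma ppp_space: "w \<in> space P \<Longrightarrow> space (N w) = space \<mu>"
  by (rule sets_eq_imp_space_eq[OF ppp_sets])

lemma ppp_borel_measurable: "w \<in> space P \<Longrightarrow> borel_measurable (N w) = borel_measurable \<mu>"
  by (rule measurable_cong_sets[OF ppp_sets refl])

text \<open>The definition prescribes only the probabilities of finite counts. As the Poisson
  weights sum to 1, the count is almost surely a natural number, and the expectation splits over the
  events \<open>E k\<close>.\<close>

lemma ppp_count:
  assumes A: "A \<in> sets \<mu>" "emeasure \<mu> A < \<infinity>" and c: "c \<ge> 0"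
  shows "AE w in P. \<exists>k::nat. emeasure (N w) A = of_nat k"
    and "(\<integral>w. exp (- (c * enn2real (emeasure (N w) A))) \<partial>P) = exp (- (measure \<mu> A * (1 - exp (- c))))"
proof -
  interpret prob_space P by (rule ppp_prob_space)
  note [measurable] = ppp_measurable[OF A(1)]
  define E where "E k = {w\<in>space P. emeasure (N w) A = of_nat k}" for k :: nat
  have [measurable]: "E k \<in> sets P" for k unfolding E_def by measurable
  define p where "p k = exp (- measure \<mu> A) * measure \<mu> A ^ k / fact k" for k :: nat
  have pE: "emeasure P (E k) = ennreal (p k)" for k
    using ppp A unfolding poisson_point_process_def E_def emeasure_eq_measure p_def
    by (simp add: measure_def)
  have p0: "p k \<ge> 0" for k by (simp add: p_def)
  have dis: "disjoint_family E" by (auto simp: disjoint_family_on_def E_def)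
  have sum1: "(\<Sum>k. ennreal (exp (- (c * real k)) * p k)) = ennreal (exp (- (measure \<mu> A * (1 - exp (- c)))))" for c
    using poisson_weights_sums[of c "measure \<mu> A"] p0 unfolding p_def[symmetric]
    by (intro suminf_ennreal_eq) auto
  have "emeasure P (\<Union>k. E k) = (\<Sum>k. emeasure P (E k))"
    by (rule suminf_emeasure[symmetric]) (use dis in auto)
  also have "\<dots> = 1" using sum1[of 0] by (simp add: pE)
  finally have "prob (\<Union>k. E k) = 1" by (simp add: emeasure_eq_measure)
  hence "AE w in P. w \<in> (\<Union>k. E k)" by (subst (asm) prob_eq_1) auto
  thus ae: "AE w in P. \<exists>k::nat. emeasure (N w) A = of_nat k"
    by eventually_elim (auto simp: E_def)
  have "(\<integral>\<^sup>+w. ennreal (exp (- (c * enn2real (emeasure (N w) A)))) \<partial>P)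
      = (\<integral>\<^sup>+w. (\<Sum>k. ennreal (exp (- (c * real k))) * indicator (E k) w) \<partial>P)"
  proof (rule nn_integral_cong_AE, use ae AE_space in eventually_elim)
    case (elim w)
    then obtain k :: nat where k: "emeasure (N w) A = of_nat k" by auto
    have "(\<Sum>j. ennreal (exp (- (c * real j))) * indicator (E j) w)
       = (\<Sum>j\<in>{k}. ennreal (exp (- (c * real j))) * indicator (E j) w)"
      by (rule suminf_finite) (use k elim in \<open>auto simp: E_def\<close>)
    thus ?case using k elim by (simp add: E_def)
  qed
  also have "\<dots> = (\<Sum>k. ennreal (exp (- (c * real k)) * p k))"
    by (subst nn_integral_suminf) (auto simp: nn_integral_cmult_indicator pE p0 ennreal_mult)
  also note sum1
  finally show "(\<integral>w. exp (- (c * enn2real (emeasure (N w) A))) \<partial>P) = exp (- (measure \<mu> A * (1 - exp (- c))))"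
    by (subst integral_eq_nn_integral) auto
qed

lemma ppp_counts_laplace:
  fixes I :: "nat set"
  assumes I: "finite I" "disjoint_family_on F I"
    and F: "\<And>i. i \<in> I \<Longrightarrow> F i \<in> sets \<mu>" "\<And>i. i \<in> I \<Longrightarrow> emeasure \<mu> (F i) < \<infinity>"
    and c: "\<And>i. i \<in> I \<Longrightarrow> c i \<ge> 0"
  shows "(\<integral>w. exp (- (\<Sum>i\<in>I. c i * enn2real (emeasure (N w) (F i)))) \<partial>P)
      = exp (- (\<Sum>i\<in>I. measure \<mu> (F i) * (1 - exp (- c i))))"
proof -
  interpret prob_space P by (rule ppp_prob_space)
  have "indep_vars (\<lambda>_. borel) (\<lambda>i w. emeasure (N w) (F i)) I"
    using ppp I F unfolding poisson_point_process_def by blast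
  hence ind: "indep_vars (\<lambda>_. borel) (\<lambda>i w. exp (- (c i * enn2real (emeasure (N w) (F i))))) I"
    by (rule indep_vars_compose2) auto
  have "(\<integral>w. (\<Prod>i\<in>I. exp (- (c i * enn2real (emeasure (N w) (F i))))) \<partial>P)
     = (\<Prod>i\<in>I. \<integral>w. exp (- (c i * enn2real (emeasure (N w) (F i)))) \<partial>P)"
  proof (rule indep_vars_lebesgue_integral[OF I(1) ind])
    fix i assume "i \<in> I"
    thus "integrable P (\<lambda>w. exp (- (c i * enn2real (emeasure (N w) (F i)))))"
      using ppp_measurable[OF F(1)] c by (intro integrable_const_bound[where B=1]) auto
  qed
  also have "\<dots> = (\<Prod>i\<in>I. exp (- (measure \<mu> (F i) * (1 - exp (- c i)))))"
    by (intro prod.cong refl ppp_count F c)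
  finally show ?thesis using I by (simp add: exp_sum sum_negf[symmetric])
qed

lemma ppp_integral_measurable:
  assumes "f \<in> borel_measurable \<mu>"
  shows "(\<lambda>w. \<integral>\<^sup>+x. f x \<partial>N w) \<in> borel_measurable P"
  using assms
proof (induction rule: borel_measurable_induct)
  case (cong f g)
  have "(\<integral>\<^sup>+x. f x \<partial>N w) = (\<integral>\<^sup>+x. g x \<partial>N w)" if "w \<in> space P" for w
    using cong that by (intro nn_integral_cong) (auto simp: ppp_space)
  thus ?case using cong by (simp cong: measurable_cong)
next
  case (set A)
  thus ?case using ppp_measurable[OF set] by (simp add: ppp_sets cong: measurable_cong)
next
  case (mult u c)
  have "(\<integral>\<^sup>+x. c * u x \<partial>N w) = c * (\<integral>\<^sup>+x. u x \<partial>N w)" if "w \<in> space P" for w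
    using mult that by (intro nn_integral_cmult) (simp add: ppp_borel_measurable)
  thus ?case using mult by (simp cong: measurable_cong)
next
  case (add u v)
  have "(\<integral>\<^sup>+x. v x + u x \<partial>N w) = (\<integral>\<^sup>+x. v x \<partial>N w) + (\<integral>\<^sup>+x. u x \<partial>N w)" if "w \<in> space P" for w
    using add that by (intro nn_integral_add) (simp_all add: ppp_borel_measurable)
  thus ?case using add by (simp cong: measurable_cong)
next
  case (seq U)
  have "(\<integral>\<^sup>+x. (SUP i. U i) x \<partial>N w) = (SUP i. \<integral>\<^sup>+x. U i x \<partial>N w)" if "w \<in> space P" for w
    using seq that unfolding SUP_apply
    by (intro nn_integral_monotone_convergence_SUP) (auto simp: ppp_borel_measurable)
  thus ?case using seq by (simp cong: measurable_cong)
qed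

text \<open>The integral of a simple function is a finite combination of counts on its level sets,
  which are independent Poisson variables. Finiteness of the integral forces every level set with a
  positive value to have finite intensity.\<close>

lemma ppp_laplace_simple:
  fixes s :: "'e \<Rightarrow> real"
  assumes s: "simple_function \<mu> s" "\<And>x. 0 \<le> s x" and fin: "(\<integral>\<^sup>+x. ennreal (s x) \<partial>\<mu>) < \<infinity>"
  shows "(\<integral>w. enn_exp (\<integral>\<^sup>+x. ennreal (s x) \<partial>N w) \<partial>P) = enn_exp (\<integral>\<^sup>+x. ennreal (1 - exp (- s x)) \<partial>\<mu>)"
proof -
  interpret prob_space P by (rule ppp_prob_space)
  define R where "R = s ` space \<mu> - {0}"
  have finR: "finite R" using s by (auto simp: simple_function_def R_def)
  define F where "F r = s -` {r} \<inter> space \<mu>" for r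
  have F: "F r \<in> sets \<mu>" for r using simple_functionD[OF s(1)] by (auto simp: F_def)
  have R0: "r > 0" if "r \<in> R" for r using that s(2) by (force simp: R_def less_le)
  have Ffin: "emeasure \<mu> (F r) < \<infinity>" if "r \<in> R" for r
  proof -
    have "ennreal r * emeasure \<mu> (F r) \<le> (\<Sum>r\<in>R. ennreal r * emeasure \<mu> (F r))"
      by (rule member_le_sum[OF that]) (use finR in auto)
    also have "\<dots> < \<infinity>" using nn_integral_simple_real[OF s refl, of "\<lambda>x. x"] fin by (simp add: R_def F_def)
    finally show ?thesis using R0[OF that] by (auto simp: ennreal_mult_less_top)
  qed
  \<comment> \<open>Independence of the counts is available for families indexed by natural numbers,
    so the values are numbered.\<close>
  obtain m and f :: "nat \<Rightarrow> real" where f: "bij_betw f {..<m} R"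
    using ex_bij_betw_nat_finite[OF finR] by (auto simp: atLeast0LessThan)
  have fR: "i < m \<Longrightarrow> f i \<in> R" for i using f by (auto simp: bij_betw_def)
  have dis: "disjoint_family_on (\<lambda>i. F (f i)) {..<m}"
    using f by (auto simp: disjoint_family_on_def F_def bij_betw_def inj_on_def)
  have reidx: "(\<Sum>r\<in>R. G r) = (\<Sum>i<m. G (f i))" for G :: "real \<Rightarrow> 'c::comm_monoid_add"
    using sum.reindex_bij_betw[OF f, of G] by simp
  have "AE w in P. \<forall>r\<in>R. \<exists>k::nat. emeasure (N w) (F r) = of_nat k"
    using ppp_count(1)[OF F Ffin, of _ 0] finR by (intro AE_finite_allI) auto
  hence "AE w in P. enn_exp (\<integral>\<^sup>+x. ennreal (s x) \<partial>N w) = exp (- (\<Sum>i<m. f i * enn2real (emeasure (N w) (F (f i)))))"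
    using AE_space
  proof eventually_elim
    case (elim w)
    hence ft: "emeasure (N w) (F r) < \<top>" if "r \<in> R" for r
      using elim(1) that by (metis less_top of_nat_less_top)
    have "(\<integral>\<^sup>+x. ennreal (s x) \<partial>N w) = (\<Sum>r\<in>R. ennreal r * emeasure (N w) (F r))"
      using nn_integral_simple_real[OF s ppp_sets[OF elim(2)], of "\<lambda>x. x"] by (simp add: R_def F_def)
    also have "\<dots> = (\<Sum>r\<in>R. ennreal (r * enn2real (emeasure (N w) (F r))))"
      using ft R0 by (intro sum.cong refl) (simp add: ennreal_mult ennreal_enn2real less_imp_le)
    also have "\<dots> = ennreal (\<Sum>r\<in>R. r * enn2real (emeasure (N w) (F r)))"
      by (intro sum_ennreal mult_nonneg_nonneg enn2real_nonneg less_imp_le[OF R0])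
    finally show ?case using R0
      by (subst reidx[symmetric]) (simp add: enn_exp_ennreal sum_nonneg less_imp_le)
  qed
  hence "(\<integral>w. enn_exp (\<integral>\<^sup>+x. ennreal (s x) \<partial>N w) \<partial>P) = (\<integral>w. exp (- (\<Sum>i<m. f i * enn2real (emeasure (N w) (F (f i))))) \<partial>P)"
  proof (rule integral_cong_AE[rotated 2])
    have [measurable]: "s \<in> borel_measurable \<mu>" by (rule borel_measurable_simple_function[OF s(1)])
    note [measurable] = ppp_measurable[OF F] ppp_integral_measurable[of "\<lambda>x. ennreal (s x)"]
    show "(\<lambda>w. enn_exp (\<integral>\<^sup>+x. ennreal (s x) \<partial>N w)) \<in> borel_measurable P"
      and "(\<lambda>w. exp (- (\<Sum>i<m. f i * enn2real (emeasure (N w) (F (f i)))))) \<in> borel_measurable P"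
      by measurable
  qed
  also have "\<dots> = exp (- (\<Sum>i<m. measure \<mu> (F (f i)) * (1 - exp (- f i))))"
    by (rule ppp_counts_laplace) (use dis F Ffin fR R0 in \<open>auto intro!: less_imp_le\<close>)
  also have "(\<Sum>i<m. measure \<mu> (F (f i)) * (1 - exp (- f i))) = (\<Sum>r\<in>R. measure \<mu> (F r) * (1 - exp (- r)))"
    by (rule reidx[symmetric])
  also have "exp (- \<dots>) = enn_exp (\<integral>\<^sup>+x. ennreal (1 - exp (- s x)) \<partial>\<mu>)"
  proof -
    have "(\<integral>\<^sup>+x. ennreal (1 - exp (- s x)) \<partial>\<mu>) = (\<Sum>r\<in>R. ennreal (1 - exp (- r)) * emeasure \<mu> (F r))"
      using nn_integral_simple_real[OF s refl, of "\<lambda>x. 1 - exp (- x)"] by (simp add: R_def F_def)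
    also have "\<dots> = (\<Sum>r\<in>R. ennreal (measure \<mu> (F r) * (1 - exp (- r))))"
      using Ffin R0 by (intro sum.cong refl) (auto simp: measure_def ennreal_mult' mult.commute less_imp_le)
    also have "\<dots> = ennreal (\<Sum>r\<in>R. measure \<mu> (F r) * (1 - exp (- r)))"
      using R0 by (intro sum_ennreal) (auto simp: less_imp_le)
    finally show ?thesis using R0
      by (simp add: enn_exp_ennreal sum_nonneg less_imp_le)
  qed
  finally show ?thesis .
qed

text \<open>Simple functions increase to \<open>g\<close>. On the left the integrands converge for
  every realisation and are bounded by 1; on the right monotone convergence applies because r -> 1 -
  exp(-r) is increasing.\<close>

lemma ppp_laplace_ennreal:
  fixes g :: "'e \<Rightarrow> real"
  assumes g [measurable]: "g \<in> borel_measurable \<mu>" and g0: "\<And>x. 0 \<le> g x"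
    and fin: "(\<integral>\<^sup>+x. ennreal (g x) \<partial>\<mu>) < \<infinity>"
  shows "(\<integral>w. enn_exp (\<integral>\<^sup>+x. ennreal (g x) \<partial>N w) \<partial>P) = enn_exp (\<integral>\<^sup>+x. ennreal (1 - exp (- g x)) \<partial>\<mu>)"
proof -
  interpret prob_space P by (rule ppp_prob_space)
  obtain s where s: "\<And>i. simple_function \<mu> (s i)" "incseq s" "\<And>x. bdd_above (range (\<lambda>i. s i x))"
    "\<And>i x. 0 \<le> s i x" "g = (SUP i. s i)"
    using borel_measurable_implies_simple_function_sequence_real[of g \<mu>] g0 g by blast
  have s_mono: "s i x \<le> s j x" if "i \<le> j" for i j x using s(2) that by (auto simp: incseq_def le_fun_def)
  have s_lim: "(\<lambda>i. s i x) \<longlonglongrightarrow> g x" for x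
    unfolding s(5) SUP_apply by (rule LIMSEQ_incseq_SUP[OF s(3)]) (auto simp: incseq_def s_mono)
  have s_le: "s i x \<le> g x" for i x
    by (rule incseq_le[OF _ s_lim]) (auto simp: incseq_def s_mono)
  have [measurable]: "s i \<in> borel_measurable \<mu>" for i by (rule borel_measurable_simple_function[OF s(1)])
  have mono_lim: "(\<lambda>i. \<integral>\<^sup>+x. ennreal (h (s i x)) \<partial>K) \<longlonglongrightarrow> (\<integral>\<^sup>+x. ennreal (h (g x)) \<partial>K)"
    if K: "sets K = sets \<mu>" and h: "continuous_on UNIV h" "mono h" for K and h :: "real \<Rightarrow> real"
  proof (rule nn_integral_LIMSEQ)
    have [measurable]: "h \<in> borel_measurable borel" using h by (intro borel_measurable_continuous_onI)
    show "incseq (\<lambda>i x. ennreal (h (s i x)))"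
      using s_mono h(2) by (auto simp: incseq_def le_fun_def mono_def intro!: ennreal_leI)
    show "(\<lambda>x. ennreal (h (s i x))) \<in> borel_measurable K" for i
      by (simp add: measurable_cong_sets[OF K refl])
    show "(\<lambda>i. ennreal (h (s i x))) \<longlonglongrightarrow> ennreal (h (g x))" for x
      by (intro tendsto_ennrealI continuous_on_tendsto_compose[OF h(1) s_lim]) auto
  qed
  have "(\<lambda>i. \<integral>w. enn_exp (\<integral>\<^sup>+x. ennreal (s i x) \<partial>N w) \<partial>P) \<longlonglongrightarrow> (\<integral>w. enn_exp (\<integral>\<^sup>+x. ennreal (g x) \<partial>N w) \<partial>P)"
  proof (rule integral_dominated_convergence[where w="\<lambda>_. 1"])
    show "AE w in P. (\<lambda>i. enn_exp (\<integral>\<^sup>+x. ennreal (s i x) \<partial>N w)) \<longlonglongrightarrow> enn_exp (\<integral>\<^sup>+x. ennreal (g x) \<partial>N w)"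
      using AE_space
    proof eventually_elim
      case (elim w)
      thus ?case using mono_lim[OF ppp_sets[OF elim], of "\<lambda>x. x"]
        by (intro tendsto_enn_exp) (auto simp: mono_def continuous_on_id)
    qed
  qed (auto simp: enn_exp_bounds intro!: measurable_compose[OF ppp_integral_measurable])
  moreover have "(\<lambda>i. \<integral>w. enn_exp (\<integral>\<^sup>+x. ennreal (s i x) \<partial>N w) \<partial>P) \<longlonglongrightarrow> enn_exp (\<integral>\<^sup>+x. ennreal (1 - exp (- g x)) \<partial>\<mu>)"
  proof -
    have "(\<integral>\<^sup>+x. ennreal (s i x) \<partial>\<mu>) < \<infinity>" for i
      by (rule le_less_trans[OF nn_integral_mono fin]) (auto intro!: ennreal_leI s_le)
    hence "(\<integral>w. enn_exp (\<integral>\<^sup>+x. ennreal (s i x) \<partial>N w) \<partial>P) = enn_exp (\<integral>\<^sup>+x. ennreal (1 - exp (- s i x)) \<partial>\<mu>)" for i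
      using s by (intro ppp_laplace_simple) auto
    moreover have "(\<lambda>i. \<integral>\<^sup>+x. ennreal (1 - exp (- s i x)) \<partial>\<mu>) \<longlonglongrightarrow> (\<integral>\<^sup>+x. ennreal (1 - exp (- g x)) \<partial>\<mu>)"
      by (rule mono_lim[OF refl]) (auto simp: mono_def intro!: continuous_intros)
    ultimately show ?thesis by (simp add: tendsto_enn_exp)
  qed
  ultimately show ?thesis by (rule LIMSEQ_unique)
qed

text \<open>For every \<open>u > 0\<close> the variable exp(-u X), read as 0 where X is infinite, is
  bounded by the indicator of finiteness. Its mean is at least \<open>exp (- (u * G))\<close>
  because 1 - exp(-z) is at most z; letting \<open>u\<close> tend to 0 gives probability 1.\<close>

lemma ppp_integral_finite:
  fixes g :: "'e \<Rightarrow> real"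
  assumes g [measurable]: "g \<in> borel_measurable \<mu>" and g0: "\<And>x. 0 \<le> g x"
    and fin: "(\<integral>\<^sup>+x. ennreal (g x) \<partial>\<mu>) < \<infinity>"
  shows "AE w in P. (\<integral>\<^sup>+x. ennreal (g x) \<partial>N w) < \<infinity>"
proof -
  let ?X = "\<lambda>w. \<integral>\<^sup>+x. ennreal (g x) \<partial>N w"
  interpret prob_space P by (rule ppp_prob_space)
  note meas [measurable] = ppp_integral_measurable[of "\<lambda>x. ennreal (g x)"]
  define E where "E = {w\<in>space P. (?X w) < \<infinity>}"
  have [measurable]: "E \<in> sets P" unfolding E_def by measurable
  define G where "G = enn2real (\<integral>\<^sup>+x. ennreal (g x) \<partial>\<mu>)"
  have lower: "exp (- (u * G)) \<le> prob E" if u: "u > 0" for u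
  proof -
    have scale: "(\<integral>\<^sup>+x. ennreal (u * g x) \<partial>K) = ennreal u * (\<integral>\<^sup>+x. ennreal (g x) \<partial>K)"
      if "sets K = sets \<mu>" for K
      using u g0 g by (subst nn_integral_cmult[symmetric])
        (auto simp: ennreal_mult measurable_cong_sets[OF that refl])
    have fu: "(\<integral>\<^sup>+x. ennreal (u * g x) \<partial>\<mu>) = ennreal (u * G)"
      using scale[OF refl] fin u by (simp add: G_def ennreal_mult)
    have "(\<integral>\<^sup>+x. ennreal (1 - exp (- (u * g x))) \<partial>\<mu>) \<le> (\<integral>\<^sup>+x. ennreal (u * g x) \<partial>\<mu>)"
      by (intro nn_integral_mono ennreal_leI) (use exp_ge_add_one_self in \<open>smt (verit)\<close>)
    also note fu
    finally have le: "(\<integral>\<^sup>+x. ennreal (1 - exp (- (u * g x))) \<partial>\<mu>) \<le> ennreal (u * G)" .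
    have G0: "G \<ge> 0" by (simp add: G_def)
    have "exp (- (u * G)) \<le> enn_exp (\<integral>\<^sup>+x. ennreal (1 - exp (- (u * g x))) \<partial>\<mu>)"
      using le G0 u by (cases "(\<integral>\<^sup>+x. ennreal (1 - exp (- (u * g x))) \<partial>\<mu>)") (auto simp: enn_exp_ennreal top_unique)
    also have "\<dots> = (\<integral>w. enn_exp (\<integral>\<^sup>+x. ennreal (u * g x) \<partial>N w) \<partial>P)"
      by (rule ppp_laplace_ennreal[symmetric]) (use g0 u fu in auto)
    also have "\<dots> \<le> (\<integral>w. indicator E w \<partial>P)"
    proof (rule integral_mono)
      show "integrable P (\<lambda>w. enn_exp (\<integral>\<^sup>+x. ennreal (u * g x) \<partial>N w))"
        by (rule integrable_const_bound[where B=1])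
           (auto simp: enn_exp_bounds intro!: measurable_compose[OF ppp_integral_measurable])
      fix w assume w: "w \<in> space P"
      show "enn_exp (\<integral>\<^sup>+x. ennreal (u * g x) \<partial>N w) \<le> indicator E w"
      proof (cases "w \<in> E")
        case False
        hence "(\<integral>\<^sup>+x. ennreal (u * g x) \<partial>N w) = \<top>"
          using w u scale[OF ppp_sets[OF w]] by (auto simp: E_def less_top[symmetric] ennreal_mult_eq_top_iff)
        thus ?thesis by (simp add: enn_exp_def)
      qed (auto simp: enn_exp_bounds)
    qed (auto intro!: integrable_real_indicator simp: emeasure_eq_measure)
    finally show ?thesis by simp
  qed
  have "(\<lambda>k. exp (- (inverse (real (Suc k)) * G))) \<longlonglongrightarrow> exp (- (0 * G))"
    by (intro tendsto_intros LIMSEQ_inverse_real_of_nat)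
  hence "exp (- (0 * G)) \<le> prob E" by (rule LIMSEQ_le_const2) (use lower in auto)
  hence "prob E = 1" using prob_le_1[of E] by simp
  hence "AE w in P. w \<in> E" by (subst (asm) prob_eq_1) auto
  thus ?thesis by eventually_elim (auto simp: E_def)
qed

lemma ppp_laplace:
  fixes g :: "'e \<Rightarrow> real"
  assumes g [measurable]: "g \<in> borel_measurable \<mu>" and g0: "\<And>x. 0 \<le> g x"
    and fin: "(\<integral>\<^sup>+x. ennreal (g x) \<partial>\<mu>) < \<infinity>"
  shows "(\<integral>w. exp (- enn2real (\<integral>\<^sup>+x. ennreal (g x) \<partial>N w)) \<partial>P) = exp (- (\<integral>x. 1 - exp (- g x) \<partial>\<mu>))"
proof -
  let ?X = "\<lambda>w. \<integral>\<^sup>+x. ennreal (g x) \<partial>N w"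
  have "(\<integral>w. exp (- enn2real (?X w)) \<partial>P) = (\<integral>w. enn_exp (?X w) \<partial>P)"
  proof (rule integral_cong_AE)
    show "AE w in P. exp (- enn2real (?X w)) = enn_exp (?X w)"
      using ppp_integral_finite[OF assms] by eventually_elim (auto simp: enn_exp_def)
  qed (use ppp_integral_measurable[of "\<lambda>x. ennreal (g x)"] in measurable)
  also have "\<dots> = enn_exp (\<integral>\<^sup>+x. ennreal (1 - exp (- g x)) \<partial>\<mu>)" by (rule ppp_laplace_ennreal[OF assms])
  also have "\<dots> = exp (- (\<integral>x. 1 - exp (- g x) \<partial>\<mu>))"
  proof -
    have "(\<integral>\<^sup>+x. ennreal (1 - exp (- g x)) \<partial>\<mu>) \<le> (\<integral>\<^sup>+x. ennreal (g x) \<partial>\<mu>)"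
      by (intro nn_integral_mono ennreal_leI) (use exp_ge_add_one_self in \<open>smt (verit)\<close>)
    hence "(\<integral>\<^sup>+x. ennreal (1 - exp (- g x)) \<partial>\<mu>) < \<infinity>" using fin by (rule le_less_trans)
    thus ?thesis by (subst integral_eq_nn_integral) (use g0 in \<open>auto simp: enn_exp_def\<close>)
  qed
  finally show ?thesis .
qed

end

section \<open>Surface measure on the sphere\<close>

lemma lborel_nn_integral_translate:
  fixes h :: "'a::euclidean_space \<Rightarrow> ennreal"
  assumes [measurable]: "h \<in> borel_measurable borel"
  shows "(\<integral>\<^sup>+x. h (x + t) \<partial>lborel) = (\<integral>\<^sup>+x. h x \<partial>lborel)"
proof -
  have "(\<integral>\<^sup>+x. h x \<partial>lborel) = (\<integral>\<^sup>+x. h x \<partial>distr lborel borel ((+) t))"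
    by (simp only: lborel_distr_plus)
  thus ?thesis by (simp add: nn_integral_distr add.commute)
qed

text \<open>Exchanging two invariant integrals determines a translation-invariant measure up to its
  mass on the unit ball; this yields orthogonal invariance without determinants.\<close>

lemma translation_invariant_swap:
  fixes \<mu> :: "'a::euclidean_space measure" and f g :: "'a \<Rightarrow> ennreal"
  assumes \<mu>: "sigma_finite_measure \<mu>" "sets \<mu> = sets borel"
    and inv: "\<And>h t. h \<in> borel_measurable borel \<Longrightarrow> (\<integral>\<^sup>+x. h (x + t) \<partial>\<mu>) = (\<integral>\<^sup>+x. h x \<partial>\<mu>)"
    and f [measurable]: "f \<in> borel_measurable borel" and g [measurable]: "g \<in> borel_measurable borel"
  shows "(\<integral>\<^sup>+x. f x \<partial>\<mu>) * (\<integral>\<^sup>+x. g x \<partial>lborel) = (\<integral>\<^sup>+x. g x \<partial>\<mu>) * (\<integral>\<^sup>+x. f (- x) \<partial>lborel)"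
proof -
  interpret M: sigma_finite_measure \<mu> by fact
  interpret pair_sigma_finite \<mu> lborel
    by (intro pair_sigma_finite.intro \<mu> sigma_finite_lborel)
  note [measurable_cong] = \<mu>(2)
  have "(\<integral>\<^sup>+x. f x \<partial>\<mu>) * (\<integral>\<^sup>+x. g x \<partial>lborel) = (\<integral>\<^sup>+x. \<integral>\<^sup>+y. f x * g (y + x) \<partial>lborel \<partial>\<mu>)"
    by (simp add: nn_integral_cmult nn_integral_multc lborel_nn_integral_translate)
  also have "\<dots> = (\<integral>\<^sup>+y. \<integral>\<^sup>+x. f x * g (y + x) \<partial>\<mu> \<partial>lborel)"
    by (rule Fubini'[symmetric]) measurable
  also have "\<dots> = (\<integral>\<^sup>+y. \<integral>\<^sup>+x. f (x - y) * g x \<partial>\<mu> \<partial>lborel)"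
    using inv[of "\<lambda>x. f (x - y) * g x" y for y] by (simp add: add.commute)
  also have "\<dots> = (\<integral>\<^sup>+x. \<integral>\<^sup>+y. f (x - y) * g x \<partial>lborel \<partial>\<mu>)"
    by (rule Fubini') measurable
  also have "\<dots> = (\<integral>\<^sup>+x. (\<integral>\<^sup>+y. f (- y) \<partial>lborel) * g x \<partial>\<mu>)"
  proof (rule nn_integral_cong)
    fix x
    have "(\<integral>\<^sup>+y. f (x - y) * g x \<partial>lborel) = (\<integral>\<^sup>+y. f (x - y) \<partial>lborel) * g x"
      by (rule nn_integral_multc) measurable
    also have "(\<integral>\<^sup>+y. f (x - y) \<partial>lborel) = (\<integral>\<^sup>+y. f (- y) \<partial>lborel)"
      using lborel_nn_integral_translate[of "\<lambda>y. f (x - y)" x] by simp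
    finally show "(\<integral>\<^sup>+y. f (x - y) * g x \<partial>lborel) = (\<integral>\<^sup>+y. f (- y) \<partial>lborel) * g x" .
  qed
  also have "\<dots> = (\<integral>\<^sup>+y. f (- y) \<partial>lborel) * (\<integral>\<^sup>+x. g x \<partial>\<mu>)"
    by (rule nn_integral_cmult) measurable
  finally show ?thesis by (simp add: mult.commute)
qed

lemma emeasure_unit_ball_pos_finite:
  "0 < emeasure lborel (ball (0::'a::euclidean_space) 1)" "emeasure lborel (ball (0::'a) 1) < \<infinity>"
  by (simp_all add: emeasure_ball emeasure_lborel_ball_finite unit_ball_vol_pos)

lemma orthogonal_transformation_measurable:
  "orthogonal_transformation (U :: 'a::euclidean_space \<Rightarrow> 'a) \<Longrightarrow> U \<in> borel_measurable borel"
  by (intro borel_measurable_continuous_onI linear_continuous_on linear_conv_bounded_linear[THEN iffD1]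
      orthogonal_transformation_linear)

text \<open>The swap identity is applied to the image of \<open>lborel\<close> under
  \<open>U\<close> and to \<open>lborel\<close> itself, with \<open>g\<close> the indicator of the
  unit ball. The ball is invariant, so the right-hand sides agree, and its measure is positive and
  finite and cancels on the left.\<close>

lemma lborel_nn_integral_orthogonal:
  fixes f :: "'a::euclidean_space \<Rightarrow> ennreal"
  assumes U: "orthogonal_transformation (U :: 'a \<Rightarrow> 'a)" and f [measurable]: "f \<in> borel_measurable borel"
  shows "(\<integral>\<^sup>+x. f (U x) \<partial>lborel) = (\<integral>\<^sup>+x. f x \<partial>lborel)"
proof -
  note [measurable] = orthogonal_transformation_measurable[OF U]
  define \<mu> where "\<mu> = distr lborel borel U"
  define g :: "'a \<Rightarrow> ennreal" where "g = indicator (ball 0 1)"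
  have [measurable]: "g \<in> borel_measurable borel" by (simp add: g_def borel_measurable_indicator)
  obtain V where V: "orthogonal_transformation V" "\<And>x. U (V x) = x" "\<And>x. V (U x) = x"
    using orthogonal_transformation_inv[OF U] orthogonal_transformation_inj[OF U]
      orthogonal_transformation_surj[OF U] by (metis inv_f_f surj_f_inv_f)
  have gU: "g (U x) = g x" for x
    by (simp add: g_def indicator_def orthogonal_transformation_norm[OF U])
  have sf: "sigma_finite_measure \<mu>"
  proof -
    have [measurable]: "V \<in> borel_measurable borel" by (rule orthogonal_transformation_measurable[OF V(1)])
    define B where "B n = ball (0::'a) (real n)" for n
    have "U -` B n = B n" for n
      by (auto simp: B_def orthogonal_transformation_norm[OF U])
    hence "emeasure \<mu> (B n) = emeasure lborel (B n)" for n
      by (simp add: \<mu>_def emeasure_distr B_def)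
    hence fin: "emeasure \<mu> (B n) \<noteq> \<infinity>" for n
      using emeasure_lborel_ball_finite[of "0::'a" "real n"] by (simp add: B_def)
    have cover: "\<Union> (range B) = space \<mu>"
    proof -
      have "x \<in> (\<Union>n. B n)" for x
        using reals_Archimedean2[of "norm x"] unfolding B_def by (metis UN_iff UNIV_I mem_ball_0)
      thus ?thesis by (auto simp: \<mu>_def)
    qed
    show ?thesis
      by (intro sigma_finite_measure.intro exI[of _ "range B"] conjI ballI)
         (use fin cover in \<open>auto simp: \<mu>_def B_def\<close>)
  qed
  have inv: "(\<integral>\<^sup>+x. h (x + t) \<partial>\<mu>) = (\<integral>\<^sup>+x. h x \<partial>\<mu>)" if [measurable]: "h \<in> borel_measurable borel" for h :: "'a \<Rightarrow> ennreal" and t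
  proof -
    have "(\<integral>\<^sup>+x. h (U (x + V t)) \<partial>lborel) = (\<integral>\<^sup>+x. h (U x) \<partial>lborel)"
      by (rule lborel_nn_integral_translate[of "\<lambda>x. h (U x)"]) measurable
    thus ?thesis using V(2)
      by (simp add: \<mu>_def nn_integral_distr linear_add[OF orthogonal_transformation_linear[OF U]])
  qed
  have 1: "(\<integral>\<^sup>+x. f x \<partial>\<mu>) * (\<integral>\<^sup>+x. g x \<partial>lborel) = (\<integral>\<^sup>+x. g x \<partial>\<mu>) * (\<integral>\<^sup>+x. f (- x) \<partial>lborel)"
    by (rule translation_invariant_swap[OF sf _ inv]) (auto simp: \<mu>_def)
  have 2: "(\<integral>\<^sup>+x. f x \<partial>lborel) * (\<integral>\<^sup>+x. g x \<partial>lborel) = (\<integral>\<^sup>+x. g x \<partial>lborel) * (\<integral>\<^sup>+x. f (- x) \<partial>lborel)"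
    by (rule translation_invariant_swap[OF sigma_finite_lborel _ lborel_nn_integral_translate]) auto
  have "(\<integral>\<^sup>+x. g x \<partial>\<mu>) = (\<integral>\<^sup>+x. g x \<partial>lborel)" by (simp add: \<mu>_def nn_integral_distr gU)
  hence "(\<integral>\<^sup>+x. f x \<partial>\<mu>) * (\<integral>\<^sup>+x. g x \<partial>lborel) = (\<integral>\<^sup>+x. f x \<partial>lborel) * (\<integral>\<^sup>+x. g x \<partial>lborel)"
    using 1 2 by simp
  moreover have "(\<integral>\<^sup>+x. g x \<partial>lborel) = emeasure lborel (ball (0::'a) 1)" by (simp add: g_def)
  ultimately have "(\<integral>\<^sup>+x. f x \<partial>\<mu>) = (\<integral>\<^sup>+x. f x \<partial>lborel)"
    using emeasure_unit_ball_pos_finite[where 'a='a] by (auto simp: mult.commute[of _ "emeasure _ _"] ennreal_mult_cancel_left)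
  thus ?thesis by (simp add: \<mu>_def nn_integral_distr)
qed

section \<open>The surface measure as an image of Lebesgue measure on the punctured ball\<close>

lemma sgn_borel_measurable [measurable]: "(sgn :: 'a::euclidean_space \<Rightarrow> 'a) \<in> borel_measurable borel"
  unfolding sgn_div_norm[abs_def] by measurable

text \<open>A \<open>measure_of\<close> construction has the intended values only if the set
  function is a measure. Recognising the cone over \<open>A\<close> as the part of the punctured
  unit ball mapped into \<open>A\<close> by \<open>sgn\<close> exhibits it as a scaled image
  measure.\<close>

lemma sphere_surface_measure_eq:
  "(sphere_surface_measure :: 'a::euclidean_space measure) = scale_measure (of_nat DIM('a))
     (distr (density lborel (indicator {z. 0 < norm z \<and> norm z \<le> 1})) borel sgn)" (is "_ = ?R")
proof -
  have "emeasure ?R A = of_nat DIM('a) * emeasure lborel {t *\<^sub>R u | t u. 0 < t \<and> t \<le> 1 \<and> u \<in> A \<inter> sphere 0 1}"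
    if [measurable]: "A \<in> sets borel" for A
  proof -
    have eq: "{t *\<^sub>R u | t u. 0 < t \<and> t \<le> 1 \<and> u \<in> A \<inter> sphere 0 1} = {z. 0 < norm z \<and> norm z \<le> 1} \<inter> sgn -` A"
    proof (intro set_eqI iffI)
      fix z assume "z \<in> {t *\<^sub>R u | t u. 0 < t \<and> t \<le> 1 \<and> u \<in> A \<inter> sphere 0 1}"
      thus "z \<in> {z. 0 < norm z \<and> norm z \<le> 1} \<inter> sgn -` A"
        by (auto simp: sgn_div_norm)
    next
      fix z assume z: "z \<in> {z. 0 < norm z \<and> norm z \<le> 1} \<inter> sgn -` A"
      hence "z = norm z *\<^sub>R sgn z" by (auto simp: sgn_div_norm)
      moreover have "norm (sgn z) = 1" using z by (auto simp: norm_sgn)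
      ultimately show "z \<in> {t *\<^sub>R u | t u. 0 < t \<and> t \<le> 1 \<and> u \<in> A \<inter> sphere 0 1}"
        using z by (auto intro!: exI[of _ "norm z"] exI[of _ "sgn z"])
    qed
    have [measurable]: "sgn -` A \<in> sets (borel :: 'a measure)"
      using measurable_sets_borel[OF sgn_borel_measurable that] by simp
    have "emeasure ?R A = of_nat DIM('a) * (\<integral>\<^sup>+z. indicator {z. 0 < norm z \<and> norm z \<le> 1} z * indicator (sgn -` A) z \<partial>(lborel :: 'a measure))"
      by (simp add: emeasure_distr emeasure_density)
    also have "(\<integral>\<^sup>+z. indicator {z. 0 < norm z \<and> norm z \<le> 1} z * indicator (sgn -` A) z \<partial>(lborel :: 'a measure))
        = emeasure lborel ({z. 0 < norm z \<and> norm z \<le> 1} \<inter> sgn -` A)"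
      by (simp add: indicator_inter_arith[symmetric] nn_integral_indicator)
    finally show ?thesis by (simp only: eq)
  qed
  hence "sphere_surface_measure = measure_of UNIV (sets borel) (emeasure ?R)"
    unfolding sphere_surface_measure_def
    using sets.sigma_sets_eq[of "borel :: 'a measure"] by (intro measure_of_eq) auto
  also have "\<dots> = ?R" using measure_of_of_measure[of ?R] by (simp add: space_scale_measure)
  finally show ?thesis .
qed

lemma sets_sphere_surface_measure [simp, measurable_cong]: "sets sphere_surface_measure = sets borel"
  by (simp add: sphere_surface_measure_eq)

lemma space_sphere_surface_measure [simp]: "space sphere_surface_measure = UNIV"
  by (simp add: sphere_surface_measure_eq space_scale_measure)

lemma nn_integral_sphere_surface_measure:
  fixes f :: "'a::euclidean_space \<Rightarrow> ennreal"
  assumes [measurable]: "f \<in> borel_measurable borel"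
  shows "(\<integral>\<^sup>+u. f u \<partial>sphere_surface_measure)
     = of_nat DIM('a) * (\<integral>\<^sup>+z. indicator {z. 0 < norm z \<and> norm z \<le> 1} z * f (sgn z) \<partial>lborel)"
  by (simp add: sphere_surface_measure_eq nn_integral_scale_measure nn_integral_distr nn_integral_density)

lemma finite_measure_sphere_surface_measure: "finite_measure (sphere_surface_measure :: 'a::euclidean_space measure)"
proof
  have "emeasure (sphere_surface_measure :: 'a measure) UNIV
      = of_nat DIM('a) * emeasure lborel {z::'a. 0 < norm z \<and> norm z \<le> 1}"
    using nn_integral_sphere_surface_measure[of "\<lambda>_::'a. 1"] by simp
  also have "\<dots> \<le> of_nat DIM('a) * emeasure lborel (cball (0::'a) 1)"
    by (intro mult_left_mono emeasure_mono) auto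
  also have "\<dots> < \<infinity>" using emeasure_lborel_cball_finite[of "0::'a" 1]
    by (simp add: ennreal_mult_less_top of_nat_less_top)
  finally show "emeasure (sphere_surface_measure :: 'a measure) (space sphere_surface_measure) \<noteq> \<infinity>" by simp
qed

lemma AE_sphere_surface_measure:
  fixes Q :: "'a::euclidean_space \<Rightarrow> bool"
  assumes [measurable]: "Measurable.pred borel Q" and ae: "AE z in lborel. z \<noteq> 0 \<longrightarrow> Q (sgn z)"
  shows "AE u in sphere_surface_measure. Q u"
proof -
  have "emeasure sphere_surface_measure {u. \<not> Q u} = (\<integral>\<^sup>+u. indicator {u. \<not> Q u} u \<partial>sphere_surface_measure)"
    by simp
  also have "\<dots> = 0"
    by (subst nn_integral_sphere_surface_measure) (use ae in \<open>auto simp: nn_integral_0_iff_AE elim!: eventually_mono split: split_indicator\<close>)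
  finally show ?thesis by (subst AE_iff_measurable[OF _ refl]) auto
qed

lemma AE_sphere_surface_measure_norm: "AE u in sphere_surface_measure. norm (u::'a::euclidean_space) = 1"
  by (rule AE_sphere_surface_measure) (auto simp: norm_sgn)

text \<open>Invariance descends from Lebesgue measure because \<open>U\<close> commutes with
  \<open>sgn\<close> and preserves the punctured ball.\<close>

lemma sphere_surface_measure_orthogonal:
  fixes f :: "'a::euclidean_space \<Rightarrow> ennreal"
  assumes U: "orthogonal_transformation (U :: 'a \<Rightarrow> 'a)" and [measurable]: "f \<in> borel_measurable borel"
  shows "(\<integral>\<^sup>+u. f (U u) \<partial>sphere_surface_measure) = (\<integral>\<^sup>+u. f u \<partial>sphere_surface_measure)"
proof -
  note [measurable] = orthogonal_transformation_measurable[OF U]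
  have "U (sgn z) = sgn (U z)" for z
    by (simp add: sgn_div_norm orthogonal_transformation_norm[OF U] orthogonal_transformation_scaleR[OF U])
  moreover have "U z = 0 \<longleftrightarrow> z = 0" for z
    using orthogonal_transformation_norm[OF U, of z] by (metis norm_eq_zero)
  ultimately show ?thesis
    using lborel_nn_integral_orthogonal[OF U, of "\<lambda>z. indicator {z. 0 < norm z \<and> norm z \<le> 1} z * f (sgn z)"]
    by (simp add: nn_integral_sphere_surface_measure orthogonal_transformation_norm[OF U] indicator_def)
qed

text \<open>The reflection in the hyperplane orthogonal to \<open>v - w\<close>. Equal norms make it
  send \<open>v\<close> to \<open>w\<close>, and it fixes every vector orthogonal to both, so a
  rotation of directions can be chosen that keeps the pole fixed.\<close>

lemma householder_exists:
  fixes v w :: "'a::euclidean_space"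
  assumes "norm v = norm w"
  obtains U where "orthogonal_transformation U" "U v = w" "\<And>q. q \<bullet> v = 0 \<Longrightarrow> q \<bullet> w = 0 \<Longrightarrow> U q = q"
proof (cases "v = w")
  case True
  thus ?thesis using that[of "\<lambda>x. x"] by simp
next
  case False
  define a where "a = v - w"
  have a: "a \<bullet> a \<noteq> 0" using False by (simp add: a_def)
  define U where "U x = x - (2 * (x \<bullet> a) / (a \<bullet> a)) *\<^sub>R a" for x
  have lin: "linear U"
    by (rule linearI) (simp_all add: U_def inner_add_left scaleR_add_left scaleR_diff_right add_divide_distrib ring_distribs)
  have "U x \<bullet> U y = x \<bullet> y" for x y
  proof -
    define c where "c = 2 / (a \<bullet> a)"
    have c: "c * (a \<bullet> a) = 2" using a by (simp add: c_def)
    have "U x \<bullet> U y = x \<bullet> y - c * (x \<bullet> a) * (y \<bullet> a) * (2 - c * (a \<bullet> a))"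
      by (simp add: U_def c_def inner_simps inner_commute[of a y] algebra_simps)
    thus ?thesis by (simp add: c)
  qed
  hence "orthogonal_transformation U" using lin by (simp add: orthogonal_transformation_def)
  moreover have "U v = w"
  proof -
    have "v \<bullet> v = w \<bullet> w" using assms by (metis norm_eq)
    hence "2 * (v \<bullet> a) = a \<bullet> a" by (simp add: a_def inner_simps inner_commute)
    thus ?thesis using a by (simp add: U_def) (simp add: a_def)
  qed
  moreover have "U q = q" if "q \<bullet> v = 0" "q \<bullet> w = 0" for q
    using that by (simp add: U_def a_def inner_simps)
  ultimately show ?thesis by (rule that)
qed

section \<open>Area of small spherical caps via solid cones\<close>

lemma emeasure_solid_cone:
  fixes b :: "'a::euclidean_space"
  assumes b: "b \<in> Basis" and a: "a > 0" and h: "h > 0" and m: "DIM('a) = Suc m"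
  shows "emeasure lborel {z. 0 < z \<bullet> b \<and> z \<bullet> b \<le> h \<and> z \<bullet> z - (z \<bullet> b)\<^sup>2 \<le> (a * (z \<bullet> b))\<^sup>2}
     = ennreal (unit_ball_vol (real m) * a ^ m * h ^ Suc m / real (Suc m))"
proof -
  interpret product_sigma_finite "\<lambda>_. lborel :: real measure" by standard
  define I where "I = Basis - {b}"
  have I: "finite I" "b \<notin> I" "insert b I = Basis" "card I = m"
    using b m by (auto simp: I_def)
  define D where "D = {z. 0 < z \<bullet> b \<and> z \<bullet> b \<le> h \<and> z \<bullet> z - (z \<bullet> b)\<^sup>2 \<le> (a * (z \<bullet> b))\<^sup>2}"
  have [measurable]: "D \<in> sets borel" unfolding D_def by measurable
  define vec where "vec f = (\<Sum>i\<in>Basis. f i *\<^sub>R i)" for f :: "'a \<Rightarrow> real"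
  have [measurable]: "vec \<in> borel_measurable (PiM (insert b I) (\<lambda>_. lborel))"
    unfolding vec_def I(3) by measurable
  have [measurable]: "vec \<in> borel_measurable (PiM Basis (\<lambda>_. lborel))"
    unfolding vec_def by measurable
  have vecb: "vec f \<bullet> i = f i" if "i \<in> Basis" for f i
    using that by (simp add: vec_def)
  have ip: "vec (x(b := y)) \<bullet> vec (x(b := y)) = y\<^sup>2 + (\<Sum>i\<in>I. (x i)\<^sup>2)" for x y
  proof -
    have "vec (x(b := y)) \<bullet> vec (x(b := y)) = (\<Sum>i\<in>insert b I. ((x(b := y)) i)\<^sup>2)"
      by (subst euclidean_inner) (simp add: vecb I(3) power2_eq_square)
    also have "\<dots> = y\<^sup>2 + (\<Sum>i\<in>I. ((x(b := y)) i)\<^sup>2)"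
      by (subst sum.insert[OF I(1,2)]) simp
    also have "(\<Sum>i\<in>I. ((x(b := y)) i)\<^sup>2) = (\<Sum>i\<in>I. (x i)\<^sup>2)" using I by (intro sum.cong) auto
    finally show ?thesis .
  qed
  have mem: "vec (x(b := y)) \<in> D \<longleftrightarrow> 0 < y \<and> y \<le> h \<and> sqrt (\<Sum>i\<in>I. (x i)\<^sup>2) \<le> a * y" for x y
  proof -
    have "sqrt (\<Sum>i\<in>I. (x i)\<^sup>2) \<le> a * y \<longleftrightarrow> (\<Sum>i\<in>I. (x i)\<^sup>2) \<le> (a * y)\<^sup>2" if "0 < y"
      using that a by (metis less_imp_le mult_pos_pos real_sqrt_le_iff real_sqrt_abs abs_of_nonneg)
    thus ?thesis using ip[of x y] vecb[OF b, of "x(b := y)"] by (auto simp: D_def)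
  qed
  have "emeasure lborel D = (\<integral>\<^sup>+z. indicator D z \<partial>lborel)" by simp
  also have "\<dots> = (\<integral>\<^sup>+f. indicator D (vec f) \<partial>PiM (insert b I) (\<lambda>_. lborel))"
    unfolding I(3) vec_def by (subst lborel_eq, subst nn_integral_distr) measurable
  \<comment> \<open>Integrating the axial coordinate last: the slice of the cone at height
    \<open>y\<close> is an m-dimensional ball of radius \<open>a * y\<close>, which leaves the
    integral of a multiple of \<open>y ^ m\<close>.\<close>
  also have "\<dots> = (\<integral>\<^sup>+y. (\<integral>\<^sup>+x. indicator D (vec (x(b := y))) \<partial>PiM I (\<lambda>_. lborel)) \<partial>lborel)"
    by (rule product_nn_integral_insert_rev) (use I in auto)
  also have "\<dots> = (\<integral>\<^sup>+y. ennreal (unit_ball_vol (real m) * a ^ m * y ^ m) * indicator {0..h} y \<partial>lborel)"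
  proof (rule nn_integral_cong_AE)
    have "AE y in lborel. y \<noteq> (0::real)" by (rule AE_lborel_singleton)
    thus "AE y in lborel. (\<integral>\<^sup>+x. indicator D (vec (x(b := y))) \<partial>PiM I (\<lambda>_. lborel))
       = ennreal (unit_ball_vol (real m) * a ^ m * y ^ m) * indicator {0..h} y"
    proof eventually_elim
      case (elim y)
      show ?case
      proof (cases "0 < y \<and> y \<le> h")
        case False
        hence "indicator D (vec (x(b := y))) = (0::ennreal)" for x by (auto simp: mem indicator_def)
        moreover have "y \<notin> {0..h}" using False elim by auto
        ultimately show ?thesis by simp
      next
        case True
        hence "(\<integral>\<^sup>+x. indicator D (vec (x(b := y))) \<partial>PiM I (\<lambda>_. lborel))
            = (\<integral>\<^sup>+x. indicator ({f. sqrt (\<Sum>i\<in>I. (f i)\<^sup>2) \<le> a * y} \<inter> space (PiM I (\<lambda>_. lborel))) x \<partial>PiM I (\<lambda>_. lborel))"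
          by (intro nn_integral_cong) (auto simp: mem indicator_def)
        also have "\<dots> = emeasure (PiM I (\<lambda>_. lborel)) ({f. sqrt (\<Sum>i\<in>I. (f i)\<^sup>2) \<le> a * y} \<inter> space (PiM I (\<lambda>_. lborel)))"
          by (subst nn_integral_indicator) auto
        also have "\<dots> = ennreal (unit_ball_vol (real m) * (a * y) ^ m)"
          using emeasure_cball_aux[OF I(1), of "a * y"] True a I(4) by simp
        finally show ?thesis using True by (simp add: power_mult_distrib mult.assoc)
      qed
    qed
  qed
  also have "\<dots> = ennreal (unit_ball_vol (real m) * a ^ m * h ^ Suc m / real (Suc m) - unit_ball_vol (real m) * a ^ m * 0 ^ Suc m / real (Suc m))"
    by (rule nn_integral_FTC_Icc[where F = "\<lambda>y. unit_ball_vol (real m) * a ^ m * y ^ Suc m / real (Suc m)"])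
       (use a h in \<open>auto intro!: derivative_eq_intros mult_nonneg_nonneg simp del: power_Suc\<close>)
  finally show ?thesis by (simp add: D_def)
qed

text \<open>Here \<open>a\<close> is the tangent of the opening angle whose cosine is
  \<open>1 - e\<close>. The part of the unit ball over the cap lies in the cone of slope
  \<open>a\<close> and height 1, and contains the cone of height \<open>1 - e\<close>, whose points
  have norm at most 1. The dimension factor of the surface measure cancels the denominator in the
  cone volume.\<close>

lemma sphere_cap_bounds:
  fixes q :: "'a::euclidean_space"
  assumes q: "norm q = 1" and e: "0 < e" "e < 1" and m: "DIM('a) = Suc m"
  defines "a \<equiv> sqrt (2 * e - e\<^sup>2) / (1 - e)"
  shows "measure sphere_surface_measure {u. 1 - q \<bullet> u \<le> e} \<le> unit_ball_vol (real m) * a ^ m"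
    and "unit_ball_vol (real m) * a ^ m * (1 - e) ^ Suc m \<le> measure sphere_surface_measure {u. 1 - q \<bullet> u \<le> e}"
proof -
  interpret finite_measure "sphere_surface_measure :: 'a measure"
    by (rule finite_measure_sphere_surface_measure)
  obtain b :: 'a where b: "b \<in> Basis" using nonempty_Basis by blast
  obtain U where U: "orthogonal_transformation U" "U q = b"
    using householder_exists[of q b] q b by auto
  have e2: "e\<^sup>2 < e" using e by (simp add: power2_eq_square)
  have a0: "a > 0" using e e2 by (auto simp: a_def)
  \<comment> \<open>cos^2 (1 + tan^2) = 1 for the opening angle of the cone.\<close>
  have a2: "(1 - e)\<^sup>2 * (1 + a\<^sup>2) = 1"
  proof -
    have "a\<^sup>2 = (2 * e - e\<^sup>2) / (1 - e)\<^sup>2" using e e2 by (simp add: a_def power_divide)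
    hence "(1 - e)\<^sup>2 * (1 + a\<^sup>2) = (1 - e)\<^sup>2 + (2 * e - e\<^sup>2)" using e by (simp add: distrib_left)
    thus ?thesis by (simp add: power2_eq_square algebra_simps)
  qed
  define Cone where "Cone h = {z. 0 < z \<bullet> b \<and> z \<bullet> b \<le> h \<and> z \<bullet> z - (z \<bullet> b)\<^sup>2 \<le> (a * (z \<bullet> b))\<^sup>2}" for h
  have [measurable]: "Cone h \<in> sets borel" for h unfolding Cone_def by measurable
  define K where "K = {z. 0 < norm z \<and> norm z \<le> 1 \<and> 1 - b \<bullet> sgn z \<le> e}"
  have [measurable]: "K \<in> sets borel" unfolding K_def by measurable
  have cone_iff: "z \<bullet> z - (z \<bullet> b)\<^sup>2 \<le> (a * (z \<bullet> b))\<^sup>2 \<longleftrightarrow> (1 - e) * norm z \<le> z \<bullet> b" if "0 < z \<bullet> b" for z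
  proof -
    have "z \<bullet> z - (z \<bullet> b)\<^sup>2 \<le> (a * (z \<bullet> b))\<^sup>2 \<longleftrightarrow> (norm z)\<^sup>2 \<le> (1 + a\<^sup>2) * (z \<bullet> b)\<^sup>2"
      by (simp add: power2_norm_eq_inner power_mult_distrib algebra_simps)
    also have "\<dots> \<longleftrightarrow> (1 - e)\<^sup>2 * (norm z)\<^sup>2 \<le> (1 - e)\<^sup>2 * ((1 + a\<^sup>2) * (z \<bullet> b)\<^sup>2)"
      using e by (subst mult_le_cancel_left_pos) auto
    also have "\<dots> \<longleftrightarrow> ((1 - e) * norm z)\<^sup>2 \<le> (z \<bullet> b)\<^sup>2"
      using a2 by (simp add: power_mult_distrib mult.assoc[symmetric])
    also have "\<dots> \<longleftrightarrow> (1 - e) * norm z \<le> z \<bullet> b"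
      using e that by (subst abs_le_square_iff[symmetric]) auto
    finally show ?thesis .
  qed
  have K_iff: "1 - b \<bullet> sgn z \<le> e \<longleftrightarrow> (1 - e) * norm z \<le> z \<bullet> b" if "z \<noteq> 0" for z
    using that by (simp add: sgn_div_norm inner_commute field_simps)
  have up: "K \<subseteq> Cone 1"
  proof
    fix z assume z: "z \<in> K"
    hence nz: "z \<noteq> 0" and le: "(1 - e) * norm z \<le> z \<bullet> b" using K_iff by (auto simp: K_def)
    have "0 < (1 - e) * norm z" using nz e by simp
    hence pos: "0 < z \<bullet> b" using le by linarith
    have "z \<bullet> b \<le> norm z" using Cauchy_Schwarz_ineq2[of z b] b by simp
    thus "z \<in> Cone 1" using pos z le cone_iff[OF pos] by (auto simp: Cone_def K_def)
  qed
  have low: "Cone (1 - e) \<subseteq> K"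
  proof
    fix z assume z: "z \<in> Cone (1 - e)"
    hence pos: "0 < z \<bullet> b" and nz: "z \<noteq> 0" by (auto simp: Cone_def)
    have le: "(1 - e) * norm z \<le> z \<bullet> b" using z cone_iff[OF pos] by (auto simp: Cone_def)
    also have "z \<bullet> b \<le> (1 - e) * 1" using z by (auto simp: Cone_def)
    finally have "norm z \<le> 1" using e by (subst (asm) mult_le_cancel_left_pos) auto
    thus "z \<in> K" using nz le K_iff by (auto simp: K_def)
  qed
  have "emeasure sphere_surface_measure {u. 1 - q \<bullet> u \<le> e} = (\<integral>\<^sup>+u. indicator {u. 1 - q \<bullet> u \<le> e} u \<partial>sphere_surface_measure)"
    by simp
  also have "\<dots> = (\<integral>\<^sup>+u. indicator {u. 1 - b \<bullet> u \<le> e} (U u) \<partial>sphere_surface_measure)"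
    using U by (intro nn_integral_cong) (auto simp: indicator_def orthogonal_transformation_def; metis)
  also have "\<dots> = (\<integral>\<^sup>+u. indicator {u. 1 - b \<bullet> u \<le> e} u \<partial>sphere_surface_measure)"
    by (rule sphere_surface_measure_orthogonal[OF U(1)]) measurable
  also have "\<dots> = of_nat DIM('a) * (\<integral>\<^sup>+z. indicator {z. 0 < norm z \<and> norm z \<le> 1} z * indicator {u. 1 - b \<bullet> u \<le> e} (sgn z) \<partial>lborel)"
    by (rule nn_integral_sphere_surface_measure) measurable
  also have "(\<integral>\<^sup>+z. indicator {z. 0 < norm z \<and> norm z \<le> 1} z * indicator {u. 1 - b \<bullet> u \<le> e} (sgn z) \<partial>lborel)
      = (\<integral>\<^sup>+z. indicator K z \<partial>lborel)"
    by (intro nn_integral_cong) (auto simp: K_def indicator_def)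
  finally have cap: "emeasure sphere_surface_measure {u. 1 - q \<bullet> u \<le> e} = of_nat (Suc m) * emeasure lborel K"
    by (simp add: m)
  have cone: "of_nat (Suc m) * emeasure lborel (Cone h) = ennreal (unit_ball_vol (real m) * a ^ m * h ^ Suc m)" if "h > 0" for h
  proof -
    have "of_nat (Suc m) * emeasure lborel (Cone h) = ennreal (real (Suc m)) * ennreal (unit_ball_vol (real m) * a ^ m * h ^ Suc m / real (Suc m))"
      using emeasure_solid_cone[OF b a0 that m] by (simp only: Cone_def ennreal_of_nat_eq_real_of_nat)
    also have "\<dots> = ennreal (real (Suc m) * (unit_ball_vol (real m) * a ^ m * h ^ Suc m / real (Suc m)))"
      by (rule ennreal_mult'[symmetric]) simp
    finally show ?thesis by simp
  qed
  have nn: "0 \<le> unit_ball_vol (real m) * a ^ m" using a0 by simp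
  have "emeasure sphere_surface_measure {u. 1 - q \<bullet> u \<le> e} \<le> of_nat (Suc m) * emeasure lborel (Cone 1)"
    unfolding cap by (intro mult_left_mono emeasure_mono up) auto
  also have "\<dots> = ennreal (unit_ball_vol (real m) * a ^ m)" using cone[of 1] by simp
  finally show "measure sphere_surface_measure {u. 1 - q \<bullet> u \<le> e} \<le> unit_ball_vol (real m) * a ^ m"
    using nn by (simp add: emeasure_eq_measure)
  have "ennreal (unit_ball_vol (real m) * a ^ m * (1 - e) ^ Suc m) = of_nat (Suc m) * emeasure lborel (Cone (1 - e))"
    using cone[of "1 - e"] e by simp
  also have "\<dots> \<le> emeasure sphere_surface_measure {u. 1 - q \<bullet> u \<le> e}"
    unfolding cap by (intro mult_left_mono emeasure_mono low) auto
  finally show "unit_ball_vol (real m) * a ^ m * (1 - e) ^ Suc m \<le> measure sphere_surface_measure {u. 1 - q \<bullet> u \<le> e}"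
    by (simp add: emeasure_eq_measure)
qed

text \<open>The tangent of the opening angle equals \<open>sqrt e\<close> times a factor tending to
  \<open>sqrt 2\<close>, and the ratio \<open>(1 - e) ^ Suc m\<close> between the two cone bounds
  tends to 1.\<close>

lemma sphere_cap_asymptotics:
  fixes q :: "'a::euclidean_space"
  assumes q: "norm q = 1" and m: "DIM('a) = Suc m"
  shows "((\<lambda>e. measure sphere_surface_measure {u. 1 - q \<bullet> u \<le> e} / sqrt e ^ m) \<longlongrightarrow> unit_ball_vol (real m) * sqrt 2 ^ m) (at_right 0)"
proof -
  let ?V = "unit_ball_vol (real m)"
  define r where "r e = sqrt (2 - e) / (1 - e)" for e :: real
  have r: "(sqrt (2 * e - e\<^sup>2) / (1 - e)) ^ m = r e ^ m * sqrt e ^ m" if "0 < e" for e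
    by (simp add: r_def power_mult_distrib[symmetric] real_sqrt_mult[symmetric] power2_eq_square algebra_simps)
  have r_lim: "(r \<longlongrightarrow> sqrt 2) (at_right 0)"
  proof -
    have "(r \<longlongrightarrow> sqrt (2 - 0) / (1 - 0)) (at_right 0)"
      unfolding r_def by (intro tendsto_intros) auto
    thus ?thesis by simp
  qed
  have ev: "eventually (\<lambda>e. 0 < e \<and> e < (1::real)) (at_right 0)"
    by (auto simp: eventually_at_right_field intro!: exI[of _ 1])
  show ?thesis
  proof (rule tendsto_sandwich)
    show "eventually (\<lambda>e. ?V * r e ^ m * (1 - e) ^ Suc m \<le> measure sphere_surface_measure {u. 1 - q \<bullet> u \<le> e} / sqrt e ^ m) (at_right 0)"
      using ev
    proof eventually_elim
      case (elim e)
      thus ?case using sphere_cap_bounds(2)[OF q _ _ m, of e] r[of e]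
        by (subst pos_le_divide_eq) (auto simp: mult_ac)
    qed
    show "eventually (\<lambda>e. measure sphere_surface_measure {u. 1 - q \<bullet> u \<le> e} / sqrt e ^ m \<le> ?V * r e ^ m) (at_right 0)"
      using ev
    proof eventually_elim
      case (elim e)
      thus ?case using sphere_cap_bounds(1)[OF q _ _ m, of e] r[of e]
        by (subst pos_divide_le_eq) (auto simp: mult_ac)
    qed
    have "((\<lambda>e. ?V * r e ^ m * (1 - e) ^ Suc m) \<longlongrightarrow> ?V * sqrt 2 ^ m * (1 - 0) ^ Suc m) (at_right 0)"
      by (intro tendsto_intros r_lim)
    thus "((\<lambda>e. ?V * r e ^ m * (1 - e) ^ Suc m) \<longlongrightarrow> ?V * sqrt 2 ^ m) (at_right 0)" by simp
    show "((\<lambda>e. ?V * r e ^ m) \<longlongrightarrow> ?V * sqrt 2 ^ m) (at_right 0)"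
      by (intro tendsto_intros r_lim)
  qed
qed

text \<open>A bound for all heights is needed as a dominating function when rescaled cap areas are
  integrated against an exponential.\<close>

lemma sphere_cap_le:
  fixes q :: "'a::euclidean_space"
  assumes q: "norm q = 1" and m: "DIM('a) = Suc m"
  shows "\<exists>C\<ge>0. \<forall>e>0. measure sphere_surface_measure {u. 1 - q \<bullet> u \<le> e} \<le> C * sqrt e ^ m"
proof -
  interpret finite_measure "sphere_surface_measure :: 'a measure"
    by (rule finite_measure_sphere_surface_measure)
  let ?\<sigma> = "sphere_surface_measure :: 'a measure"
  let ?V = "unit_ball_vol (real m)"
  \<comment> \<open>The first summand serves \<open>e \<le> 1/2\<close>, where the tangent is at
    most \<open>4 * sqrt e\<close>; the second serves larger \<open>e\<close>, where the total mass
    is a bound and \<open>2 * sqrt e\<close> exceeds 1.\<close>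
  define C where "C = ?V * 4 ^ m + measure ?\<sigma> UNIV * 2 ^ m"
  have "measure ?\<sigma> {u. 1 - q \<bullet> u \<le> e} \<le> C * sqrt e ^ m" if e: "e > 0" for e
  proof (cases "e \<le> 1/2")
    case True
    have "sqrt (2 * e - e\<^sup>2) \<le> 2 * sqrt e"
      using e by (intro real_le_lsqrt) (auto simp: power_mult_distrib intro: order_trans[of _ 0])
    hence "sqrt (2 * e - e\<^sup>2) / (1 - e) \<le> (2 * sqrt e) / (1/2)"
      using True e by (intro frac_le) auto
    hence "(sqrt (2 * e - e\<^sup>2) / (1 - e)) ^ m \<le> (4 * sqrt e) ^ m"
      using True e by (intro power_mono) (auto intro!: divide_nonneg_nonneg mult_left_le simp: power2_eq_square)
    hence "?V * (sqrt (2 * e - e\<^sup>2) / (1 - e)) ^ m \<le> ?V * (4 * sqrt e) ^ m"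
      by (intro mult_left_mono) auto
    with sphere_cap_bounds(1)[OF q e _ m] True
    have "measure ?\<sigma> {u. 1 - q \<bullet> u \<le> e} \<le> ?V * (4 * sqrt e) ^ m"
      by linarith
    also have "\<dots> = (?V * 4 ^ m) * sqrt e ^ m"
      by (simp add: power_mult_distrib mult.assoc)
    also have "\<dots> \<le> C * sqrt e ^ m"
      using e by (intro mult_right_mono) (auto simp: C_def)
    finally show ?thesis .
  next
    case False
    have "1 \<le> (2 * sqrt e) ^ m"
    proof (rule one_le_power)
      have "sqrt (1/4) \<le> sqrt e" using False by (subst real_sqrt_le_iff) auto
      thus "1 \<le> 2 * sqrt e" by (simp add: real_sqrt_divide)
    qed
    have "measure ?\<sigma> {u. 1 - q \<bullet> u \<le> e} \<le> measure ?\<sigma> UNIV * 1"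
      by (simp add: finite_measure_mono)
    also have "\<dots> \<le> measure ?\<sigma> UNIV * (2 * sqrt e) ^ m"
      by (intro mult_left_mono) (use \<open>1 \<le> (2 * sqrt e) ^ m\<close> in auto)
    also have "\<dots> \<le> C * sqrt e ^ m"
      using e by (simp add: C_def power_mult_distrib distrib_right)
    finally show ?thesis .
  qed
  moreover have "C \<ge> 0" by (simp add: C_def)
  ultimately show ?thesis by blast
qed

section \<open>Independence of height and direction\<close>

text \<open>For a unit vector \<open>q\<close> this is the unit direction of the component of
  \<open>u\<close> orthogonal to \<open>q\<close>. It takes the default value 0 when that component
  vanishes, which on the sphere happens only at the two poles.\<close>

definition tang :: "'a::euclidean_space \<Rightarrow> 'a \<Rightarrow> 'a" where
  "tang q u = sgn (u - (u \<bullet> q) *\<^sub>R q)"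

lemma tang_measurable [measurable]: "tang q \<in> borel_measurable borel"
  unfolding tang_def[abs_def] by measurable

lemma tang_orthogonal_transformation:
  assumes U: "orthogonal_transformation U" and Uq: "U q = q"
  shows "tang q (U u) = U (tang q u)" "q \<bullet> U u = q \<bullet> u"
proof -
  have ip: "U x \<bullet> U y = x \<bullet> y" for x y using U by (simp add: orthogonal_transformation_def)
  show q: "q \<bullet> U u = q \<bullet> u" using ip[of q u] Uq by simp
  have "U u - (U u \<bullet> q) *\<^sub>R q = U (u - (u \<bullet> q) *\<^sub>R q)"
    using q Uq by (simp add: linear_diff[OF orthogonal_transformation_linear[OF U]]
        orthogonal_transformation_scaleR[OF U] inner_commute)
  thus "tang q (U u) = U (tang q u)"
    by (simp add: tang_def sgn_div_norm orthogonal_transformation_scaleR[OF U] orthogonal_transformation_norm[OF U])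
qed

lemma orth_sphere_borel [measurable]: "orth_sphere q \<in> sets borel"
  unfolding orth_sphere_def by measurable

lemma orth_sphere_nonempty:
  fixes q :: "'a::euclidean_space"
  assumes "DIM('a) \<ge> 2"
  obtains v where "v \<in> orth_sphere q"
proof -
  obtain y where y: "y \<noteq> 0" "orthogonal q y" using orthogonal_to_vector_exists[OF assms] .
  show ?thesis
    by (rule that[of "sgn y"])
       (use y in \<open>auto simp: orth_sphere_def norm_sgn orthogonal_def sgn_div_norm inner_commute\<close>)
qed

text \<open>The exceptional set is covered by a hyperplane: for a fixed \<open>v\<close> orthogonal
  to \<open>q\<close>, projecting along \<open>q\<close> does not change the product with
  \<open>v\<close>, so the projection is nonzero wherever \<open>v \<bullet> z\<close> is.\<close>

lemma AE_tang_orth_sphere: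
  fixes q :: "'a::euclidean_space"
  assumes dim: "DIM('a) \<ge> 2" and q: "norm q = 1"
  shows "AE u in sphere_surface_measure. tang q u \<in> orth_sphere q"
proof (rule AE_sphere_surface_measure)
  obtain v where v: "v \<in> orth_sphere q" using orth_sphere_nonempty[OF dim] .
  hence v0: "v \<noteq> 0" by (auto simp: orth_sphere_def)
  have qq: "q \<bullet> q = 1" using q by (simp add: norm_eq_1)
  have "{z. v \<bullet> z = 0} \<in> null_sets (lborel :: 'a measure)"
    using negligible_hyperplane[of v 0] v0
    by (simp add: negligible_iff_null_sets null_sets_completion_iff)
  hence "AE z in lborel. v \<bullet> z \<noteq> 0" by (rule AE_I') auto
  thus "AE z in lborel. z \<noteq> 0 \<longrightarrow> tang q (sgn z) \<in> orth_sphere q"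
  proof eventually_elim
    case (elim z)
    define y where "y = sgn z - (sgn z \<bullet> q) *\<^sub>R q"
    have yq: "y \<bullet> q = 0" using qq by (simp add: y_def inner_simps)
    have "v \<bullet> y = v \<bullet> sgn z" using v by (simp add: y_def inner_simps orth_sphere_def)
    hence "z \<noteq> 0 \<Longrightarrow> v \<bullet> y \<noteq> 0" using elim by (simp add: sgn_div_norm)
    hence "z \<noteq> 0 \<Longrightarrow> y \<noteq> 0" by auto
    moreover have "tang q (sgn z) = sgn y" by (simp only: tang_def y_def)
    moreover have "sgn y \<bullet> q = 0" using yq by (simp add: sgn_div_norm)
    ultimately show ?case by (auto simp: orth_sphere_def norm_sgn)
  qed
qed measurable

lemma uniform_on_orth_sphereD:
  fixes q :: "'a::euclidean_space"
  assumes "uniform_on_orth_sphere q \<nu>"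
  shows "prob_space \<nu>" "sets \<nu> = sets borel" "space \<nu> = UNIV" "AE \<theta> in \<nu>. \<theta> \<in> orth_sphere q"
    and "\<And>U (f :: 'a \<Rightarrow> ennreal). orthogonal_transformation U \<Longrightarrow> U q = q \<Longrightarrow> f \<in> borel_measurable borel \<Longrightarrow>
        (\<integral>\<^sup>+\<theta>. f (U \<theta>) \<partial>\<nu>) = (\<integral>\<^sup>+\<theta>. f \<theta> \<partial>\<nu>)"
proof -
  show "prob_space \<nu>" and s: "sets \<nu> = sets borel" using assms by (auto simp: uniform_on_orth_sphere_def)
  show sp: "space \<nu> = UNIV" using sets_eq_imp_space_eq[OF s] by simp
  have "UNIV - orth_sphere q \<in> null_sets \<nu>"
    using assms by (auto simp: null_sets_def uniform_on_orth_sphere_def)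
  thus "AE \<theta> in \<nu>. \<theta> \<in> orth_sphere q" by (rule AE_I') auto
  fix U and f :: "'a \<Rightarrow> ennreal" assume U: "orthogonal_transformation U" "U q = q" and f: "f \<in> borel_measurable borel"
  have "(\<integral>\<^sup>+\<theta>. f \<theta> \<partial>\<nu>) = (\<integral>\<^sup>+\<theta>. f \<theta> \<partial>distr \<nu> borel U)"
    using assms U by (simp add: uniform_on_orth_sphere_def)
  also have "\<dots> = (\<integral>\<^sup>+\<theta>. f (U \<theta>) \<partial>\<nu>)"
    by (rule nn_integral_distr)
       (use f orthogonal_transformation_measurable[OF U(1)] s in \<open>simp_all cong: measurable_cong_sets\<close>)
  finally show "(\<integral>\<^sup>+\<theta>. f (U \<theta>) \<partial>\<nu>) = (\<integral>\<^sup>+\<theta>. f \<theta> \<partial>\<nu>)" ..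
qed

text \<open>Averaging the kernel \<open>exp (- s (w \<bullet> \<theta>))\<close> over \<open>w\<close> as well shows that height and direction
  factorise, without constructing invariant measures.\<close>

lemma sphere_laplace_factor:
  fixes q :: "'a::euclidean_space"
  assumes dim: "DIM('a) \<ge> 2" and q: "norm q = 1" and \<nu>: "uniform_on_orth_sphere q \<nu>"
  shows "(\<integral>\<^sup>+u. ennreal (exp (- (a * (1 - q \<bullet> u)) - p \<bullet> tang q u)) \<partial>sphere_surface_measure)
    = (\<integral>\<^sup>+u. ennreal (exp (- (a * (1 - q \<bullet> u)))) \<partial>sphere_surface_measure) * (\<integral>\<^sup>+\<theta>. ennreal (exp (- (p \<bullet> \<theta>))) \<partial>\<nu>)"
proof -
  let ?\<sigma> = "sphere_surface_measure :: 'a measure"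
  note \<nu>D = uniform_on_orth_sphereD[OF \<nu>]
  interpret N: prob_space \<nu> by (rule \<nu>D)
  interpret S: finite_measure ?\<sigma> by (rule finite_measure_sphere_surface_measure)
  interpret pair_sigma_finite ?\<sigma> \<nu> ..
  note [measurable_cong] = \<nu>D(2)
  have qq: "q \<bullet> q = 1" using q by (simp add: norm_eq_1)
  \<comment> \<open>Directions are orthogonal to \<open>q\<close>, so only this component of
    \<open>p\<close> matters; it is written as a multiple \<open>s\<close> of a unit vector
    \<open>v\<close>.\<close>
  define p' where "p' = p - (p \<bullet> q) *\<^sub>R q"
  obtain v s where v: "v \<in> orth_sphere q" "p' = s *\<^sub>R v"
  proof (cases "p' = 0")
    case True
    thus ?thesis using orth_sphere_nonempty[OF dim, of q] that[of _ 0] by auto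
  next
    case False
    show ?thesis
      by (rule that[of "sgn p'" "norm p'"])
         (use False qq in \<open>auto simp: orth_sphere_def norm_sgn sgn_div_norm p'_def inner_simps\<close>)
  qed
  have ps: "p \<bullet> \<theta> = s * (v \<bullet> \<theta>)" if "\<theta> \<in> orth_sphere q" for \<theta>
  proof -
    have "p \<bullet> \<theta> = p' \<bullet> \<theta>" using that by (simp add: p'_def inner_simps orth_sphere_def inner_commute)
    thus ?thesis using v by simp
  qed
  define L where "L w = (\<integral>\<^sup>+u. ennreal (exp (- (a * (1 - q \<bullet> u)) - s * (w \<bullet> tang q u))) \<partial>?\<sigma>)" for w
  define K where "K w = (\<integral>\<^sup>+\<theta>. ennreal (exp (- (s * (w \<bullet> \<theta>)))) \<partial>\<nu>)" for w
  \<comment> \<open>A reflection taking \<open>v\<close> to \<open>w\<close> and fixing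
    \<open>q\<close> preserves both measures and the height, so \<open>L\<close> and
    \<open>K\<close> are constant on the sphere of directions.\<close>
  have LK: "L w = L v" "K w = K v" if w: "w \<in> orth_sphere q" for w
  proof -
    obtain U where U: "orthogonal_transformation U" "U v = w" "U q = q"
      using householder_exists[of v w] v(1) w by (auto simp: orth_sphere_def inner_commute)
    have [measurable]: "U \<in> borel_measurable borel" by (rule orthogonal_transformation_measurable[OF U(1)])
    have ip: "w \<bullet> U y = v \<bullet> y" for y using U by (auto simp: orthogonal_transformation_def)
    have "L w = (\<integral>\<^sup>+u. ennreal (exp (- (a * (1 - q \<bullet> U u)) - s * (w \<bullet> tang q (U u)))) \<partial>?\<sigma>)"
      unfolding L_def by (rule sphere_surface_measure_orthogonal[OF U(1), symmetric]) measurable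
    thus "L w = L v" by (simp add: L_def tang_orthogonal_transformation[OF U(1,3)] ip)
    have "K w = (\<integral>\<^sup>+\<theta>. ennreal (exp (- (s * (w \<bullet> U \<theta>)))) \<partial>\<nu>)"
      unfolding K_def by (rule \<nu>D(5)[OF U(1,3), symmetric]) measurable
    thus "K w = K v" by (simp add: K_def ip)
  qed
  have "(\<integral>\<^sup>+u. ennreal (exp (- (a * (1 - q \<bullet> u)) - p \<bullet> tang q u)) \<partial>?\<sigma>) = L v"
    unfolding L_def using AE_tang_orth_sphere[OF dim q]
    by (intro nn_integral_cong_AE) (auto elim!: eventually_mono simp: ps)
  also have "\<dots> = (\<integral>\<^sup>+w. L v \<partial>\<nu>)" by (simp add: N.emeasure_space_1)
  also have "\<dots> = (\<integral>\<^sup>+w. L w \<partial>\<nu>)"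
    using \<nu>D(4) by (intro nn_integral_cong_AE) (auto elim!: eventually_mono simp: LK)
  \<comment> \<open>After the exchange the inner integral over \<open>w\<close> is \<open>K\<close>
    evaluated at the direction of \<open>u\<close>, since the inner product is symmetric; by
    constancy it becomes \<open>K v\<close> and leaves the integral.\<close>
  also have "\<dots> = (\<integral>\<^sup>+u. \<integral>\<^sup>+w. ennreal (exp (- (a * (1 - q \<bullet> u)) - s * (w \<bullet> tang q u))) \<partial>\<nu> \<partial>?\<sigma>)"
    unfolding L_def by (rule Fubini') measurable
  also have "\<dots> = (\<integral>\<^sup>+u. ennreal (exp (- (a * (1 - q \<bullet> u)))) * K (tang q u) \<partial>?\<sigma>)"
    unfolding K_def
    by (subst nn_integral_cmult[symmetric])
       (auto simp: exp_diff exp_minus divide_inverse ennreal_mult inner_commute intro!: nn_integral_cong)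
  also have "\<dots> = (\<integral>\<^sup>+u. ennreal (exp (- (a * (1 - q \<bullet> u)))) * K v \<partial>?\<sigma>)"
    using AE_tang_orth_sphere[OF dim q]
    by (intro nn_integral_cong_AE) (auto elim!: eventually_mono simp: LK)
  also have "\<dots> = (\<integral>\<^sup>+u. ennreal (exp (- (a * (1 - q \<bullet> u)))) \<partial>?\<sigma>) * K v"
    by (rule nn_integral_multc) measurable
  also have "K v = (\<integral>\<^sup>+\<theta>. ennreal (exp (- (p \<bullet> \<theta>))) \<partial>\<nu>)"
    unfolding K_def using \<nu>D(4) by (intro nn_integral_cong_AE) (auto elim!: eventually_mono simp: ps)
  finally show ?thesis .
qed

text \<open>The factorised Laplace transforms identify the joint law of height and direction with
  that of a product. The weak limit theorem for a constant sequence turns equality of transforms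
  into equality of integrals, by uniqueness of limits.\<close>

lemma sphere_integral_height_direction:
  fixes q :: "'a::euclidean_space" and G :: "real \<times> 'a \<Rightarrow> real"
  assumes dim: "DIM('a) \<ge> 2" and q: "norm q = 1" and \<nu>: "uniform_on_orth_sphere q \<nu>"
    and Gm [measurable]: "G \<in> borel_measurable borel" and cont: "continuous_on ({0..} \<times> UNIV) G"
    and B: "\<And>p. \<bar>G p\<bar> \<le> B"
  shows "(\<integral>u. G (1 - q \<bullet> u, tang q u) \<partial>sphere_surface_measure)
     = (\<integral>u. \<integral>\<theta>. G (1 - q \<bullet> u, \<theta>) \<partial>\<nu> \<partial>sphere_surface_measure)"
proof -
  let ?\<sigma> = "sphere_surface_measure :: 'a measure"
  note \<nu>D = uniform_on_orth_sphereD[OF \<nu>]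
  interpret N: prob_space \<nu> by (rule \<nu>D)
  interpret S: finite_measure ?\<sigma> by (rule finite_measure_sphere_surface_measure)
  interpret pair_sigma_finite ?\<sigma> \<nu> ..
  interpret P: finite_measure "?\<sigma> \<Otimes>\<^sub>M \<nu>"
    by (rule finite_measure_pair_measure) unfold_locales
  note [measurable_cong] = \<nu>D(2)
  have T0: "AE u in ?\<sigma>. 0 \<le> 1 - q \<bullet> u"
    using AE_sphere_surface_measure_norm
  proof eventually_elim
    case (elim u)
    show ?case using Cauchy_Schwarz_ineq2[of q u] q elim by simp
  qed
  have One_ge: "0 < (\<theta> + 2 *\<^sub>R One) \<bullet> b" if "\<theta> \<in> orth_sphere q" "b \<in> Basis" for \<theta> b
    using Basis_le_norm[OF that(2), of \<theta>] that by (auto simp: orth_sphere_def inner_simps)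
  have pos: "\<forall>b\<in>Basis. 0 \<le> (t, \<theta> + 2 *\<^sub>R One) \<bullet> b" if "0 \<le> t" "\<theta> \<in> orth_sphere q" for t :: real and \<theta> :: 'a
    using that One_ge[OF that(2)] by (auto simp: Basis_prod_def Basis_real_def less_imp_le)
  have AEp: "AE p in ?\<sigma> \<Otimes>\<^sub>M \<nu>. 0 \<le> 1 - q \<bullet> fst p \<and> snd p \<in> orth_sphere q"
  proof (rule AE_pair_measure)
    show "{p \<in> space (?\<sigma> \<Otimes>\<^sub>M \<nu>). 0 \<le> 1 - q \<bullet> fst p \<and> snd p \<in> orth_sphere q} \<in> sets (?\<sigma> \<Otimes>\<^sub>M \<nu>)"
      by measurable
    show "AE u in ?\<sigma>. AE \<theta> in \<nu>. 0 \<le> 1 - q \<bullet> fst (u, \<theta>) \<and> snd (u, \<theta>) \<in> orth_sphere q"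
      using T0 by eventually_elim (use \<nu>D(4) in simp)
  qed
  \<comment> \<open>Coordinates of a unit vector lie between -1 and 1; the shift by
    \<open>2 *\<^sub>R One\<close> makes them at least 1 and changes the transform only by the
    constant factor \<open>c\<close> on both sides.\<close>
  interpret laplace_limit "\<lambda>_. ?\<sigma>" "\<lambda>_ u. (1 - q \<bullet> u, tang q u + 2 *\<^sub>R One)" "?\<sigma> \<Otimes>\<^sub>M \<nu>"
    "\<lambda>p. (1 - q \<bullet> fst p, snd p + 2 *\<^sub>R One)"
  proof (unfold_locales, goal_cases)
    case 3
    show ?case using T0 AE_tang_orth_sphere[OF dim q] by eventually_elim (rule pos)
  next
    case 4
    show ?case using AEp
      by eventually_elim (use pos in blast)
  next
    case (5 u)
    obtain a p where u: "u = (a, p)" by (cases u)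
    define c where "c = exp (- (p \<bullet> (2 *\<^sub>R One)))"
    have split: "exp (- (u \<bullet> (t, \<theta> + 2 *\<^sub>R One))) = c * exp (- (a * t) - p \<bullet> \<theta>)" for t \<theta>
      by (simp add: u c_def inner_simps exp_add[symmetric])
    have "(\<integral>\<^sup>+w. ennreal (exp (- (a * (1 - q \<bullet> fst w)) - p \<bullet> snd w)) \<partial>(?\<sigma> \<Otimes>\<^sub>M \<nu>))
        = (\<integral>\<^sup>+x. \<integral>\<^sup>+\<theta>. ennreal (exp (- (a * (1 - q \<bullet> x)) - p \<bullet> \<theta>)) \<partial>\<nu> \<partial>?\<sigma>)"
      by (subst N.nn_integral_fst[symmetric]) auto
    also have "\<dots> = (\<integral>\<^sup>+x. ennreal (exp (- (a * (1 - q \<bullet> x)))) * (\<integral>\<^sup>+\<theta>. ennreal (exp (- (p \<bullet> \<theta>))) \<partial>\<nu>) \<partial>?\<sigma>)"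
      by (subst nn_integral_cmult[symmetric])
         (auto simp: exp_diff exp_minus divide_inverse ennreal_mult intro!: nn_integral_cong)
    also have "\<dots> = (\<integral>\<^sup>+u. ennreal (exp (- (a * (1 - q \<bullet> u)) - p \<bullet> tang q u)) \<partial>?\<sigma>)"
      by (simp add: sphere_laplace_factor[OF dim q \<nu>] nn_integral_multc)
    finally have "(\<integral>u. exp (- (a * (1 - q \<bullet> u)) - p \<bullet> tang q u) \<partial>?\<sigma>)
        = (\<integral>w. exp (- (a * (1 - q \<bullet> fst w)) - p \<bullet> snd w) \<partial>(?\<sigma> \<Otimes>\<^sub>M \<nu>))"
      by (simp add: integral_eq_nn_integral)
    thus ?case unfolding split by (simp add: tendsto_const)
  qed measurable
  obtain b :: 'a where b: "b \<in> Basis" using nonempty_Basis by blast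
  define h where "h s = G (fst s, snd s - 2 *\<^sub>R One)" for s :: "real \<times> 'a"
  have "(\<lambda>n::nat. \<integral>w. h (1 - q \<bullet> w, tang q w + 2 *\<^sub>R One) \<partial>?\<sigma>)
     \<longlonglongrightarrow> (\<integral>p. h (1 - q \<bullet> fst p, snd p + 2 *\<^sub>R One) \<partial>(?\<sigma> \<Otimes>\<^sub>M \<nu>))"
  proof (rule limit)
    \<comment> \<open>A shifted direction coordinate is strictly positive, which meets the
      positivity condition of \<open>limit\<close> without excluding height 0.\<close>
    show "(0, b) \<in> Basis" using b by (simp add: Basis_prod_def)
    show "AE w in ?\<sigma> \<Otimes>\<^sub>M \<nu>. 0 < (1 - q \<bullet> fst w, snd w + 2 *\<^sub>R One) \<bullet> (0, b)"
      using AEp by eventually_elim (use One_ge[OF _ b] in simp)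
    show "h \<in> borel_measurable borel"
      unfolding h_def
      by (rule measurable_compose[OF _ Gm]) (auto intro!: borel_measurable_continuous_onI continuous_intros)
    show "continuous_on {s. 0 < s \<bullet> (0, b) \<and> (\<forall>b\<in>Basis. 0 \<le> s \<bullet> b)} h"
      unfolding h_def
      by (rule continuous_on_compose2[OF cont]) (auto intro!: continuous_intros simp: Basis_prod_def)
  qed (use B in \<open>auto simp: h_def\<close>)
  hence "(\<integral>w. h (1 - q \<bullet> w, tang q w + 2 *\<^sub>R One) \<partial>?\<sigma>) = (\<integral>p. h (1 - q \<bullet> fst p, snd p + 2 *\<^sub>R One) \<partial>(?\<sigma> \<Otimes>\<^sub>M \<nu>))"
    by (rule LIMSEQ_unique[OF tendsto_const])
  also have "\<dots> = (\<integral>p. G (1 - q \<bullet> fst p, snd p) \<partial>(?\<sigma> \<Otimes>\<^sub>M \<nu>))" by (simp add: h_def)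
  also have "\<dots> = (\<integral>u. \<integral>\<theta>. G (1 - q \<bullet> u, \<theta>) \<partial>\<nu> \<partial>?\<sigma>)"
    by (subst integral_fst'[symmetric]) (auto intro!: P.integrable_const_bound[where B=B] simp: B)
  finally show ?thesis by (simp add: h_def)
qed

section \<open>Rescaling near the pole\<close>

lemma has_bochner_integral_Gamma:
  fixes x a :: real
  assumes x: "x > 0" and a: "a > 0"
  shows "has_bochner_integral lborel (\<lambda>t. indicator {0..} t * (t powr (x - 1) * exp (- (a * t)))) (Gamma x / a powr x)"
proof (rule has_bochner_integral_nn_integral)
  let ?I = "\<integral>\<^sup>+t. ennreal (indicator {0..} t * (t powr (x - 1) * exp (- (a * t)))) \<partial>lborel"
  have "ennreal (Gamma x) = \<bar>a\<bar> * (\<integral>\<^sup>+t. ennreal (indicator {0..} (0 + a * t) * (0 + a * t) powr (x - 1) / exp (0 + a * t)) \<partial>lborel)"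
    unfolding Gamma_conv_nn_integral_real[OF x] using a by (intro nn_integral_real_affine) auto
  also have "(\<integral>\<^sup>+t. ennreal (indicator {0..} (0 + a * t) * (0 + a * t) powr (x - 1) / exp (0 + a * t)) \<partial>lborel)
      = (\<integral>\<^sup>+t. ennreal (a powr (x - 1)) * ennreal (indicator {0..} t * (t powr (x - 1) * exp (- (a * t)))) \<partial>lborel)"
    using a by (intro nn_integral_cong)
      (auto simp: indicator_def powr_mult exp_minus field_simps zero_le_mult_iff simp flip: ennreal_mult)
  also have "\<dots> = ennreal (a powr (x - 1)) * ?I" by (rule nn_integral_cmult) measurable
  also have "ennreal \<bar>a\<bar> * (ennreal (a powr (x - 1)) * ?I) = ennreal (a powr x) * ?I"
    using a by (simp add: mult.assoc[symmetric] ennreal_mult[symmetric] powr_diff)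
  finally have eq: "ennreal (Gamma x) = ennreal (a powr x) * ?I" .
  have "ennreal (Gamma x / a powr x) = ennreal (1 / a powr x) * ennreal (Gamma x)"
    using Gamma_real_pos[OF x] by (subst ennreal_mult[symmetric]) auto
  also have "\<dots> = ?I"
  proof -
    have "ennreal (1 / a powr x) * ennreal (a powr x) = 1"
      using a by (subst ennreal_mult'[symmetric]) auto
    thus ?thesis by (simp only: eq mult.assoc[symmetric] mult_1_left)
  qed
  finally show "?I = ennreal (Gamma x / a powr x)" ..
qed (use x Gamma_real_pos[OF x] in auto)

lemma sqrt_power_eq_powr: "y > 0 \<Longrightarrow> sqrt y ^ m = y powr (real m / 2)"
  by (simp add: powr_half_sqrt[symmetric] powr_realpow[symmetric] powr_powr)

text \<open>In the application m = d - 1 and \<open>\<zeta>\<close> is \<gamma>^(-1/\<alpha>).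
  Keeping the scaling in this form separates the geometry of the cap from the arithmetic of
  \<alpha>.\<close>

locale cap_scaling =
  fixes q :: "'a::euclidean_space" and \<nu> :: "'a measure" and \<beta> :: "nat \<Rightarrow> real" and \<zeta> :: real and m :: nat
  assumes q: "norm q = 1" and \<nu>: "uniform_on_orth_sphere q \<nu>" and m: "DIM('a) = Suc m" and m1: "m \<ge> 1"
    and \<beta>_pos: "\<And>n. \<beta> n > 0" and \<beta>_top: "filterlim \<beta> at_top sequentially"
    and \<zeta>: "(\<lambda>n. real n * (1 / sqrt (\<beta> n)) ^ m) \<longlonglongrightarrow> \<zeta>" and \<zeta>_pos: "\<zeta> > 0"
begin

abbreviation \<sigma> :: "'a measure" where "\<sigma> \<equiv> sphere_surface_measure"

definition T :: "'a \<Rightarrow> real" where "T u = 1 - q \<bullet> u"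

abbreviation decay :: "real \<Rightarrow> nat \<Rightarrow> 'a \<Rightarrow> real" where
  "decay a n u \<equiv> exp (- (a * (\<beta> n * T u)))"

lemma T_measurable [measurable]: "T \<in> borel_measurable borel"
  unfolding T_def[abs_def] by measurable

lemma T_nonneg: "norm u = 1 \<Longrightarrow> 0 \<le> T u"
  using Cauchy_Schwarz_ineq2[of q u] q by (simp add: T_def)

lemma AE_sphere: "AE u in \<sigma>. norm u = 1 \<and> tang q u \<in> orth_sphere q \<and> 0 \<le> T u"
proof -
  have "DIM('a) \<ge> 2" using m m1 by simp
  show ?thesis using AE_sphere_surface_measure_norm AE_tang_orth_sphere[OF \<open>DIM('a) \<ge> 2\<close> q]
    by eventually_elim (auto intro: T_nonneg)
qed

sublocale finite_measure \<sigma> by (rule finite_measure_sphere_surface_measure)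
sublocale N: prob_space \<nu> by (rule uniform_on_orth_sphereD[OF \<nu>])
sublocale pair_sigma_finite \<sigma> \<nu> ..

text \<open>The constant C(q)/(\<alpha> \<gamma>^(1/\<alpha>)) without the factor rho(q): the
  leading coefficient of the cap area, the scaling limit, and m/2 from differentiating
  y^(m/2).\<close>

definition intensity_const :: real where
  "intensity_const = unit_ball_vol (real m) * sqrt 2 ^ m * \<zeta> * (real m / 2)"

definition height_intensity :: "real measure" where
  "height_intensity = density lborel (\<lambda>y. ennreal (indicator {0..} y * intensity_const * y powr (real m / 2 - 1)))"

lemma intensity_const_pos: "intensity_const > 0"
  using m1 \<zeta>_pos by (simp add: intensity_const_def)

lemma sets_height_intensity [simp, measurable_cong]: "sets height_intensity = sets borel"
  by (simp add: height_intensity_def)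

lemma AE_height_intensity_pos: "AE y in height_intensity. 0 < y"
proof -
  have "AE y in lborel. y \<noteq> (0::real)" by (rule AE_lborel_singleton)
  thus ?thesis unfolding height_intensity_def
    by (subst AE_density) (auto elim!: eventually_mono split: split_indicator)
qed

definition cap :: "real \<Rightarrow> real" where "cap e = measure \<sigma> {u. T u \<le> e}"

lemma cap_mono: "mono cap"
  unfolding cap_def by (intro monoI finite_measure_mono) auto

lemma cap_measurable [measurable]: "cap \<in> borel_measurable borel"
  by (rule borel_measurable_mono[OF cap_mono])

lemma cap_neg: "e < 0 \<Longrightarrow> cap e = 0"
proof -
  assume "e < 0"
  have "AE u in \<sigma>. u \<notin> {u. T u \<le> e}" using AE_sphere by eventually_elim (use \<open>e < 0\<close> in auto)
  hence "{u. T u \<le> e} \<in> null_sets \<sigma>" by (subst AE_iff_null_sets) auto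
  thus ?thesis unfolding cap_def by (rule measure_eq_0_null_sets)
qed

text \<open>Writing exp(-a z) as the integral of a exp(-a y) over y \<ge> z and exchanging the
  integrals leaves only cap areas.\<close>

lemma layer_cake:
  assumes a: "a > 0" and b: "b > 0"
  shows "(\<integral>\<^sup>+u. ennreal (exp (- (a * (b * T u)))) \<partial>\<sigma>)
    = (\<integral>\<^sup>+y. ennreal (indicator {0..} y * (a * exp (- (a * y)) * cap (y / b))) \<partial>lborel)"
proof -
  interpret L: pair_sigma_finite \<sigma> "lborel :: real measure" ..
  have "(\<integral>\<^sup>+u. ennreal (exp (- (a * (b * T u)))) \<partial>\<sigma>)
      = (\<integral>\<^sup>+u. \<integral>\<^sup>+y. ennreal (a * exp (- (a * y))) * indicator {b * T u..} y \<partial>lborel \<partial>\<sigma>)"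
  proof (intro nn_integral_cong)
    fix u
    have "((\<lambda>y. - exp (- (a * y))) \<longlongrightarrow> - 0) at_top"
      using a by (intro tendsto_minus filterlim_compose[OF exp_at_bot])
        (simp add: filterlim_uminus_at_bot filterlim_tendsto_pos_mult_at_top[OF tendsto_const _ filterlim_ident])
    hence "(\<integral>\<^sup>+y. ennreal (a * exp (- (a * y))) * indicator {b * T u..} y \<partial>lborel) = ennreal (0 - (- exp (- (a * (b * T u)))))"
      using a by (intro nn_integral_FTC_atLeast[where F="\<lambda>y. - exp (- (a * y))"]) (auto intro!: derivative_eq_intros)
    thus "ennreal (exp (- (a * (b * T u)))) = (\<integral>\<^sup>+y. ennreal (a * exp (- (a * y))) * indicator {b * T u..} y \<partial>lborel)" by simp
  qed
  also have "\<dots> = (\<integral>\<^sup>+u. \<integral>\<^sup>+y. ennreal (a * exp (- (a * y))) * indicator {p. b * T (fst p) \<le> snd p} (u, y) \<partial>lborel \<partial>\<sigma>)"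
    by (intro nn_integral_cong) (auto simp: indicator_def)
  also have "\<dots> = (\<integral>\<^sup>+y. \<integral>\<^sup>+u. ennreal (a * exp (- (a * y))) * indicator {p. b * T (fst p) \<le> snd p} (u, y) \<partial>\<sigma> \<partial>lborel)"
    by (rule L.Fubini'[symmetric]) measurable
  also have "\<dots> = (\<integral>\<^sup>+y. ennreal (indicator {0..} y * (a * exp (- (a * y)) * cap (y / b))) \<partial>lborel)"
  proof (intro nn_integral_cong)
    fix y
    have "(\<integral>\<^sup>+u. ennreal (a * exp (- (a * y))) * indicator {p. b * T (fst p) \<le> snd p} (u, y) \<partial>\<sigma>)
        = (\<integral>\<^sup>+u. ennreal (a * exp (- (a * y))) * indicator {u. T u \<le> y / b} u \<partial>\<sigma>)"
      using b by (intro nn_integral_cong) (auto simp: indicator_def field_simps)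
    also have "\<dots> = ennreal (a * exp (- (a * y))) * ennreal (cap (y / b))"
      by (subst nn_integral_cmult_indicator) (auto simp: cap_def emeasure_eq_measure)
    also have "\<dots> = ennreal (indicator {0..} y * (a * exp (- (a * y)) * cap (y / b)))"
      using a b cap_neg[of "y / b"]
      by (cases "y < 0") (auto simp: ennreal_mult'[symmetric] divide_neg_pos)
    finally show "(\<integral>\<^sup>+u. ennreal (a * exp (- (a * y))) * indicator {p. b * T (fst p) \<le> snd p} (u, y) \<partial>\<sigma>)
       = ennreal (indicator {0..} y * (a * exp (- (a * y)) * cap (y / b)))" .
  qed
  finally show ?thesis .
qed

lemma integral_height_intensity_exp:
  assumes a: "a > 0"
  shows "integrable height_intensity (\<lambda>y. exp (- (a * y)))"
    and "(\<integral>y. exp (- (a * y)) \<partial>height_intensity) = intensity_const * (Gamma (real m / 2) / a powr (real m / 2))"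
proof -
  have x: "real m / 2 > 0" using m1 by simp
  note g = has_bochner_integral_Gamma[OF x a]
  have eq: "(indicator {0..} y * intensity_const * y powr (real m / 2 - 1)) *\<^sub>R exp (- (a * y))
      = intensity_const * (indicator {0..} y * (y powr (real m / 2 - 1) * exp (- (a * y))))" for y :: real
    by simp
  have nn: "AE y in lborel. 0 \<le> indicator {0..} y * intensity_const * y powr (real m / 2 - 1)"
    using intensity_const_pos by auto
  show "integrable height_intensity (\<lambda>y. exp (- (a * y)))"
    unfolding height_intensity_def using g nn
    by (subst integrable_density) (auto simp only: eq integrable_mult_right has_bochner_integral_iff, measurable)
  show "(\<integral>y. exp (- (a * y)) \<partial>height_intensity) = intensity_const * (Gamma (real m / 2) / a powr (real m / 2))"
    unfolding height_intensity_def using g nn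
    by (subst integral_density) (auto simp only: eq integral_mult_right_zero has_bochner_integral_iff, measurable)
qed

text \<open>In the layer cake formula \<open>real n * cap (y / \<beta> n)\<close> tends to c y^(m/2)
  by the cap asymptotics. The uniform cap bound, together with boundedness of the convergent scaling
  sequence, dominates the integrands.\<close>

lemma laplace_height:
  assumes a: "a > 0"
  shows "(\<lambda>n. real n * (\<integral>u. decay a n u \<partial>\<sigma>)) \<longlonglongrightarrow> (\<integral>y. exp (- (a * y)) \<partial>height_intensity)"
proof -
  \<comment> \<open>The exponent is left unsimplified to match the Gamma integral at m/2 +
    1.\<close>
  let ?w = "\<lambda>y. indicator {0..} y * (y powr (real m / 2 + 1 - 1) * exp (- (a * y)))"
  define c where "c = unit_ball_vol (real m) * sqrt 2 ^ m * \<zeta>"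
  obtain C where C: "C \<ge> 0" "\<And>e. e > 0 \<Longrightarrow> cap e \<le> C * sqrt e ^ m"
    using sphere_cap_le[OF q m] by (auto simp: cap_def T_def)
  define z where "z = (\<lambda>n. real n * (1 / sqrt (\<beta> n)) ^ m)"
  have zlim: "z \<longlonglongrightarrow> \<zeta>" unfolding z_def by (rule \<zeta>)
  obtain B where B: "B > 0" "\<And>n. norm (z n) \<le> B"
    using convergent_imp_Bseq[OF convergentI[OF zlim]] unfolding Bseq_def by blast
  have z0: "z n \<ge> 0" for n using \<beta>_pos[of n] by (simp add: z_def)
  have sq: "sqrt (y / \<beta> n) ^ m = (1 / sqrt (\<beta> n)) ^ m * sqrt y ^ m" for y n
    by (simp add: real_sqrt_divide power_divide)
  have x: "real m / 2 + 1 > 0" by simp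
  note g = has_bochner_integral_Gamma[OF x a]
  have conv: "(\<lambda>n. \<integral>y. real n * (indicator {0..} y * (a * exp (- (a * y)) * cap (y / \<beta> n))) \<partial>lborel)
      \<longlonglongrightarrow> (\<integral>y. (a * c) * ?w y \<partial>lborel)"
  proof (rule integral_dominated_convergence[where w="\<lambda>y. (a * C * B) * ?w y"])
    show "integrable lborel (\<lambda>y. (a * C * B) * ?w y)"
      using g by (intro integrable_mult_right) (simp add: has_bochner_integral_iff)
    have y0: "AE y in lborel. y \<noteq> (0::real)" by (rule AE_lborel_singleton)
    show "AE y in lborel. (\<lambda>n. real n * (indicator {0..} y * (a * exp (- (a * y)) * cap (y / \<beta> n))))
        \<longlonglongrightarrow> (a * c) * ?w y"
      using y0
    proof eventually_elim
      case (elim y)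
      show ?case
      proof (cases "y > 0")
        case True
        have "filterlim (\<lambda>n. y / \<beta> n) (at_right 0) sequentially"
          unfolding filterlim_at using True \<beta>_pos
          by (intro conjI real_tendsto_divide_at_top[OF tendsto_const \<beta>_top] always_eventually) (simp add: less_imp_neq[symmetric])
        from filterlim_compose[OF sphere_cap_asymptotics[OF q m] this]
        have "(\<lambda>n. cap (y / \<beta> n) / sqrt (y / \<beta> n) ^ m) \<longlonglongrightarrow> unit_ball_vol (real m) * sqrt 2 ^ m"
          by (simp add: cap_def T_def)
        hence "(\<lambda>n. (a * exp (- (a * y)) * sqrt y ^ m) * (z n * (cap (y / \<beta> n) / sqrt (y / \<beta> n) ^ m)))
           \<longlonglongrightarrow> (a * exp (- (a * y)) * sqrt y ^ m) * (\<zeta> * (unit_ball_vol (real m) * sqrt 2 ^ m))"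
          by (intro tendsto_intros zlim)
        moreover have "(a * exp (- (a * y)) * sqrt y ^ m) * (z n * (cap (y / \<beta> n) / sqrt (y / \<beta> n) ^ m))
            = real n * (indicator {0..} y * (a * exp (- (a * y)) * cap (y / \<beta> n)))" for n
          using True \<beta>_pos[of n] unfolding sq by (simp add: z_def)
        moreover have "(a * exp (- (a * y)) * sqrt y ^ m) * (\<zeta> * (unit_ball_vol (real m) * sqrt 2 ^ m))
            = (a * c) * ?w y"
          using True by (simp add: c_def sqrt_power_eq_powr)
        ultimately show ?thesis by simp
      qed (use elim in auto)
    qed
    show "AE y in lborel. norm (real n * (indicator {0..} y * (a * exp (- (a * y)) * cap (y / \<beta> n))))
        \<le> (a * C * B) * ?w y" for n
      using y0
    proof eventually_elim
      case (elim y)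
      show ?case
      proof (cases "y > 0")
        case True
        have c0: "cap e \<ge> 0" for e by (simp add: cap_def)
        have "real n * cap (y / \<beta> n) \<le> real n * (C * sqrt (y / \<beta> n) ^ m)"
          using True \<beta>_pos[of n] by (intro mult_left_mono C) auto
        also have "\<dots> = C * (z n * sqrt y ^ m)" unfolding sq by (simp add: z_def)
        also have "\<dots> \<le> C * (B * sqrt y ^ m)"
          using True C(1) B(2)[of n] by (intro mult_left_mono mult_right_mono) auto
        finally have "(a * exp (- (a * y))) * (real n * cap (y / \<beta> n)) \<le> (a * exp (- (a * y))) * (C * (B * sqrt y ^ m))"
          using a by (intro mult_left_mono) auto
        thus ?thesis using True a c0 by (simp add: sqrt_power_eq_powr mult_ac abs_mult)
      qed (use elim in auto)
    qed
  qed measurable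
  have "(\<integral>u. decay a n u \<partial>\<sigma>) = (\<integral>y. indicator {0..} y * (a * exp (- (a * y)) * cap (y / \<beta> n)) \<partial>lborel)" for n
  proof -
    have "(\<integral>u. decay a n u \<partial>\<sigma>) = enn2real (\<integral>\<^sup>+y. ennreal (indicator {0..} y * (a * exp (- (a * y)) * cap (y / \<beta> n))) \<partial>lborel)"
      using layer_cake[OF a \<beta>_pos[of n]] by (subst integral_eq_nn_integral) auto
    also have "\<dots> = (\<integral>y. indicator {0..} y * (a * exp (- (a * y)) * cap (y / \<beta> n)) \<partial>lborel)"
      using a by (subst integral_eq_nn_integral) (auto simp: cap_def)
    finally show ?thesis .
  qed
  hence "(\<lambda>n. real n * (\<integral>u. decay a n u \<partial>\<sigma>))
      \<longlonglongrightarrow> (\<integral>y. (a * c) * ?w y \<partial>lborel)"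
    using conv by simp
  also have "(\<integral>y. (a * c) * ?w y \<partial>lborel)
      = (a * c) * (Gamma (real m / 2 + 1) / a powr (real m / 2 + 1))"
    using g by (simp only: integral_mult_right_zero has_bochner_integral_iff)
  \<comment> \<open>The Gamma recursion plays the part of an integration by parts, trading the
    cumulative function c y^(m/2) for its derivative, the height density.\<close>
  also have "\<dots> = (\<integral>y. exp (- (a * y)) \<partial>height_intensity)"
  proof -
    have Gamma_half: "Gamma (real m / 2 + 1) = (real m / 2) * Gamma (real m / 2)"
      by (rule Gamma_plus1) (use m1 in auto)
    show ?thesis using a
      unfolding Gamma_half integral_height_intensity_exp(2)[OF a] intensity_const_def c_def powr_add by simp
  qed
  finally show ?thesis .
qed

lemma height_bounded:
  assumes "a > 0"
  obtains B where "B > 0" "\<And>n. real n * (\<integral>u. decay a n u \<partial>\<sigma>) \<le> B"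
proof -
  obtain B where "B > 0" "\<And>n. norm (real n * (\<integral>u. decay a n u \<partial>\<sigma>)) \<le> B"
    using convergent_imp_Bseq[OF convergentI[OF laplace_height[OF assms]]] unfolding Bseq_def by blast
  thus ?thesis using that by (metis real_norm_def abs_le_D1)
qed

lemma integrable_exp_height:
  assumes "a \<ge> 0" shows "integrable \<sigma> (\<lambda>u. decay a n u)"
proof (rule integrable_const_bound[where B=1])
  show "AE u in \<sigma>. norm (decay a n u) \<le> 1"
    using AE_sphere by eventually_elim (use assms \<beta>_pos[of n] in simp)
qed measurable

text \<open>The limiting measure is infinite, so both sides are tilted by exp(-y/2). The hypothesis
  on \<open>g\<close> says precisely that \<open>g\<close> times the inverse tilt is bounded, and
  the weak limit theorem then applies to finite measures.\<close>

lemma height_limit: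
  fixes g :: "real \<Rightarrow> real"
  assumes [measurable]: "g \<in> borel_measurable borel" and cont: "continuous_on {0..} g"
    and bd: "\<And>y. y \<ge> 0 \<Longrightarrow> \<bar>g y\<bar> \<le> C * exp (- (y / 2))"
  shows "(\<lambda>n. real n * (\<integral>u. g (\<beta> n * T u) \<partial>\<sigma>)) \<longlonglongrightarrow> (\<integral>y. g y \<partial>height_intensity)"
proof -
  define Mn where "Mn n = density \<sigma> (\<lambda>u. ennreal (real n * decay (1/2) n u))" for n
  define L where "L = density height_intensity (\<lambda>y. ennreal (exp (- (1/2 * y))))"
  have [measurable_cong, simp]: "sets (Mn n) = sets borel" "sets L = sets borel" for n
    by (simp_all add: Mn_def L_def)
  have intM: "(\<integral>u. f (\<beta> n * T u) \<partial>Mn n) = real n * (\<integral>u. decay (1/2) n u * f (\<beta> n * T u) \<partial>\<sigma>)"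
    if [measurable]: "f \<in> borel_measurable borel" for f :: "real \<Rightarrow> real" and n
    unfolding Mn_def by (subst integral_density) (auto simp: mult.assoc)
  have intL: "(\<integral>y. f y \<partial>L) = (\<integral>y. exp (- (1/2 * y)) * f y \<partial>height_intensity)"
    if [measurable]: "f \<in> borel_measurable borel" for f :: "real \<Rightarrow> real"
    unfolding L_def by (subst integral_density) auto
  have H: "laplace_limit Mn (\<lambda>n u. \<beta> n * T u) L (\<lambda>y. y)"
  proof (rule laplace_limit.intro, goal_cases)
    case (1 n)
    have "(\<integral>\<^sup>+u. ennreal (real n * decay (1/2) n u) \<partial>\<sigma>) < \<infinity>"
      using integrable_exp_height[of "1/2" n]
      by (subst ennreal_mult', simp, subst nn_integral_cmult) (auto simp: ennreal_mult_less_top nn_integral_eq_integral)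
    thus ?case unfolding Mn_def by (intro finite_measureI) (simp add: emeasure_density)
  next
    case 2
    have "(\<integral>\<^sup>+y. ennreal (exp (- (1/2 * y))) \<partial>height_intensity) < \<infinity>"
      using integral_height_intensity_exp(1)[of "1/2"] by (subst nn_integral_eq_integral) auto
    thus ?case unfolding L_def using sets_eq_imp_space_eq[OF sets_height_intensity]
      by (intro finite_measureI) (simp add: emeasure_density)
  next
    case (3 n)
    show ?case by measurable
  next
    case (5 n)
    have "AE u in \<sigma>. \<forall>b\<in>Basis. 0 \<le> (\<beta> n * T u) \<bullet> b"
      using AE_sphere by eventually_elim (use \<beta>_pos[of n] in \<open>simp add: Basis_real_def\<close>)
    thus ?case unfolding Mn_def
      by (subst AE_density) (auto elim!: eventually_mono)
  next
    case 6
    show ?case unfolding L_def using AE_height_intensity_pos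
      by (subst AE_density) (auto elim!: eventually_mono simp: Basis_real_def)
  next
    case (7 u)
    hence u: "u \<ge> 0" by (simp add: Basis_real_def)
    \<comment> \<open>The tilt raises the Laplace parameter to \<open>1/2 + u\<close>, so
      \<open>laplace_height\<close> is available even at \<open>u = 0\<close>.\<close>
    have "exp (- (1/2 * y)) * exp (- (u \<bullet> y)) = exp (- ((1/2 + u) * y))" for y :: real
      by (simp add: exp_add[symmetric] algebra_simps)
    hence "(\<integral>w. exp (- (u \<bullet> (\<beta> n * T w))) \<partial>Mn n) = real n * (\<integral>w. exp (- ((1/2 + u) * (\<beta> n * T w))) \<partial>\<sigma>)"
      and "(\<integral>y. exp (- (u \<bullet> y)) \<partial>L) = (\<integral>y. exp (- ((1/2 + u) * y)) \<partial>height_intensity)" for n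
      using intM[of "\<lambda>y. exp (- (u \<bullet> y))"] intL[of "\<lambda>y. exp (- (u \<bullet> y))"] by simp_all
    thus ?case using laplace_height[of "1/2 + u"] u by simp
  qed measurable
  \<comment> \<open>The truncation at 0 is needed because \<open>limit\<close> asks for a bound on
    all reals, while \<open>g\<close> is controlled only for nonnegative heights.\<close>
  define h where "h y = g (max 0 y) * exp (max 0 y / 2)" for y
  have h [measurable]: "h \<in> borel_measurable borel" unfolding h_def by measurable
  have h_eq: "exp (- (1/2 * y)) * h y = g y" if "0 \<le> y" for y
    using that by (simp add: h_def max_absorb2 exp_minus)
  have "(\<lambda>n. \<integral>u. h (\<beta> n * T u) \<partial>Mn n) \<longlonglongrightarrow> (\<integral>y. h y \<partial>L)"
  proof (rule laplace_limit.limit[OF H])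
    show "(1::real) \<in> Basis" by simp
    show "AE y in L. 0 < y \<bullet> 1"
      unfolding L_def using AE_height_intensity_pos by (subst AE_density) (auto elim!: eventually_mono)
    show "continuous_on {s. 0 < s \<bullet> 1 \<and> (\<forall>b\<in>Basis. 0 \<le> s \<bullet> b)} h"
      unfolding h_def by (intro continuous_intros continuous_on_compose2[OF cont]) auto
    show "\<bar>h s\<bar> \<le> C" for s
    proof -
      have "\<bar>h s\<bar> \<le> (C * exp (- (max 0 s / 2))) * exp (max 0 s / 2)"
        unfolding h_def abs_mult using bd[of "max 0 s"] by (intro mult_mono) auto
      thus ?thesis by (simp add: mult.assoc exp_add[symmetric])
    qed
    show "h \<in> borel_measurable borel" by (rule h)
  qed
  moreover have "(\<integral>u. h (\<beta> n * T u) \<partial>Mn n) = real n * (\<integral>u. g (\<beta> n * T u) \<partial>\<sigma>)" for n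
  proof -
    have "AE u in \<sigma>. decay (1/2) n u * h (\<beta> n * T u) = g (\<beta> n * T u)"
      using AE_sphere
    proof eventually_elim
      case (elim u)
      have "0 \<le> \<beta> n * T u" using elim \<beta>_pos[of n] by simp
      thus ?case by (rule h_eq)
    qed
    moreover have "(\<lambda>u. g (\<beta> n * T u)) \<in> borel_measurable \<sigma>"
       "(\<lambda>u. decay (1/2) n u * h (\<beta> n * T u)) \<in> borel_measurable \<sigma>" by measurable
    ultimately have "(\<integral>u. decay (1/2) n u * h (\<beta> n * T u) \<partial>\<sigma>) = (\<integral>u. g (\<beta> n * T u) \<partial>\<sigma>)"
      by (intro integral_cong_AE)
    thus ?thesis by (simp only: intM[OF h])
  qed
  moreover have "(\<integral>y. h y \<partial>L) = (\<integral>y. g y \<partial>height_intensity)"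
  proof -
    have "AE y in height_intensity. exp (- (1/2 * y)) * h y = g y"
      using AE_height_intensity_pos by eventually_elim (rule h_eq[OF less_imp_le])
    thus ?thesis unfolding intL[OF h] by (intro integral_cong_AE) measurable
  qed
  ultimately show ?thesis by (simp only:)
qed

end

section \<open>Joint limit of height and direction under the density\<close>

context cap_scaling
begin

lemma dim_ge_2: "DIM('a) \<ge> 2"
  using m m1 by simp

text \<open>For each n the direction is integrated out exactly, which leaves a limit for the
  directional average \<open>g\<close> alone. Its continuity follows by dominated
  convergence.\<close>

lemma height_direction_limit:
  fixes G :: "real \<times> 'a \<Rightarrow> real"
  assumes Gm [measurable]: "G \<in> borel_measurable borel" and cont: "continuous_on ({0..} \<times> UNIV) G"
    and B: "\<And>p. \<bar>G p\<bar> \<le> B"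
    and C: "\<And>y \<theta>. 0 \<le> y \<Longrightarrow> \<theta> \<in> orth_sphere q \<Longrightarrow> \<bar>G (y, \<theta>)\<bar> \<le> C * exp (- (y / 2))"
  shows "(\<lambda>n. real n * (\<integral>u. G (\<beta> n * T u, tang q u) \<partial>\<sigma>)) \<longlonglongrightarrow> (\<integral>y. \<integral>\<theta>. G (y, \<theta>) \<partial>\<nu> \<partial>height_intensity)"
proof -
  note \<nu>D = uniform_on_orth_sphereD[OF \<nu>]
  note [measurable_cong] = \<nu>D(2)
  define g where "g y = (\<integral>\<theta>. G (y, \<theta>) \<partial>\<nu>)" for y
  have [measurable]: "(\<lambda>\<theta>. G (y, \<theta>)) \<in> borel_measurable \<nu>" for y by measurable
  have gm: "g \<in> borel_measurable borel" unfolding g_def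
    by (rule N.borel_measurable_lebesgue_integral) measurable
  have intG: "integrable \<nu> (\<lambda>\<theta>. G (y, \<theta>))" for y
    by (rule N.integrable_const_bound[where B=B]) (use B in auto)
  have "(\<lambda>n. real n * (\<integral>u. g (\<beta> n * T u) \<partial>\<sigma>)) \<longlonglongrightarrow> (\<integral>y. g y \<partial>height_intensity)"
  proof (rule height_limit[OF gm])
    show "continuous_on {0..} g"
      unfolding continuous_on_sequentially comp_def
    proof (intro allI ballI impI, elim conjE)
      fix x and a :: real assume x: "\<forall>n. x n \<in> {0..}" "a \<in> {0..}" "x \<longlonglongrightarrow> a"
      show "(\<lambda>n. g (x n)) \<longlonglongrightarrow> g a"
        unfolding g_def
      proof (rule integral_dominated_convergence[where w="\<lambda>_. B"])
        have "(\<lambda>n. G (x n, \<theta>)) \<longlonglongrightarrow> G (a, \<theta>)" for \<theta>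
          by (rule continuous_on_tendsto_compose[OF cont]) (use x in \<open>auto intro!: tendsto_intros\<close>)
        thus "AE \<theta> in \<nu>. (\<lambda>n. G (x n, \<theta>)) \<longlonglongrightarrow> G (a, \<theta>)" by simp
      qed (use B in auto)
    qed
    fix y :: real assume y: "0 \<le> y"
    have "\<bar>g y\<bar> \<le> (\<integral>\<theta>. \<bar>G (y, \<theta>)\<bar> \<partial>\<nu>)" unfolding g_def by (rule integral_abs_bound)
    also have "\<dots> \<le> (\<integral>\<theta>. C * exp (- (y / 2)) \<partial>\<nu>)"
      using \<nu>D(4) C[OF y] intG by (intro integral_mono_AE) (auto elim!: eventually_mono)
    finally show "\<bar>g y\<bar> \<le> C * exp (- (y / 2))" by (simp add: N.prob_space)
  qed
  moreover have "(\<integral>u. G (\<beta> n * T u, tang q u) \<partial>\<sigma>) = (\<integral>u. g (\<beta> n * T u) \<partial>\<sigma>)" for n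
  proof -
    have pm: "(\<lambda>p. (\<beta> n * fst p, snd p :: 'a)) \<in> borel_measurable borel"
      by (intro borel_measurable_continuous_onI continuous_intros)
    have "continuous_on ({0..} \<times> UNIV) (\<lambda>p. G (\<beta> n * fst p, snd p))"
      by (rule continuous_on_compose2[OF cont]) (use \<beta>_pos[of n] in \<open>auto intro!: continuous_intros\<close>)
    from sphere_integral_height_direction[OF dim_ge_2 q \<nu> measurable_compose[OF pm Gm] this B]
    show ?thesis by (simp add: T_def g_def)
  qed
  ultimately show ?thesis by (simp only: g_def)
qed

text \<open>Close to \<open>q\<close> the density differs little from its value there, and n times
  the integral of the weight stays bounded. Away from \<open>q\<close> half of the exponent gives a
  factor exp(-beta_n \<delta>/4) tending to 0, while the other half still has bounded integrals
  after multiplication by n.\<close>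

lemma density_localises:
  fixes \<rho> :: "'a \<Rightarrow> real"
  assumes [measurable]: "\<rho> \<in> borel_measurable borel"
    and R: "\<And>u. norm u = 1 \<Longrightarrow> \<bar>\<rho> u\<bar> \<le> R" and cont: "continuous (at q within sphere 0 1) \<rho>"
  shows "(\<lambda>n. real n * (\<integral>u. \<bar>\<rho> u - \<rho> q\<bar> * decay (1/2) n u \<partial>\<sigma>)) \<longlonglongrightarrow> 0"
proof -
  let ?D = "\<lambda>n u. \<bar>\<rho> u - \<rho> q\<bar> * decay (1/2) n u"
  obtain B1 where B1: "B1 > 0" "\<And>n. real n * (\<integral>u. decay (1/2) n u \<partial>\<sigma>) \<le> B1"
    using height_bounded[of "1/2"] by auto
  obtain B2 where B2: "B2 > 0" "\<And>n. real n * (\<integral>u. decay (1/4) n u \<partial>\<sigma>) \<le> B2"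
    using height_bounded[of "1/4"] by auto
  have R0: "R \<ge> 0" using R[OF q] by linarith
  have int: "integrable \<sigma> (\<lambda>u. decay (1/2) n u)" "integrable \<sigma> (\<lambda>u. decay (1/4) n u)" for n
    using integrable_exp_height[of "1/2" n] integrable_exp_height[of "1/4" n] by simp_all
  show ?thesis
  proof (rule tendstoI)
    fix e :: real assume e: "e > 0"
    define e' where "e' = e / (2 * B1)"
    have e': "e' > 0" "e' * B1 = e / 2" using e B1 by (auto simp: e'_def)
    obtain d where d: "d > 0" "\<And>u. norm u = 1 \<Longrightarrow> dist u q < d \<Longrightarrow> dist (\<rho> u) (\<rho> q) < e'"
      using cont e'(1) unfolding continuous_within_eps_delta by auto
    \<comment> \<open>On the sphere the squared distance to \<open>q\<close> is
      \<open>2 * T u\<close>, so heights below \<open>\<delta>\<close> mean distances below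
      \<open>d\<close>.\<close>
    define \<delta> where "\<delta> = d\<^sup>2 / 2"
    have \<delta>: "\<delta> > 0" using d by (simp add: \<delta>_def)
    have close: "\<bar>\<rho> u - \<rho> q\<bar> \<le> e'" if u: "norm u = 1" "T u < \<delta>" for u
    proof -
      have "(dist u q)\<^sup>2 = 2 * T u"
        using u(1) q by (simp add: dist_norm T_def power2_norm_eq_inner norm_eq_1 inner_simps inner_commute)
      also have "\<dots> < d\<^sup>2" using u by (simp add: \<delta>_def)
      finally have "dist u q < d" using d(1) by (simp add: power2_less_imp_less)
      thus ?thesis using d(2)[OF u(1)] by (simp add: dist_real_def)
    qed
    let ?F = "\<lambda>n u. e' * decay (1/2) n u + 2 * R * exp (- (\<beta> n * \<delta> / 4)) * decay (1/4) n u"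
    have bound: "real n * (\<integral>u. ?D n u \<partial>\<sigma>) \<le> e / 2 + 2 * R * exp (- (\<beta> n * \<delta> / 4)) * B2" for n
    proof -
      have "(\<integral>u. ?D n u \<partial>\<sigma>)
         \<le> (\<integral>u. ?F n u \<partial>\<sigma>)"
      proof (rule integral_mono_AE)
        have ae: "AE u in \<sigma>. ?D n u
           \<le> ?F n u"
          using AE_sphere
        proof eventually_elim
          case (elim u)
          hence u: "norm u = 1" by simp
          show ?case
          proof (cases "T u < \<delta>")
            case True
            have "?D n u \<le> e' * decay (1/2) n u"
              using close[OF u True] by (intro mult_right_mono) auto
            thus ?thesis using R0 by (simp add: add_increasing2)
          next
            case False
            have "decay (1/2) n u = exp (- (\<beta> n * T u / 4)) * decay (1/4) n u"
              by (simp add: exp_add[symmetric])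
            also have "\<dots> \<le> exp (- (\<beta> n * \<delta> / 4)) * decay (1/4) n u"
              using False \<beta>_pos[of n] by (intro mult_right_mono) auto
            finally have "?D n u \<le> (2 * R) * (exp (- (\<beta> n * \<delta> / 4)) * decay (1/4) n u)"
              using R[OF u] R[OF q] by (intro mult_mono) auto
            moreover have "0 \<le> e' * decay (1/2) n u" using e' by simp
            ultimately show ?thesis by (simp add: mult.assoc)
          qed
        qed
        show "AE u in \<sigma>. ?D n u
           \<le> ?F n u" by (rule ae)
        show i: "integrable \<sigma> (\<lambda>u. ?F n u)"
          using int by (intro Bochner_Integration.integrable_add integrable_mult_right)
        show "integrable \<sigma> (\<lambda>u. ?D n u)"
        proof (rule Bochner_Integration.integrable_bound[OF i])
          show "AE u in \<sigma>. norm (?D n u)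
           \<le> norm (?F n u)"
            using ae by eventually_elim (simp add: abs_mult)
        qed measurable
      qed
      also have "\<dots> = e' * (\<integral>u. decay (1/2) n u \<partial>\<sigma>) + 2 * R * exp (- (\<beta> n * \<delta> / 4)) * (\<integral>u. decay (1/4) n u \<partial>\<sigma>)"
        using int by (subst Bochner_Integration.integral_add) (auto simp only: integrable_mult_right integral_mult_right_zero)
      finally have "real n * (\<integral>u. ?D n u \<partial>\<sigma>)
        \<le> real n * (e' * (\<integral>u. decay (1/2) n u \<partial>\<sigma>) + 2 * R * exp (- (\<beta> n * \<delta> / 4)) * (\<integral>u. decay (1/4) n u \<partial>\<sigma>))"
        by (rule mult_left_mono) simp
      also have "\<dots> = e' * (real n * (\<integral>u. decay (1/2) n u \<partial>\<sigma>))
          + 2 * R * exp (- (\<beta> n * \<delta> / 4)) * (real n * (\<integral>u. decay (1/4) n u \<partial>\<sigma>))"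
        by (simp only: algebra_simps)
      also have "\<dots> \<le> e' * B1 + 2 * R * exp (- (\<beta> n * \<delta> / 4)) * B2"
        using e' R0 B1 B2 by (intro add_mono mult_left_mono) auto
      finally show ?thesis using e'(2) by simp
    qed
    have "filterlim (\<lambda>n. \<delta> / 4 * \<beta> n) at_top sequentially"
      using \<delta> by (intro filterlim_tendsto_pos_mult_at_top[OF tendsto_const _ \<beta>_top]) auto
    hence "(\<lambda>n. exp (- (\<delta> / 4 * \<beta> n))) \<longlonglongrightarrow> 0"
      by (intro filterlim_compose[OF exp_at_bot]) (simp add: filterlim_uminus_at_bot)
    hence "(\<lambda>n. 2 * R * exp (- (\<delta> / 4 * \<beta> n)) * B2) \<longlonglongrightarrow> 2 * R * 0 * B2"
      by (intro tendsto_intros)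
    hence "(\<lambda>n. 2 * R * exp (- (\<beta> n * \<delta> / 4)) * B2) \<longlonglongrightarrow> 0" by (simp add: mult_ac)
    hence "eventually (\<lambda>n. 2 * R * exp (- (\<beta> n * \<delta> / 4)) * B2 < e / 2) sequentially"
      by (rule order_tendstoD(2)) (use e in simp)
    thus "eventually (\<lambda>n. dist (real n * (\<integral>u. ?D n u \<partial>\<sigma>)) 0 < e) sequentially"
    proof eventually_elim
      case (elim n)
      have "0 \<le> real n * (\<integral>u. ?D n u \<partial>\<sigma>)"
        by (intro mult_nonneg_nonneg integral_nonneg_AE) auto
      thus ?case using bound[of n] elim by (simp add: dist_real_def)
    qed
  qed
qed

text \<open>\<open>H n\<close> is the actual integrand and \<open>G\<close> its idealisation in
  terms of height and direction; an error of order beta_n^(-1/2) with an exponential weight is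
  negligible after multiplication by n.\<close>

lemma sphere_density_limit:
  fixes \<rho> :: "'a \<Rightarrow> real" and G :: "real \<times> 'a \<Rightarrow> real"
  assumes rm [measurable]: "\<rho> \<in> borel_measurable borel"
    and R: "\<And>u. norm u = 1 \<Longrightarrow> \<bar>\<rho> u\<bar> \<le> R" and rc: "continuous (at q within sphere 0 1) \<rho>"
    and Gm [measurable]: "G \<in> borel_measurable borel" and cont: "continuous_on ({0..} \<times> UNIV) G"
    and B: "\<And>p. \<bar>G p\<bar> \<le> B"
    and C: "\<And>y \<theta>. 0 \<le> y \<Longrightarrow> \<theta> \<in> orth_sphere q \<Longrightarrow> \<bar>G (y, \<theta>)\<bar> \<le> C * exp (- (y / 2))"
    and Hm [measurable]: "\<And>n. H n \<in> borel_measurable borel"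
    and H: "\<And>n u. norm u = 1 \<Longrightarrow> tang q u \<in> orth_sphere q \<Longrightarrow> 0 \<le> T u \<Longrightarrow>
      \<bar>H n u - G (\<beta> n * T u, tang q u)\<bar> \<le> K / sqrt (\<beta> n) * decay (1/2) n u"
  shows "(\<lambda>n. real n * (\<integral>u. \<rho> u * H n u \<partial>\<sigma>)) \<longlonglongrightarrow> \<rho> q * (\<integral>y. \<integral>\<theta>. G (y, \<theta>) \<partial>\<nu> \<partial>height_intensity)"
proof -
  let ?G = "\<lambda>n u. G (\<beta> n * T u, tang q u)" and ?D = "\<lambda>n u. \<bar>\<rho> u - \<rho> q\<bar> * decay (1/2) n u"
  obtain B1 where B1: "B1 > 0" "\<And>n. real n * (\<integral>u. decay (1/2) n u \<partial>\<sigma>) \<le> B1"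
    using height_bounded[of "1/2"] by auto
  have R0: "R \<ge> 0" using R[OF q] by linarith
  have int: "integrable \<sigma> (\<lambda>u. decay (1/2) n u)" for n
    using integrable_exp_height[of "1/2" n] by simp
  have [measurable]: "(\<lambda>u. ?G n u) \<in> borel_measurable borel" for n by measurable
  have intG: "integrable \<sigma> (\<lambda>u. \<rho> q * ?G n u)" for n
    by (intro integrable_mult_right integrable_const_bound[where B=B]) (use B in auto)
  have intr: "integrable \<sigma> (\<lambda>u. ?D n u)" for n
  proof (rule integrable_const_bound[where B="2 * R"])
    show "AE u in \<sigma>. norm (?D n u) \<le> 2 * R"
      using AE_sphere
    proof eventually_elim
      case (elim u)
      have "?D n u \<le> (2 * R) * 1"
        using elim R[of u] R[OF q] \<beta>_pos[of n] by (intro mult_mono) auto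
      thus ?case by (simp add: abs_mult)
    qed
  qed measurable
  \<comment> \<open>The two terms account for replacing \<open>H n\<close> by \<open>G\<close> and
    for replacing the density by its value at \<open>q\<close>.\<close>
  define err where "err n u = R * (K / sqrt (\<beta> n)) * decay (1/2) n u + C * (?D n u)" for n u
  have interr: "integrable \<sigma> (err n)" for n
    unfolding err_def by (intro Bochner_Integration.integrable_add integrable_mult_right int intr)
  have diff: "AE u in \<sigma>. \<bar>\<rho> u * H n u - \<rho> q * ?G n u\<bar> \<le> err n u" for n
    using AE_sphere
  proof eventually_elim
    case (elim u)
    let ?e = "decay (1/2) n u"
    have "0 \<le> \<beta> n * T u" using elim \<beta>_pos[of n] by simp
    hence G: "\<bar>?G n u\<bar> \<le> C * ?e" using C[of "\<beta> n * T u" "tang q u"] elim by simp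
    have "\<bar>\<rho> u * H n u - \<rho> q * ?G n u\<bar> = \<bar>\<rho> u * (H n u - ?G n u) + (\<rho> u - \<rho> q) * ?G n u\<bar>"
      by (simp add: algebra_simps)
    also have "\<dots> \<le> \<bar>\<rho> u\<bar> * \<bar>H n u - ?G n u\<bar> + \<bar>\<rho> u - \<rho> q\<bar> * \<bar>?G n u\<bar>"
      unfolding abs_mult[symmetric] by (rule abs_triangle_ineq)
    also have "\<dots> \<le> R * (K / sqrt (\<beta> n) * ?e) + \<bar>\<rho> u - \<rho> q\<bar> * (C * ?e)"
      using elim R[of u] R0 H[of u n] G by (intro add_mono mult_mono) auto
    also have "\<dots> = err n u" by (simp only: err_def mult_ac)
    finally show ?case .
  qed
  have intH: "integrable \<sigma> (\<lambda>u. \<rho> u * H n u)" for n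
  proof (rule Bochner_Integration.integrable_bound)
    show "integrable \<sigma> (\<lambda>u. err n u + \<bar>\<rho> q * ?G n u\<bar>)"
      by (intro Bochner_Integration.integrable_add interr integrable_abs intG)
    show "AE u in \<sigma>. norm (\<rho> u * H n u) \<le> norm (err n u + \<bar>\<rho> q * ?G n u\<bar>)"
      using diff[of n] by eventually_elim (simp; linarith)
  qed measurable
  have err_lim: "(\<lambda>n. real n * (\<integral>u. err n u \<partial>\<sigma>)) \<longlonglongrightarrow> 0"
  proof -
    have eq: "real n * (\<integral>u. err n u \<partial>\<sigma>) = R * (K / sqrt (\<beta> n)) * (real n * (\<integral>u. decay (1/2) n u \<partial>\<sigma>))
        + C * (real n * (\<integral>u. ?D n u \<partial>\<sigma>))" for n
    proof -
      have "(\<integral>u. err n u \<partial>\<sigma>) = R * (K / sqrt (\<beta> n)) * (\<integral>u. decay (1/2) n u \<partial>\<sigma>)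
        + C * (\<integral>u. ?D n u \<partial>\<sigma>)"
        unfolding err_def using int intr
        by (subst Bochner_Integration.integral_add) (auto simp only: integrable_mult_right integral_mult_right_zero)
      thus ?thesis by (simp only: algebra_simps)
    qed
    have "filterlim (\<lambda>n. sqrt (\<beta> n)) at_top sequentially"
      by (rule filterlim_compose[OF sqrt_at_top \<beta>_top])
    hence "(\<lambda>n. K / sqrt (\<beta> n)) \<longlonglongrightarrow> 0" by (rule real_tendsto_divide_at_top[OF tendsto_const])
    hence "(\<lambda>n. R * (K / sqrt (\<beta> n)) * (real n * (\<integral>u. decay (1/2) n u \<partial>\<sigma>))
        + C * (real n * (\<integral>u. ?D n u \<partial>\<sigma>)))
      \<longlonglongrightarrow> R * 0 * (\<integral>y. exp (- (1/2 * y)) \<partial>height_intensity) + C * 0"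
      by (intro tendsto_intros laplace_height density_localises[OF rm R rc]) auto
    thus ?thesis unfolding eq by simp
  qed
  have "(\<lambda>n. real n * (\<integral>u. \<rho> u * H n u \<partial>\<sigma>) - \<rho> q * (real n * (\<integral>u. ?G n u \<partial>\<sigma>))) \<longlonglongrightarrow> 0"
  proof (rule tendsto_rabs_zero_cancel, rule tendsto_sandwich[OF _ _ tendsto_const err_lim])
    show "\<forall>\<^sub>F n in sequentially. \<bar>real n * (\<integral>u. \<rho> u * H n u \<partial>\<sigma>) - \<rho> q * (real n * (\<integral>u. ?G n u \<partial>\<sigma>))\<bar>
       \<le> real n * (\<integral>u. err n u \<partial>\<sigma>)"
    proof (intro always_eventually allI)
      fix n
      have "\<bar>(\<integral>u. \<rho> u * H n u \<partial>\<sigma>) - (\<integral>u. \<rho> q * ?G n u \<partial>\<sigma>)\<bar> \<le> (\<integral>u. err n u \<partial>\<sigma>)"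
        by (rule integral_diff_abs_le[OF intH intG interr diff])
      hence "real n * \<bar>(\<integral>u. \<rho> u * H n u \<partial>\<sigma>) - (\<integral>u. \<rho> q * ?G n u \<partial>\<sigma>)\<bar> \<le> real n * (\<integral>u. err n u \<partial>\<sigma>)"
        by (rule mult_left_mono) simp
      moreover have "real n * (\<integral>u. \<rho> u * H n u \<partial>\<sigma>) - \<rho> q * (real n * (\<integral>u. ?G n u \<partial>\<sigma>))
         = real n * ((\<integral>u. \<rho> u * H n u \<partial>\<sigma>) - (\<integral>u. \<rho> q * ?G n u \<partial>\<sigma>))"
        by (simp add: algebra_simps)
      ultimately show "\<bar>real n * (\<integral>u. \<rho> u * H n u \<partial>\<sigma>) - \<rho> q * (real n * (\<integral>u. ?G n u \<partial>\<sigma>))\<bar>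
       \<le> real n * (\<integral>u. err n u \<partial>\<sigma>)" by (simp only: abs_mult abs_of_nat)
    qed
  qed auto
  from tendsto_add[OF this tendsto_mult_left[OF height_direction_limit[OF Gm cont B C], of "\<rho> q"]]
  show ?thesis by simp
qed

end

section \<open>Nonnegative feature vectors and their limiting marks\<close>

text \<open>Adding \<open>norm w\<close> to every coordinate makes the vector nonnegative, so that Laplace
  transforms apply to signed displacements; \<open>displacement\<close> below undoes the shift.\<close>

definition feat :: "'a::euclidean_space \<Rightarrow> real \<times> (real \<times> 'a)" where
  "feat w = (1, norm w, w + norm w *\<^sub>R One)"

lemma continuous_on_feat: "continuous_on A feat"
  unfolding feat_def by (intro continuous_intros)

lemma feat_measurable [measurable]: "feat \<in> borel_measurable borel"
  by (intro borel_measurable_continuous_onI continuous_on_feat)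

lemma feat_nonneg: "b \<in> Basis \<Longrightarrow> 0 \<le> feat w \<bullet> b"
proof -
  assume b: "b \<in> Basis"
  have "0 \<le> (w + norm w *\<^sub>R One) \<bullet> i" if "i \<in> Basis" for i
    using Basis_le_norm[OF that, of w] that by (simp add: inner_simps)
  thus ?thesis using b by (auto simp: feat_def Basis_prod_def)
qed

lemma inner_feat_nonneg: "(\<And>b. b \<in> Basis \<Longrightarrow> 0 \<le> U \<bullet> b) \<Longrightarrow> 0 \<le> U \<bullet> feat w"
  by (subst euclidean_inner) (intro sum_nonneg mult_nonneg_nonneg feat_nonneg)

definition feat_lip :: "'a::euclidean_space itself \<Rightarrow> real" where
  "feat_lip _ = 2 + norm (One :: 'a)"

lemma norm_feat_diff: "norm (feat w - feat w') \<le> feat_lip TYPE('a) * norm (w - w')" for w w' :: "'a::euclidean_space"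
proof -
  have t: "\<bar>norm w - norm w'\<bar> \<le> norm (w - w')" by (rule norm_triangle_ineq3)
  have eq: "feat w - feat w' = (0, norm w - norm w', (w - w') + (norm w - norm w') *\<^sub>R One)"
    by (simp add: feat_def algebra_simps)
  have "norm (feat w - feat w') \<le> norm (0::real) + (norm (norm w - norm w') + norm ((w - w') + (norm w - norm w') *\<^sub>R (One :: 'a)))"
    unfolding eq by (intro order_trans[OF norm_Pair_le] add_mono norm_Pair_le order_refl)
  also have "\<dots> \<le> 0 + (norm (w - w') + (norm (w - w') + norm (w - w') * norm (One :: 'a)))"
    using t by (intro add_mono order_trans[OF norm_triangle_ineq]) (auto intro!: mult_right_mono)
  finally show ?thesis by (simp add: feat_lip_def algebra_simps)
qed

lemma norm_feat: "norm (feat w) \<le> feat_lip TYPE('a) * (1 + norm w)" for w :: "'a::euclidean_space"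
proof -
  have "feat (0::'a) = (1, 0, 0)" by (simp add: feat_def)
  hence "norm (feat (0::'a)) = 1" by (simp add: norm_Pair)
  moreover have "norm (feat w) \<le> norm (feat w - feat 0) + norm (feat (0::'a))"
    using norm_triangle_sub[of "feat w" "feat 0"] by simp
  moreover have "(1::real) \<le> feat_lip TYPE('a)" by (simp add: feat_lip_def)
  ultimately show ?thesis using norm_feat_diff[of w 0] by (simp add: distrib_left)
qed

lemma exp_half_ge: "(1 + y / 4)\<^sup>2 \<le> exp (y / 2)" if "0 \<le> y" for y :: real
proof -
  have "(1 + y / 4)\<^sup>2 \<le> (exp (y / 4))\<^sup>2"
    using exp_ge_add_one_self[of "y / 4"] that by (intro power_mono) auto
  thus ?thesis by (simp add: exp_double[symmetric])
qed

text \<open>Half of the decay is spent on the polynomial factor, through \<open>exp_half_ge\<close>;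
  the remaining exp(-y/2) is the weight demanded by \<open>height_limit\<close>.\<close>

lemma exp_minus_le:
  fixes y :: real assumes y: "0 \<le> y"
  shows "exp (- y) * y \<le> exp (- (y / 2))" and "exp (- y) * (1 + sqrt (2 * y)) \<le> 2 * exp (- (y / 2))"
proof -
  have e: "exp (- y) = exp (- (y / 2)) * exp (- (y / 2))" by (simp add: exp_add[symmetric])
  have one: "exp (- (y / 2)) * exp (y / 2) = 1" by (simp add: exp_add[symmetric])
  have "y \<le> (1 + y / 4)\<^sup>2" using zero_le_power2[of "1 - y / 4"] by (simp add: power2_eq_square algebra_simps)
  hence "exp (- y) * y \<le> exp (- y) * exp (y / 2)" using exp_half_ge[OF y] by (intro mult_left_mono) auto
  also have "\<dots> = exp (- (y / 2))" unfolding e using one by (simp add: mult.assoc)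
  finally show "exp (- y) * y \<le> exp (- (y / 2))" .
  have "sqrt (2 * y) \<le> 1 + y / 2"
    using y zero_le_power2[of "1 - y / 2"] by (intro real_le_lsqrt) (auto simp: power2_eq_square algebra_simps)
  moreover have "1 + y / 2 \<le> (1 + y / 4)\<^sup>2" using zero_le_power2[of "y / 4"] by (simp add: power2_eq_square algebra_simps)
  ultimately have "1 + sqrt (2 * y) \<le> 2 * exp (y / 2)" using exp_half_ge[OF y] y by linarith
  hence "exp (- y) * (1 + sqrt (2 * y)) \<le> exp (- y) * (2 * exp (y / 2))" by (intro mult_left_mono) auto
  also have "\<dots> = 2 * exp (- (y / 2))" unfolding e using one by (simp add: mult.assoc)
  finally show "exp (- y) * (1 + sqrt (2 * y)) \<le> 2 * exp (- (y / 2))" .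
qed

text \<open>The limiting contribution of a Poisson point of height y and direction \<theta>: its
  first coordinate is the summand of the denominator, and \<open>displacement\<close> extracts the
  summand of the numerator.\<close>

definition mark :: "real \<times> 'a::euclidean_space \<Rightarrow> real \<times> (real \<times> 'a)" where
  "mark p = exp (- fst p) *\<^sub>R feat (sqrt (2 * fst p) *\<^sub>R snd p)"

lemma continuous_on_mark: "continuous_on A mark"
  unfolding mark_def by (intro continuous_intros continuous_on_compose2[OF continuous_on_feat[of UNIV]]) auto

lemma mark_measurable [measurable]: "mark \<in> borel_measurable borel"
  by (intro borel_measurable_continuous_onI continuous_on_mark)

lemma mark_nonneg: "b \<in> Basis \<Longrightarrow> 0 \<le> mark p \<bullet> b"
  by (simp add: mark_def feat_nonneg)

lemma inner_mark_nonneg: "(\<And>b. b \<in> Basis \<Longrightarrow> 0 \<le> U \<bullet> b) \<Longrightarrow> 0 \<le> U \<bullet> mark p"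
  by (simp add: mark_def inner_feat_nonneg)

lemma norm_mark:
  fixes \<theta> :: "'a::euclidean_space"
  assumes "0 \<le> y" "norm \<theta> = 1"
  shows "norm (mark (y, \<theta>)) \<le> 2 * feat_lip TYPE('a) * exp (- (y / 2))"
proof -
  have "norm (mark (y, \<theta>)) \<le> exp (- y) * (feat_lip TYPE('a) * (1 + sqrt (2 * y)))"
    using norm_feat[of "sqrt (2 * y) *\<^sub>R \<theta>"] assms by (simp add: mark_def mult_left_mono)
  also have "\<dots> = feat_lip TYPE('a) * (exp (- y) * (1 + sqrt (2 * y)))" by (simp only: mult_ac)
  also have "\<dots> \<le> feat_lip TYPE('a) * (2 * exp (- (y / 2)))"
    by (intro mult_left_mono exp_minus_le assms) (simp add: feat_lip_def)
  finally show ?thesis by (simp add: mult_ac)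
qed

text \<open>With T the height, u - q = s \<theta> - T q where s^2 = 2T - T^2. Both the radial part T
  and the gap between s and sqrt(2T) are at most T, so the error before rescaling is at most
  2T.\<close>

lemma rescaled_displacement:
  fixes q u :: "'a::euclidean_space"
  assumes q: "norm q = 1" and u: "norm u = 1" and t: "tang q u \<in> orth_sphere q" and b: "b > 0"
  shows "norm (sqrt b *\<^sub>R (u - q) - sqrt (2 * (b * (1 - q \<bullet> u))) *\<^sub>R tang q u) \<le> 2 * (b * (1 - q \<bullet> u)) / sqrt b"
proof -
  define p where "p = u - (u \<bullet> q) *\<^sub>R q"
  define T where "T = 1 - q \<bullet> u"
  have T0: "0 \<le> T" using Cauchy_Schwarz_ineq2[of q u] q u by (simp add: T_def)
  have qq: "q \<bullet> q = 1" and uu: "u \<bullet> u = 1" using q u by (simp_all add: norm_eq_1)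
  have uq: "u \<bullet> q = 1 - T" "q \<bullet> u = 1 - T" by (simp_all add: T_def inner_commute)
  have "(norm p)\<^sup>2 = 2 * T - T\<^sup>2"
    unfolding power2_norm_eq_inner p_def by (simp add: inner_simps qq uu uq power2_eq_square algebra_simps)
  define s where "s = norm p"
  have s: "s \<ge> 0" "s\<^sup>2 = 2 * T - T\<^sup>2" using \<open>(norm p)\<^sup>2 = 2 * T - T\<^sup>2\<close> by (auto simp: s_def)
  have pt: "p = s *\<^sub>R tang q u" unfolding s_def tang_def p_def[symmetric] by (cases "p = 0") (auto simp: sgn_div_norm)
  have nt: "norm (tang q u) = 1" using t by (simp add: orth_sphere_def)
  have up: "u - q = p - T *\<^sub>R q" by (simp add: p_def uq algebra_simps)
  have s1: "s \<le> sqrt (2 * T)" using s T0 by (intro real_le_rsqrt) simp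
  \<comment> \<open>The square expands to 2T + 2sT.\<close>
  have "(2 * T) \<le> (s + T)\<^sup>2" using s T0 by (simp add: power2_sum)
  hence s2: "sqrt (2 * T) \<le> s + T" using s T0 by (intro real_le_lsqrt) auto
  have "sqrt b *\<^sub>R (u - q) - sqrt (2 * (b * T)) *\<^sub>R tang q u
      = sqrt b *\<^sub>R ((s - sqrt (2 * T)) *\<^sub>R tang q u - T *\<^sub>R q)"
    unfolding up by (subst pt) (simp add: real_sqrt_mult algebra_simps)
  hence "norm (sqrt b *\<^sub>R (u - q) - sqrt (2 * (b * T)) *\<^sub>R tang q u)
      = sqrt b * norm ((s - sqrt (2 * T)) *\<^sub>R tang q u - T *\<^sub>R q)"
    using b by simp
  also have "\<dots> \<le> sqrt b * (\<bar>s - sqrt (2 * T)\<bar> + \<bar>T\<bar>)"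
    using b by (intro mult_left_mono order_trans[OF norm_triangle_ineq4]) (auto simp: nt q)
  also have "\<dots> \<le> sqrt b * (2 * T)"
    using b s1 s2 T0 by (intro mult_left_mono) auto
  also have "\<dots> = 2 * (b * T) / sqrt b" using b by (simp add: field_simps)
  finally show ?thesis by (simp add: T_def)
qed

lemma exp_minus_diff_le: "\<bar>exp (- a) - exp (- b)\<bar> \<le> \<bar>a - b\<bar>" if "0 \<le> a" "0 \<le> b" for a b :: real
proof -
  have *: "exp (- a) - exp (- b) \<le> b - a" if "0 \<le> a" "a \<le> b" for a b :: real
  proof -
    have "exp (- a) - exp (- b) = exp (- a) * (1 - exp (- (b - a)))"
      by (simp add: right_diff_distrib exp_add[symmetric])
    also have "\<dots> \<le> 1 * (1 - exp (- (b - a)))" using that by (intro mult_right_mono) auto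
    also have "\<dots> \<le> b - a"
    proof -
      define z where "z = exp (- (b - a))"
      have "1 + - (b - a) \<le> z" unfolding z_def by (rule exp_ge_add_one_self)
      hence "1 - z \<le> b - a" by linarith
      thus ?thesis unfolding z_def[symmetric] mult_1_left .
    qed
    finally show ?thesis .
  qed
  show ?thesis using *[of a b] *[of b a] that by (cases "a \<le> b") auto
qed

context cap_scaling
begin

text \<open>The exponent of the Poisson Laplace functional arises by replacing the actual
  displacement with sqrt(2y) times the direction. Both exp(-t), for t \<ge> 0, and
  \<open>feat\<close> are Lipschitz, so the error is of order exp(-y) y / sqrt(beta_n), and exp(-y)
  y is at most exp(-y/2).\<close>

lemma feature_limit:
  fixes \<rho> :: "'a \<Rightarrow> real" and U :: "real \<times> (real \<times> 'a)"
  assumes U: "\<And>b. b \<in> Basis \<Longrightarrow> 0 \<le> U \<bullet> b"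
    and rm: "\<rho> \<in> borel_measurable borel"
    and R: "\<And>u. norm u = 1 \<Longrightarrow> \<bar>\<rho> u\<bar> \<le> R" and rc: "continuous (at q within sphere 0 1) \<rho>"
  shows "(\<lambda>n. real n * (\<integral>u. \<rho> u * (1 - exp (- (U \<bullet> (exp (- (\<beta> n * T u)) *\<^sub>R feat (sqrt (\<beta> n) *\<^sub>R (u - q)))))) \<partial>\<sigma>))
     \<longlonglongrightarrow> \<rho> q * (\<integral>y. \<integral>\<theta>. 1 - exp (- (U \<bullet> mark (y, \<theta>))) \<partial>\<nu> \<partial>height_intensity)"
proof (rule sphere_density_limit[OF rm R rc])
  show "continuous_on ({0..} \<times> UNIV) (\<lambda>p. 1 - exp (- (U \<bullet> mark p)))"
    by (intro continuous_intros continuous_on_mark)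
  have "continuous_on UNIV (\<lambda>p. 1 - exp (- (U \<bullet> mark p)))"
    by (intro continuous_intros continuous_on_mark)
  thus "(\<lambda>p. 1 - exp (- (U \<bullet> mark p))) \<in> borel_measurable borel"
    by (rule borel_measurable_continuous_onI)
  show "\<bar>1 - exp (- (U \<bullet> mark p))\<bar> \<le> 1" for p
    using inner_mark_nonneg[OF U, of p] by simp
  show "\<bar>1 - exp (- (U \<bullet> mark (y, \<theta>)))\<bar> \<le> (norm U * (2 * feat_lip TYPE('a))) * exp (- (y / 2))"
    if y: "0 \<le> y" "\<theta> \<in> orth_sphere q" for y \<theta>
  proof -
    have "\<bar>1 - exp (- (U \<bullet> mark (y, \<theta>)))\<bar> \<le> U \<bullet> mark (y, \<theta>)"
      using inner_mark_nonneg[OF U, of "(y, \<theta>)"] exp_ge_add_one_self[of "- (U \<bullet> mark (y, \<theta>))"] by simp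
    also have "\<dots> \<le> norm U * norm (mark (y, \<theta>))" by (rule norm_cauchy_schwarz)
    also have "\<dots> \<le> norm U * (2 * feat_lip TYPE('a) * exp (- (y / 2)))"
      using y by (intro mult_left_mono norm_mark) (auto simp: orth_sphere_def)
    finally show ?thesis by (simp add: mult.assoc)
  qed
  show "(\<lambda>u. 1 - exp (- (U \<bullet> (exp (- (\<beta> n * T u)) *\<^sub>R feat (sqrt (\<beta> n) *\<^sub>R (u - q)))))) \<in> borel_measurable borel" for n
    by measurable
  fix n and u :: 'a assume u: "norm u = 1" "tang q u \<in> orth_sphere q" "0 \<le> T u"
  define y where "y = \<beta> n * T u"
  have y: "0 \<le> y" using u \<beta>_pos[of n] by (simp add: y_def)
  define w where "w = sqrt (\<beta> n) *\<^sub>R (u - q)"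
  define w' where "w' = sqrt (2 * y) *\<^sub>R tang q u"
  have ww: "norm (w - w') \<le> 2 * y / sqrt (\<beta> n)"
    unfolding w_def w'_def y_def T_def by (rule rescaled_displacement[OF q u(1,2) \<beta>_pos])
  have "\<bar>(1 - exp (- (U \<bullet> (exp (- y) *\<^sub>R feat w)))) - (1 - exp (- (U \<bullet> (exp (- y) *\<^sub>R feat w'))))\<bar>
      = \<bar>exp (- (U \<bullet> (exp (- y) *\<^sub>R feat w))) - exp (- (U \<bullet> (exp (- y) *\<^sub>R feat w')))\<bar>" by simp
  also have "\<dots> \<le> \<bar>U \<bullet> (exp (- y) *\<^sub>R feat w) - U \<bullet> (exp (- y) *\<^sub>R feat w')\<bar>"
    by (rule exp_minus_diff_le) (simp_all add: inner_feat_nonneg U)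
  also have "\<dots> = exp (- y) * \<bar>U \<bullet> (feat w - feat w')\<bar>"
    by (simp add: inner_simps right_diff_distrib[symmetric] abs_mult)
  also have "\<dots> \<le> exp (- y) * (norm U * (feat_lip TYPE('a) * (2 * y / sqrt (\<beta> n))))"
  proof (intro mult_left_mono)
    have "\<bar>U \<bullet> (feat w - feat w')\<bar> \<le> norm U * norm (feat w - feat w')" by (rule Cauchy_Schwarz_ineq2)
    also have "\<dots> \<le> norm U * (feat_lip TYPE('a) * norm (w - w'))"
      by (intro mult_left_mono norm_feat_diff) auto
    also have "\<dots> \<le> norm U * (feat_lip TYPE('a) * (2 * y / sqrt (\<beta> n)))"
      by (intro mult_left_mono ww) (auto simp: feat_lip_def)
    finally show "\<bar>U \<bullet> (feat w - feat w')\<bar> \<le> norm U * (feat_lip TYPE('a) * (2 * y / sqrt (\<beta> n)))" .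
  qed simp
  also have "\<dots> = (norm U * feat_lip TYPE('a) * 2) / sqrt (\<beta> n) * (exp (- y) * y)" by simp
  also have "\<dots> \<le> (norm U * feat_lip TYPE('a) * 2) / sqrt (\<beta> n) * exp (- (y / 2))"
    using \<beta>_pos[of n] by (intro mult_left_mono exp_minus_le(1) y) (auto simp: feat_lip_def)
  finally show "\<bar>(1 - exp (- (U \<bullet> (exp (- (\<beta> n * T u)) *\<^sub>R feat (sqrt (\<beta> n) *\<^sub>R (u - q))))))
      - (1 - exp (- (U \<bullet> mark (\<beta> n * T u, tang q u))))\<bar>
      \<le> (norm U * feat_lip TYPE('a) * 2) / sqrt (\<beta> n) * decay (1/2) n u"
    by (simp add: w_def w'_def y_def mark_def)
qed

section \<open>The limiting intensity, with \<open>r\<close> standing for the value of the density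
  at \<open>q\<close>\<close>

definition ppi :: "real \<Rightarrow> (real \<times> 'a) measure" where
  "ppi r = density (lborel \<Otimes>\<^sub>M \<nu>) (\<lambda>(y, \<theta>). ennreal (indicator {0..} y * (r * intensity_const) * y powr (real m / 2 - 1)))"

lemma sets_nu: "sets \<nu> = sets borel"
  by (rule uniform_on_orth_sphereD[OF \<nu>])

lemma sets_ppi: "sets (ppi r) = sets borel"
proof -
  have "sets (ppi r) = sets (borel \<Otimes>\<^sub>M (borel :: 'a measure))"
    unfolding ppi_def sets_density by (rule sets_pair_measure_cong[OF sets_lborel sets_nu])
  thus ?thesis unfolding borel_prod .
qed

lemma nn_integral_ppi:
  assumes r: "r \<ge> 0" and fm [measurable]: "f \<in> borel_measurable borel"
  shows "(\<integral>\<^sup>+p. f p \<partial>ppi r) = ennreal r * (\<integral>\<^sup>+y. \<integral>\<^sup>+\<theta>. f (y, \<theta>) \<partial>\<nu> \<partial>height_intensity)"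
proof -
  note [measurable_cong] = sets_nu
  have fm': "f \<in> borel_measurable (borel \<Otimes>\<^sub>M borel)" using fm by (simp add: borel_prod)
  have [measurable]: "f \<in> borel_measurable (lborel \<Otimes>\<^sub>M \<nu>)"
    using fm' by (simp cong: measurable_cong_sets sets_pair_measure_cong add: sets_nu)
  define w where "w y = ennreal (indicator {0..} y * intensity_const * y powr (real m / 2 - 1))" for y :: real
  have [measurable]: "w \<in> borel_measurable borel" unfolding w_def by measurable
  have eq: "ennreal (indicator {0..} y * (r * intensity_const) * y powr (real m / 2 - 1)) = ennreal r * w y" for y
    using r intensity_const_pos by (simp add: w_def ennreal_mult[symmetric] mult_ac)
  have inner [measurable]: "(\<lambda>y. \<integral>\<^sup>+\<theta>. f (y, \<theta>) \<partial>\<nu>) \<in> borel_measurable borel"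
    by (rule N.borel_measurable_nn_integral) (use fm' in \<open>simp cong: measurable_cong_sets sets_pair_measure_cong add: sets_nu\<close>)
  have "(\<integral>\<^sup>+p. f p \<partial>ppi r) = (\<integral>\<^sup>+p. ennreal r * w (fst p) * f p \<partial>(lborel \<Otimes>\<^sub>M \<nu>))"
    unfolding ppi_def by (subst nn_integral_density) (auto simp: eq split_beta')
  also have "\<dots> = (\<integral>\<^sup>+y. \<integral>\<^sup>+\<theta>. ennreal r * w y * f (y, \<theta>) \<partial>\<nu> \<partial>lborel)"
    by (subst N.nn_integral_fst[symmetric]) auto
  also have "\<dots> = (\<integral>\<^sup>+y. ennreal r * (w y * (\<integral>\<^sup>+\<theta>. f (y, \<theta>) \<partial>\<nu>)) \<partial>lborel)"
  proof (intro nn_integral_cong)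
    fix y
    have "(\<lambda>\<theta>. f (y, \<theta>)) \<in> borel_measurable \<nu>"
      by measurable
    thus "(\<integral>\<^sup>+\<theta>. ennreal r * w y * f (y, \<theta>) \<partial>\<nu>) = ennreal r * (w y * (\<integral>\<^sup>+\<theta>. f (y, \<theta>) \<partial>\<nu>))"
      by (simp add: nn_integral_cmult mult.assoc)
  qed
  also have "\<dots> = ennreal r * (\<integral>\<^sup>+y. w y * (\<integral>\<^sup>+\<theta>. f (y, \<theta>) \<partial>\<nu>) \<partial>lborel)"
    by (rule nn_integral_cmult) measurable
  also have "(\<integral>\<^sup>+y. w y * (\<integral>\<^sup>+\<theta>. f (y, \<theta>) \<partial>\<nu>) \<partial>lborel) = (\<integral>\<^sup>+y. \<integral>\<^sup>+\<theta>. f (y, \<theta>) \<partial>\<nu> \<partial>height_intensity)"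
    unfolding height_intensity_def w_def[symmetric] by (subst nn_integral_density) auto
  finally show ?thesis .
qed

text \<open>The intensity is infinite, but the decay of \<open>mark\<close> makes its norm
  integrable; this is what renders the Poisson integrals of \<open>mark\<close> almost surely
  absolutely convergent.\<close>

lemma nn_integral_norm_mark_finite:
  assumes r: "r \<ge> 0"
  shows "(\<integral>\<^sup>+p. ennreal (norm (mark p)) \<partial>ppi r) < \<infinity>"
proof -
  have "(\<integral>\<^sup>+y. \<integral>\<^sup>+\<theta>. ennreal (norm (mark (y, \<theta>))) \<partial>\<nu> \<partial>height_intensity)
      \<le> (\<integral>\<^sup>+y. \<integral>\<^sup>+\<theta>. ennreal (2 * feat_lip TYPE('a) * exp (- (1/2 * y))) \<partial>\<nu> \<partial>height_intensity)"
  proof (rule nn_integral_mono_AE)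
    show "AE y in height_intensity. (\<integral>\<^sup>+\<theta>. ennreal (norm (mark (y, \<theta>))) \<partial>\<nu>)
        \<le> (\<integral>\<^sup>+\<theta>. ennreal (2 * feat_lip TYPE('a) * exp (- (1/2 * y))) \<partial>\<nu>)"
      using AE_height_intensity_pos
    proof eventually_elim
      case (elim y)
      have "AE \<theta> in \<nu>. ennreal (norm (mark (y, \<theta>))) \<le> ennreal (2 * feat_lip TYPE('a) * exp (- (1/2 * y)))"
        using uniform_on_orth_sphereD(4)[OF \<nu>]
      proof eventually_elim
        case (elim \<theta>)
        thus ?case using norm_mark[of y \<theta>] \<open>0 < y\<close> by (intro ennreal_leI) (simp add: orth_sphere_def)
      qed
      thus ?case by (rule nn_integral_mono_AE)
    qed
  qed
  also have "\<dots> = (\<integral>\<^sup>+y. ennreal (2 * feat_lip TYPE('a) * exp (- (1/2 * y))) \<partial>height_intensity)"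
    by (simp add: N.emeasure_space_1)
  also have "\<dots> < \<infinity>"
    using integral_height_intensity_exp(1)[of "1/2"]
    by (subst nn_integral_eq_integral) (auto simp: feat_lip_def)
  finally have "(\<integral>\<^sup>+y. \<integral>\<^sup>+\<theta>. ennreal (norm (mark (y, \<theta>))) \<partial>\<nu> \<partial>height_intensity) < \<infinity>" .
  moreover have "(\<integral>\<^sup>+p. ennreal (norm (mark p)) \<partial>ppi r)
      = ennreal r * (\<integral>\<^sup>+y. \<integral>\<^sup>+\<theta>. ennreal (norm (mark (y, \<theta>))) \<partial>\<nu> \<partial>height_intensity)"
    by (rule nn_integral_ppi[OF r]) measurable
  ultimately show ?thesis by (simp add: ennreal_mult_less_top)
qed

lemma integral_ppi:
  fixes f :: "real \<times> 'a \<Rightarrow> real"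
  assumes r: "r \<ge> 0" and fm [measurable]: "f \<in> borel_measurable borel" and f: "\<And>p. 0 \<le> f p" "\<And>p. f p \<le> 1"
  shows "(\<integral>p. f p \<partial>ppi r) = r * (\<integral>y. \<integral>\<theta>. f (y, \<theta>) \<partial>\<nu> \<partial>height_intensity)"
proof -
  have fm': "f \<in> borel_measurable (borel \<Otimes>\<^sub>M borel)" using fm by (simp add: borel_prod)
  have [measurable]: "(\<lambda>\<theta>. f (y, \<theta>)) \<in> borel_measurable \<nu>" for y
    using measurable_compose[OF measurable_Pair1' fm', of y] by (simp cong: measurable_cong_sets add: sets_nu)
  have inner [measurable]: "(\<lambda>y. \<integral>\<theta>. f (y, \<theta>) \<partial>\<nu>) \<in> borel_measurable borel"
    by (rule N.borel_measurable_lebesgue_integral) (use fm' in \<open>simp cong: measurable_cong_sets sets_pair_measure_cong add: sets_nu\<close>)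
  have "(\<integral>p. f p \<partial>ppi r) = enn2real (\<integral>\<^sup>+p. ennreal (f p) \<partial>ppi r)"
    by (rule integral_eq_nn_integral) (use f fm sets_ppi in \<open>auto cong: measurable_cong_sets\<close>)
  also have "(\<integral>\<^sup>+p. ennreal (f p) \<partial>ppi r) = ennreal r * (\<integral>\<^sup>+y. \<integral>\<^sup>+\<theta>. ennreal (f (y, \<theta>)) \<partial>\<nu> \<partial>height_intensity)"
    by (rule nn_integral_ppi[OF r]) measurable
  also have "(\<integral>\<^sup>+y. \<integral>\<^sup>+\<theta>. ennreal (f (y, \<theta>)) \<partial>\<nu> \<partial>height_intensity) = (\<integral>\<^sup>+y. ennreal (\<integral>\<theta>. f (y, \<theta>) \<partial>\<nu>) \<partial>height_intensity)"
    by (intro nn_integral_cong nn_integral_eq_integral N.integrable_const_bound[where B=1]) (use f in auto)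
  also have "enn2real (ennreal r * \<dots>) = r * enn2real \<dots>"
    using r by (simp add: enn2real_mult)
  also have "enn2real (\<integral>\<^sup>+y. ennreal (\<integral>\<theta>. f (y, \<theta>) \<partial>\<nu>) \<partial>height_intensity) = (\<integral>y. \<integral>\<theta>. f (y, \<theta>) \<partial>\<nu> \<partial>height_intensity)"
    by (rule integral_eq_nn_integral[symmetric]) (use f in \<open>auto intro!: integral_nonneg_AE\<close>)
  finally show ?thesis .
qed

text \<open>A finite total mass \<open>c\<close> of the heights would bound the integrals of exp(-a
  y) for every a > 0, yet these equal a constant times a^(-m/2) and blow up as a tends to 0.\<close>

lemma emeasure_ppi_infinite:
  assumes r: "r > 0"
  shows "emeasure (ppi r) UNIV = \<infinity>"
proof (rule ccontr)
  assume "emeasure (ppi r) UNIV \<noteq> \<infinity>"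
  moreover have "emeasure (ppi r) UNIV = ennreal r * emeasure height_intensity UNIV"
    using nn_integral_ppi[of r "\<lambda>_. 1"] r sets_eq_imp_space_eq[OF sets_ppi] sets_eq_imp_space_eq[OF sets_height_intensity]
    by (simp add: N.emeasure_space_1)
  ultimately have "emeasure height_intensity UNIV \<noteq> \<infinity>"
    using r by (auto simp: ennreal_mult_eq_top_iff)
  then obtain c where c: "c \<ge> 0" "emeasure height_intensity UNIV = ennreal c"
    by (cases "emeasure height_intensity UNIV") auto
  define v where "v = intensity_const * Gamma (real m / 2)"
  have v: "v > 0" using intensity_const_pos m1 by (simp add: v_def Gamma_real_pos)
  \<comment> \<open>Chosen so that the integral of exp(-a y) is exactly c + 1.\<close>
  define a where "a = (v / (c + 1)) powr (2 / real m)"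
  have a: "a > 0" using v c by (simp add: a_def)
  have am: "a powr (real m / 2) = v / (c + 1)"
    using v c m1 by (simp add: a_def powr_powr)
  have "intensity_const * (Gamma (real m / 2) / a powr (real m / 2)) = v / (v / (c + 1))"
    unfolding am by (simp add: v_def)
  also have "\<dots> = c + 1" using v c by simp
  finally have "ennreal (c + 1) = ennreal (intensity_const * (Gamma (real m / 2) / a powr (real m / 2)))" by simp
  also have "\<dots> = (\<integral>\<^sup>+y. ennreal (exp (- (a * y))) \<partial>height_intensity)"
    using integral_height_intensity_exp[OF a] by (subst nn_integral_eq_integral) auto
  also have "\<dots> \<le> (\<integral>\<^sup>+y. 1 \<partial>height_intensity)"
  proof (rule nn_integral_mono_AE)
    show "AE y in height_intensity. ennreal (exp (- (a * y))) \<le> 1"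
      using AE_height_intensity_pos by eventually_elim (use a in simp)
  qed
  also have "\<dots> = ennreal c" using c sets_eq_imp_space_eq[OF sets_height_intensity] by simp
  finally show False using c by simp
qed

end

section \<open>Convergence of the attention output\<close>

text \<open>Replacing \<open>a n\<close> by its limit costs at most
  \<open>\<bar>a n - A\<bar>\<close>, since n-th powers of numbers of modulus at most 1 differ by at
  most n times the difference of the bases. The bounds on \<open>a\<close> keep the bases in the
  unit interval.\<close>

lemma power_tendsto_exp:
  fixes a :: "nat \<Rightarrow> real"
  assumes a: "a \<longlonglongrightarrow> A" and bd: "\<And>n. 0 \<le> a n" "\<And>n. a n \<le> real n"
  shows "(\<lambda>n. (1 - a n / real n) ^ n) \<longlonglongrightarrow> exp (- A)"
proof -
  have A0: "0 \<le> A" using a bd(1) by (intro LIMSEQ_le_const) auto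
  have lim: "(\<lambda>n. (1 - A / real n) ^ n) \<longlonglongrightarrow> exp (- A)"
    using tendsto_exp_limit_sequentially[of "- A"] by simp
  have "(\<lambda>n. A / real n) \<longlonglongrightarrow> 0"
    by (rule real_tendsto_divide_at_top[OF tendsto_const filterlim_real_sequentially])
  hence ev: "eventually (\<lambda>n. A / real n < 1) sequentially" by (rule order_tendstoD(2)) simp
  have "(\<lambda>n. (1 - a n / real n) ^ n - (1 - A / real n) ^ n) \<longlonglongrightarrow> 0"
  proof (rule tendsto_rabs_zero_cancel, rule tendsto_sandwich[OF _ _ tendsto_const])
    show "\<forall>\<^sub>F n in sequentially. \<bar>(1 - a n / real n) ^ n - (1 - A / real n) ^ n\<bar> \<le> \<bar>a n - A\<bar>"
      using ev eventually_gt_at_top[of 0]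
    proof eventually_elim
      case (elim n)
      have 1: "0 \<le> A / real n" "0 \<le> a n / real n" "a n / real n \<le> 1"
        using elim A0 bd[of n] by (auto simp: divide_le_eq)
      have "norm ((1 - a n / real n) ^ n - (1 - A / real n) ^ n) \<le> real n * norm ((1 - a n / real n) - (1 - A / real n))"
        by (rule norm_power_diff) (use elim 1 in auto)
      also have "(1 - a n / real n) - (1 - A / real n) = (A - a n) / real n"
        by (simp add: diff_divide_distrib)
      also have "real n * norm \<dots> = \<bar>a n - A\<bar>"
        using elim by (simp add: abs_minus_commute)
      finally show ?case by simp
    qed
    show "(\<lambda>n. \<bar>a n - A\<bar>) \<longlonglongrightarrow> 0" using a by (simp add: LIM_zero tendsto_rabs_zero)
  qed auto
  from tendsto_add[OF this lim] show ?thesis by simp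
qed

lemma (in prob_space) iid_laplace_limit:
  fixes X :: "nat \<Rightarrow> 'a \<Rightarrow> 'b::euclidean_space" and f :: "nat \<Rightarrow> 'b \<Rightarrow> real"
  assumes indep: "indep_vars (\<lambda>_. borel) X {1..}" and law: "\<And>i. i \<ge> 1 \<Longrightarrow> distr M borel (X i) = D"
    and [measurable]: "\<And>n. f n \<in> borel_measurable borel" and f0: "\<And>n u. 0 \<le> f n u"
    and lim: "(\<lambda>n. real n * (\<integral>u. 1 - exp (- f n u) \<partial>D)) \<longlonglongrightarrow> A"
  shows "(\<lambda>n. \<integral>\<omega>. exp (- (\<Sum>i=1..n. f n (X i \<omega>))) \<partial>M) \<longlonglongrightarrow> exp (- A)"
proof -
  have X [measurable]: "X i \<in> borel_measurable M" if "i \<ge> 1" for i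
    using indep that by (auto simp: indep_vars_def)
  have D: "prob_space D" "sets D = sets borel"
    using prob_space_distr[OF X[of 1]] law[of 1] sets_distr[of M borel "X 1"] by auto
  interpret D: prob_space D by (rule D)
  have fD [measurable]: "f n \<in> borel_measurable D" for n by (simp cong: measurable_cong_sets add: D(2))
  have intD: "integrable D (\<lambda>u. exp (- f n u))" for n
    by (rule D.integrable_const_bound[where B=1]) (use f0 in auto)
  define p where "p n = (\<integral>u. 1 - exp (- f n u) \<partial>D)" for n
  have p: "p n = 1 - (\<integral>u. exp (- f n u) \<partial>D)" for n
    using intD[of n] by (simp add: p_def D.prob_space)
  have p01: "0 \<le> p n" "p n \<le> 1" for n
  proof -
    show "0 \<le> p n" unfolding p_def using f0 by (intro integral_nonneg_AE) auto
    have "0 \<le> (\<integral>u. exp (- f n u) \<partial>D)" by (intro integral_nonneg_AE) auto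
    thus "p n \<le> 1" by (simp add: p)
  qed
  have E: "(\<integral>\<omega>. exp (- (\<Sum>i=1..n. f n (X i \<omega>))) \<partial>M) = (1 - p n) ^ n" for n
  proof -
    have sub: "indep_vars (\<lambda>_. borel) X {1..n}" by (rule indep_vars_subset[OF indep]) auto
    have ind: "indep_vars (\<lambda>_. borel) (\<lambda>i \<omega>. exp (- f n (X i \<omega>))) {1..n}"
      by (rule indep_vars_compose2[OF sub, where Y="\<lambda>_ u. exp (- f n u)"]) measurable
    have "(\<integral>\<omega>. exp (- (\<Sum>i=1..n. f n (X i \<omega>))) \<partial>M) = (\<integral>\<omega>. (\<Prod>i=1..n. exp (- f n (X i \<omega>))) \<partial>M)"
      by (simp add: exp_sum sum_negf[symmetric])
    also have "\<dots> = (\<Prod>i=1..n. \<integral>\<omega>. exp (- f n (X i \<omega>)) \<partial>M)"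
      by (rule indep_vars_lebesgue_integral[OF _ ind])
         (use f0 in \<open>auto intro!: integrable_const_bound[where B=1]\<close>)
    also have "\<dots> = (\<Prod>i=1..n. \<integral>u. exp (- f n u) \<partial>D)"
    proof (intro prod.cong refl)
      fix i assume "i \<in> {1..n}"
      hence i: "i \<ge> 1" by simp
      show "(\<integral>\<omega>. exp (- f n (X i \<omega>)) \<partial>M) = (\<integral>u. exp (- f n u) \<partial>D)"
        unfolding law[OF i, symmetric] using X[OF i] by (subst integral_distr) auto
    qed
    also have "\<dots> = (1 - p n) ^ n" by (simp add: p)
    finally show ?thesis .
  qed
  define a where "a n = real n * p n" for n
  have "(\<lambda>n. (1 - a n / real n) ^ n) \<longlonglongrightarrow> exp (- A)"
  proof (rule power_tendsto_exp)
    show "a \<longlonglongrightarrow> A" using lim by (simp only: a_def[abs_def] p_def)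
    show "0 \<le> a n" "a n \<le> real n" for n
      using p01[of n] by (simp_all add: a_def mult_left_le)
  qed
  \<comment> \<open>At n = 0 division by zero is harmless, because both powers are 1.\<close>
  moreover have "(1 - a n / real n) ^ n = (1 - p n) ^ n" for n by (cases "n = 0") (auto simp: a_def)
  ultimately show ?thesis by (simp only: E)
qed

text \<open>Each coordinate is a difference of two nonnegative integrals, whose measurability is
  known. The case distinction reflects the convention that the Bochner integral is 0 for a
  non-integrable function.\<close>

lemma ppp_bochner_integral_measurable:
  fixes F :: "'e \<Rightarrow> 'b::euclidean_space"
  assumes ppp: "poisson_point_process P \<mu> N" and F [measurable]: "F \<in> borel_measurable \<mu>"
  shows "(\<lambda>w. \<integral>x. F x \<partial>N w) \<in> borel_measurable P"
proof (subst borel_measurable_euclidean_space, intro ballI)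
  fix i :: 'b assume i: "i \<in> Basis"
  have "(\<integral>x. F x \<partial>N w) \<bullet> i = (if (\<integral>\<^sup>+x. ennreal (norm (F x)) \<partial>N w) < \<infinity>
      then enn2real (\<integral>\<^sup>+x. ennreal (F x \<bullet> i) \<partial>N w) - enn2real (\<integral>\<^sup>+x. ennreal (- (F x \<bullet> i)) \<partial>N w) else 0)"
    if w: "w \<in> space P" for w
  proof -
    have Fm: "F \<in> borel_measurable (N w)" using F ppp_borel_measurable[OF ppp w] by blast
    show ?thesis
    proof (cases "integrable (N w) F")
      case True
      hence "(\<integral>x. F x \<partial>N w) \<bullet> i = (\<integral>x. F x \<bullet> i \<partial>N w)" by simp
      also have "\<dots> = enn2real (\<integral>\<^sup>+x. ennreal (F x \<bullet> i) \<partial>N w) - enn2real (\<integral>\<^sup>+x. ennreal (- (F x \<bullet> i)) \<partial>N w)"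
        using True by (intro real_lebesgue_integral_def) auto
      finally show ?thesis using True by (simp add: integrable_iff_bounded)
    next
      case False
      thus ?thesis using Fm by (simp add: not_integrable_integral_eq integrable_iff_bounded)
    qed
  qed
  moreover have "(\<lambda>w. if (\<integral>\<^sup>+x. ennreal (norm (F x)) \<partial>N w) < \<infinity>
      then enn2real (\<integral>\<^sup>+x. ennreal (F x \<bullet> i) \<partial>N w) - enn2real (\<integral>\<^sup>+x. ennreal (- (F x \<bullet> i)) \<partial>N w) else 0) \<in> borel_measurable P"
  proof -
    have "(\<lambda>x. ennreal (norm (F x))) \<in> borel_measurable \<mu>" "(\<lambda>x. ennreal (F x \<bullet> i)) \<in> borel_measurable \<mu>"
      "(\<lambda>x. ennreal (- (F x \<bullet> i))) \<in> borel_measurable \<mu>"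
      by measurable
    note [measurable] = this[THEN ppp_integral_measurable[OF ppp]]
    show ?thesis by measurable
  qed
  ultimately show "(\<lambda>w. (\<integral>x. F x \<partial>N w) \<bullet> i) \<in> borel_measurable P"
    by (simp cong: measurable_cong)
qed

text \<open>The truncations \<open>f k\<close> have vanishing mean under the limit law as k grows,
  and convergence in distribution transfers this to \<open>X n\<close>. Since \<open>f k\<close>
  equals 1 beyond radius k + 1, it dominates the tail once \<open>c n\<close> exceeds that
  radius.\<close>

lemma conv_in_distribution_scaled_tail:
  fixes X :: "nat \<Rightarrow> 'w \<Rightarrow> 'b::euclidean_space"
  assumes conv: "conv_in_distribution M X P Y" and M: "prob_space M" and P: "prob_space P"
    and c: "filterlim c at_top sequentially"
  shows "(\<lambda>n. measure M {\<omega>\<in>space M. norm (X n \<omega>) > c n}) \<longlonglongrightarrow> 0"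
proof -
  interpret M: prob_space M by fact
  interpret P: prob_space P by fact
  have [measurable]: "X n \<in> borel_measurable M" "Y \<in> borel_measurable P" for n
    using conv by (auto simp: conv_in_distribution_def)
  define f where "f R z = min 1 (max 0 (norm z - R))" for R :: real and z :: 'b
  have fc: "continuous_on UNIV (f R)" for R unfolding f_def by (intro continuous_intros)
  have [measurable]: "f R \<in> borel_measurable borel" for R by (rule borel_measurable_continuous_onI[OF fc])
  have f01: "0 \<le> f R z" "f R z \<le> 1" for R z by (auto simp: f_def)
  have bd: "bounded (range (f R))" for R
    by (rule boundedI[where B=1]) (use f01 in auto)
  have fY: "(\<lambda>k. \<integral>w. f (real k) (Y w) \<partial>P) \<longlonglongrightarrow> (\<integral>w. 0 \<partial>P)"
  proof (rule integral_dominated_convergence[where w="\<lambda>_. 1"])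
    have "(\<lambda>k. f (real k) z) \<longlonglongrightarrow> 0" for z
    proof (rule tendsto_eventually)
      obtain K :: nat where K: "norm z \<le> real K" using real_arch_simple by blast
      show "\<forall>\<^sub>F k in sequentially. f (real k) z = 0"
        using eventually_ge_at_top[of K] by eventually_elim (use K in \<open>auto simp: f_def\<close>)
    qed
    thus "AE w in P. (\<lambda>k. f (real k) (Y w)) \<longlonglongrightarrow> 0" by simp
  qed (use f01 in auto)
  show ?thesis
  proof (rule tendstoI)
    fix e :: real assume e: "e > 0"
    have "eventually (\<lambda>k. (\<integral>w. f (real k) (Y w) \<partial>P) < e) sequentially"
      by (rule order_tendstoD(2)[OF fY]) (use e in simp)
    then obtain k where k: "(\<integral>w. f (real k) (Y w) \<partial>P) < e"
      unfolding eventually_sequentially by blast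
    have "(\<lambda>n. \<integral>z. f (real k) z \<partial>(distr M borel (X n))) \<longlonglongrightarrow> (\<integral>z. f (real k) z \<partial>(distr P borel Y))"
      using conv fc bd by (auto simp: conv_in_distribution_def)
    hence "(\<lambda>n. \<integral>w. f (real k) (X n w) \<partial>M) \<longlonglongrightarrow> (\<integral>w. f (real k) (Y w) \<partial>P)"
      by (simp add: integral_distr)
    hence "eventually (\<lambda>n. (\<integral>w. f (real k) (X n w) \<partial>M) < e) sequentially"
      using k by (rule order_tendstoD(2))
    moreover have "eventually (\<lambda>n. c n > real k + 1) sequentially"
      using c by (auto simp: filterlim_at_top_dense)
    ultimately show "eventually (\<lambda>n. dist (measure M {\<omega>\<in>space M. norm (X n \<omega>) > c n}) 0 < e) sequentially"
    proof eventually_elim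
      case (elim n)
      have "measure M {\<omega>\<in>space M. norm (X n \<omega>) > c n} = (\<integral>w. indicator {\<omega>\<in>space M. norm (X n \<omega>) > c n} w \<partial>M)"
        by simp
      also have "\<dots> \<le> (\<integral>w. f (real k) (X n w) \<partial>M)"
      proof (rule integral_mono)
        show "integrable M (indicat_real {\<omega>\<in>space M. norm (X n \<omega>) > c n})"
          by (rule M.integrable_const_bound[where B=1]) auto
        show "integrable M (\<lambda>w. f (real k) (X n w))"
          by (rule M.integrable_const_bound[where B=1]) (use f01 in auto)
        fix w
        show "indicat_real {\<omega>\<in>space M. norm (X n \<omega>) > c n} w \<le> f (real k) (X n w)"
          using elim(2) f01 by (auto simp: f_def split: split_indicator)
      qed
      finally show ?case using elim(1) by simp
    qed
  qed
qed

lemma matrix_vector_mult_measurable [measurable]: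
  "(\<lambda>v. V *v v) \<in> borel_measurable borel" for V :: "real^'n^'m"
  by (intro borel_measurable_continuous_onI linear_continuous_on linear_conv_bounded_linear[THEN iffD1] matrix_vector_mul_linear)

definition displacement :: "real \<times> (real \<times> 'a::euclidean_space) \<Rightarrow> 'a" where
  "displacement z = snd (snd z) - fst (snd z) *\<^sub>R One"

definition ratio :: "real \<times> (real \<times> 'a::euclidean_space) \<Rightarrow> 'a" where
  "ratio z = (1 / fst z) *\<^sub>R displacement z"

lemma bounded_linear_displacement: "bounded_linear displacement"
  unfolding displacement_def
  by (intro bounded_linear_sub bounded_linear_compose[OF bounded_linear_snd bounded_linear_snd]
      bounded_linear_compose[OF bounded_linear_scaleR_left]
      bounded_linear_compose[OF bounded_linear_fst bounded_linear_snd])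

lemma displacement_feat: "displacement (feat w) = w" and fst_feat: "fst (feat w) = 1"
  by (simp_all add: displacement_def feat_def)

lemma ratio_measurable [measurable]: "ratio \<in> borel_measurable borel"
proof -
  have [measurable]: "displacement \<in> borel_measurable borel" "fst \<in> borel_measurable (borel :: (real \<times> (real \<times> 'a)) measure)"
    by (auto intro!: borel_measurable_continuous_onI continuous_intros linear_continuous_on bounded_linear_displacement bounded_linear_fst)
  show ?thesis unfolding ratio_def[abs_def] by measurable
qed

section \<open>Numerator and denominator of the limit as one Poisson integral\<close>

context cap_scaling
begin

context
  fixes P :: "'p measure" and N :: "'p \<Rightarrow> (real \<times> 'a) measure" and r :: real
  assumes ppp: "poisson_point_process P (ppi r) N" and r: "r > 0"
begin

lemma mark_measurable_ppi: "mark \<in> borel_measurable (ppi r)"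
  using mark_measurable by (simp cong: measurable_cong_sets add: sets_ppi)

lemma ppp_mark_integrable: "AE w in P. integrable (N w) mark"
proof -
  note [measurable] = mark_measurable_ppi
  have "AE w in P. (\<integral>\<^sup>+p. ennreal (norm (mark p)) \<partial>N w) < \<infinity>"
    by (rule ppp_integral_finite[OF ppp]) (use nn_integral_norm_mark_finite[of r] r in auto)
  thus ?thesis using AE_space
  proof eventually_elim
    case (elim w)
    have "mark \<in> borel_measurable (N w)"
      using ppp_borel_measurable[OF ppp elim(2)] mark_measurable_ppi by blast
    thus ?case using elim by (simp add: integrable_iff_bounded)
  qed
qed

text \<open>For \<open>U\<close> in the nonnegative orthant the product with \<open>mark\<close> is
  a nonnegative scalar function, so the scalar Laplace functional applies; Cauchy-Schwarz and the
  integrable norm of \<open>mark\<close> give finiteness.\<close>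

lemma ppp_mark_laplace:
  assumes U: "\<And>b. b \<in> Basis \<Longrightarrow> 0 \<le> U \<bullet> b"
  shows "(\<integral>w. exp (- (U \<bullet> (\<integral>p. mark p \<partial>N w))) \<partial>P) = exp (- (r * (\<integral>y. \<integral>\<theta>. 1 - exp (- (U \<bullet> mark (y, \<theta>))) \<partial>\<nu> \<partial>height_intensity)))"
proof -
  note [measurable] = mark_measurable_ppi
  have nn: "0 \<le> U \<bullet> mark p" for p by (rule inner_mark_nonneg[OF U])
  have "(\<integral>\<^sup>+p. ennreal (U \<bullet> mark p) \<partial>ppi r) \<le> (\<integral>\<^sup>+p. ennreal (norm U) * ennreal (norm (mark p)) \<partial>ppi r)"
    by (intro nn_integral_mono) (auto simp: ennreal_mult[symmetric] intro!: ennreal_leI norm_cauchy_schwarz)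
  also have "\<dots> = ennreal (norm U) * (\<integral>\<^sup>+p. ennreal (norm (mark p)) \<partial>ppi r)"
    by (rule nn_integral_cmult) measurable
  also have "\<dots> < \<infinity>" using nn_integral_norm_mark_finite[of r] r by (auto simp: ennreal_mult_less_top)
  finally have fin: "(\<integral>\<^sup>+p. ennreal (U \<bullet> mark p) \<partial>ppi r) < \<infinity>" .
  have "(\<integral>w. exp (- (U \<bullet> (\<integral>p. mark p \<partial>N w))) \<partial>P) = (\<integral>w. exp (- enn2real (\<integral>\<^sup>+p. ennreal (U \<bullet> mark p) \<partial>N w)) \<partial>P)"
  proof (rule integral_cong_AE)
    note [measurable] = ppp_bochner_integral_measurable[OF ppp mark_measurable_ppi]
    show "(\<lambda>w. exp (- (U \<bullet> (\<integral>p. mark p \<partial>N w)))) \<in> borel_measurable P" by measurable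
    have "(\<lambda>p. ennreal (U \<bullet> mark p)) \<in> borel_measurable (ppi r)" by measurable
    note [measurable] = ppp_integral_measurable[OF ppp this]
    show "(\<lambda>w. exp (- enn2real (\<integral>\<^sup>+p. ennreal (U \<bullet> mark p) \<partial>N w))) \<in> borel_measurable P" by measurable
    show "AE w in P. exp (- (U \<bullet> (\<integral>p. mark p \<partial>N w))) = exp (- enn2real (\<integral>\<^sup>+p. ennreal (U \<bullet> mark p) \<partial>N w))"
      using ppp_mark_integrable
    proof eventually_elim
      case (elim w)
      have "U \<bullet> (\<integral>p. mark p \<partial>N w) = (\<integral>p. U \<bullet> mark p \<partial>N w)" using elim by simp
      also have "\<dots> = enn2real (\<integral>\<^sup>+p. ennreal (U \<bullet> mark p) \<partial>N w)"
        using elim nn by (intro integral_eq_nn_integral) auto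
      finally show ?case by simp
    qed
  qed
  also have "\<dots> = exp (- (\<integral>p. 1 - exp (- (U \<bullet> mark p)) \<partial>ppi r))"
    by (rule ppp_laplace[OF ppp _ nn fin]) measurable
  also have "(\<integral>p. 1 - exp (- (U \<bullet> mark p)) \<partial>ppi r) = r * (\<integral>y. \<integral>\<theta>. 1 - exp (- (U \<bullet> mark (y, \<theta>))) \<partial>\<nu> \<partial>height_intensity)"
  proof (rule integral_ppi)
    show "(\<lambda>p. 1 - exp (- (U \<bullet> mark p))) \<in> borel_measurable borel" by measurable
  qed (use r nn in auto)
  finally show ?thesis .
qed

text \<open>Infinite intensity gives almost surely infinite mass to the realisation. A zero
  denominator would force the strictly positive integrand to vanish almost everywhere, hence a null
  realisation. Finiteness comes from integrability of \<open>mark\<close>, and the two coordinates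
  from bounded linear maps commuting with the integral.\<close>

lemma ppp_mark_components:
  "AE w in P. 0 < (\<integral>\<^sup>+p. ennreal (exp (- fst p)) \<partial>N w) \<and> (\<integral>\<^sup>+p. ennreal (exp (- fst p)) \<partial>N w) < \<infinity>
     \<and> fst (\<integral>p. mark p \<partial>N w) = enn2real (\<integral>\<^sup>+p. ennreal (exp (- fst p)) \<partial>N w)
     \<and> displacement (\<integral>p. mark p \<partial>N w) = (\<integral>p. (exp (- fst p) * sqrt (2 * fst p)) *\<^sub>R snd p \<partial>N w)"
proof -
  let ?den = "\<lambda>w. \<integral>\<^sup>+p. ennreal (exp (- fst p)) \<partial>N w"
  have "AE w in P. emeasure (N w) UNIV = \<infinity>"
  proof -
    have "UNIV \<in> sets (ppi r)" unfolding sets_ppi by simp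
    thus ?thesis using ppp emeasure_ppi_infinite[OF r] unfolding poisson_point_process_def by blast
  qed
  thus ?thesis using ppp_mark_integrable AE_space
  proof eventually_elim
    case (elim w)
    have sets: "sets (N w) = sets borel" using ppp_sets[OF ppp elim(3)] by (simp add: sets_ppi)
    have sp: "space (N w) = UNIV" using sets_eq_imp_space_eq[OF sets] by simp
    have mfst: "(\<lambda>p. exp (- fst p)) \<in> borel_measurable (N w)"
      unfolding measurable_cong_sets[OF sets refl]
      by (intro borel_measurable_continuous_onI continuous_intros)
    have fm: "fst (mark p) = exp (- fst p)" for p :: "real \<times> 'a" by (simp add: mark_def fst_feat)
    have int: "integrable (N w) (\<lambda>p. exp (- fst p))"
      using integrable_bounded_linear[OF bounded_linear_fst elim(2)] by (simp add: fm)
    have f: "fst (\<integral>p. mark p \<partial>N w) = (\<integral>p. exp (- fst p) \<partial>N w)"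
      using integral_bounded_linear[OF bounded_linear_fst elim(2)] by (simp add: fm)
    also have "\<dots> = enn2real (?den w)"
      using int by (intro integral_eq_nn_integral) auto
    finally have 1: "fst (\<integral>p. mark p \<partial>N w) = enn2real (?den w)" .
    have 2: "(?den w) < \<infinity>"
      using int by (subst nn_integral_eq_integral) auto
    have 3: "0 < (?den w)"
    proof (rule ccontr)
      assume "\<not> 0 < (?den w)"
      hence "(?den w) = 0" by simp
      hence "AE p in N w. ennreal (exp (- fst p)) = 0"
        using mfst by (subst (asm) nn_integral_0_iff_AE) auto
      hence "AE p in N w. False" by eventually_elim simp
      hence "space (N w) \<in> null_sets (N w)" by (subst (asm) AE_iff_null) auto
      hence "emeasure (N w) (space (N w)) = 0" by (rule null_setsD1)
      thus False using elim(1) sp by simp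
    qed
    have "displacement (mark p) = (exp (- fst p) * sqrt (2 * fst p)) *\<^sub>R snd p" for p :: "real \<times> 'a"
      by (simp add: mark_def linear_scale[OF bounded_linear.linear[OF bounded_linear_displacement]] displacement_feat)
    hence "displacement (\<integral>p. mark p \<partial>N w) = (\<integral>p. (exp (- fst p) * sqrt (2 * fst p)) *\<^sub>R snd p \<partial>N w)"
      using integral_bounded_linear[OF bounded_linear_displacement elim(2)] by simp
    thus ?case using 1 2 3 by simp
  qed
qed

end

end

section \<open>Matching of constants and the main result\<close>

lemma C2_on_continuous: "C2_on S f \<Longrightarrow> continuous_on S f"
  unfolding C2_on_def by (metis continuous_at_imp_continuous_on has_derivative_continuous subsetD)

text \<open>Links the sphere area in C(q), indexed by the dimension of the sphere, to the ball
  volume coming from the cap estimate; the Gamma recursion accounts for the factor m.\<close>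

lemma sphere_area_eq_unit_ball_vol:
  assumes "m \<ge> 1" shows "sphere_area (m - 1) = real m * unit_ball_vol (real m)"
proof -
  have "Gamma (real m / 2 + 1) = (real m / 2) * Gamma (real m / 2)"
    by (rule Gamma_plus1) (use assms in auto)
  moreover have "real (m - 1) + 1 = real m" using assms by simp
  ultimately show ?thesis using assms
    unfolding sphere_area_def unit_ball_vol_def by (simp only:) simp
qed

text \<open>Both claims come from factoring out \<open>real n powr (2 / real m)\<close>: beta_n is
  this diverging power times a sequence with positive limit, and raising that sequence to the power
  -m/2 turns the factor n^(-2/m) into n.\<close>

lemma beta_scaling:
  fixes \<beta> :: "nat \<Rightarrow> real"
  assumes m: "m \<ge> 1" and \<beta>: "\<And>n. \<beta> n > 0" and \<gamma>: "\<gamma> > 0"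
    and lim: "(\<lambda>n. \<beta> n * real n powr (- (2 / real m))) \<longlonglongrightarrow> \<gamma>"
  shows "filterlim \<beta> at_top sequentially"
    and "(\<lambda>n. real n * (1 / sqrt (\<beta> n)) ^ m) \<longlonglongrightarrow> \<gamma> powr (- (real m / 2))"
proof -
  have top: "filterlim (\<lambda>n. real n powr (2 / real m)) at_top sequentially"
    by (rule filterlim_compose[OF real_powr_at_top filterlim_real_sequentially]) (use m in simp)
  have "filterlim (\<lambda>n. (\<beta> n * real n powr (- (2 / real m))) * real n powr (2 / real m)) at_top sequentially"
    by (rule filterlim_tendsto_pos_mult_at_top[OF lim \<gamma> top])
  moreover have "eventually (\<lambda>n. (\<beta> n * real n powr (- (2 / real m))) * real n powr (2 / real m) = \<beta> n) sequentially"
    using eventually_gt_at_top[of 0] by eventually_elim (simp add: powr_minus)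
  ultimately show "filterlim \<beta> at_top sequentially" by (simp add: filterlim_cong[OF refl refl])
  have "(\<lambda>n. (\<beta> n * real n powr (- (2 / real m))) powr (- (real m / 2))) \<longlonglongrightarrow> \<gamma> powr (- (real m / 2))"
    using \<gamma> by (intro tendsto_powr lim tendsto_const) auto
  moreover have "eventually (\<lambda>n. (\<beta> n * real n powr (- (2 / real m))) powr (- (real m / 2)) = real n * (1 / sqrt (\<beta> n)) ^ m) sequentially"
    using eventually_gt_at_top[of 0]
  proof eventually_elim
    case (elim n)
    have "(\<beta> n * real n powr (- (2 / real m))) powr (- (real m / 2)) = \<beta> n powr (- (real m / 2)) * real n"
      using \<beta>[of n] elim m by (simp add: powr_mult powr_powr)
    also have "\<beta> n powr (- (real m / 2)) = (1 / sqrt (\<beta> n)) ^ m"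
      using sqrt_power_eq_powr[OF \<beta>[of n], of m] by (simp add: powr_minus power_divide field_simps)
    finally show ?case by simp
  qed
  ultimately show "(\<lambda>n. real n * (1 / sqrt (\<beta> n)) ^ m) \<longlonglongrightarrow> \<gamma> powr (- (real m / 2))"
    by (simp add: filterlim_cong[OF refl refl])
qed

theorem mainTheorem5:
  fixes M :: "'w measure" and x :: "nat \<Rightarrow> 'w \<Rightarrow> real^'n" and \<rho> :: "real^'n \<Rightarrow> real"
    and q :: "real^'n" and \<beta> :: "nat \<Rightarrow> real" and V :: "real^'n^'n" and \<gamma> :: real
    and \<nu> :: "(real^'n) measure" and P :: "'p measure" and N :: "'p \<Rightarrow> (real \<times> (real^'n)) measure"
  assumes dim: "CARD('n) \<ge> 2"
    and M: "prob_space M"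
    and q: "q \<in> sphere 0 1"
    and rho_meas: "\<rho> \<in> borel_measurable borel"
    and rho_nonneg: "\<forall>u\<in>sphere 0 1. \<rho> u \<ge> 0"
    and rho_dens: "(\<integral>\<^sup>+u. ennreal (\<rho> u) \<partial>sphere_surface_measure) = 1"
    and rho_C2: "C2_on (sphere 0 1) \<rho>"
    and rho_q: "\<rho> q > 0"
    and indep: "prob_space.indep_vars M (\<lambda>_. borel) x {1..}"
    and law: "\<forall>i\<ge>1. distr M borel (x i) = density sphere_surface_measure (\<lambda>u. ennreal (\<rho> u))"
    and beta_pos: "\<forall>n. \<beta> n > 0"
    and gamma_pos: "\<gamma> > 0"
    and beta_lim: "(\<lambda>n. \<beta> n * real n powr (- alpha_dim TYPE('n))) \<longlonglongrightarrow> \<gamma>"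
    and nu: "uniform_on_orth_sphere q \<nu>"
    and PPP: "poisson_point_process P (ppp_intensity TYPE('n) \<rho> q \<gamma> \<nu>) N"
  shows "conv_in_distribution M (\<lambda>n \<omega>. sqrt (\<beta> n) *\<^sub>R attn_Y V \<beta> q x n \<omega>) P (\<lambda>\<omega>. V *v ppp_Xi (N \<omega>))
    \<and> (AE \<omega> in P. 0 < ppp_den (N \<omega>) \<and> ppp_den (N \<omega>) < \<infinity>)
    \<and> conv_in_probability M (attn_Y V \<beta> q x) 0
    \<and> conv_in_probability M (ATT V \<beta> q x) (V *v q)"
proof -
  interpret M: prob_space M by (rule M)
  define m where "m = CARD('n) - 1"
  have m: "m \<ge> 1" "CARD('n) = Suc m" using dim by (auto simp: m_def)
  have alpha: "alpha_dim TYPE('n) = 2 / real m" using m by (simp add: alpha_dim_def)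
  have \<beta>: "\<beta> n > 0" for n using beta_pos by simp
  define \<zeta> where "\<zeta> = \<gamma> powr (- (real m / 2))"
  note scaling = beta_scaling[OF m(1) \<beta> gamma_pos beta_lim[unfolded alpha]]
  have q1: "norm q = 1" using q by simp
  interpret S: cap_scaling q \<nu> \<beta> \<zeta> m
    using scaling \<beta> gamma_pos m by unfold_locales (auto simp: q1 nu \<zeta>_def)

  have rc: "continuous_on (sphere 0 1) \<rho>" by (rule C2_on_continuous[OF rho_C2])
  hence rcq: "continuous (at q within sphere 0 1) \<rho>" using q by (simp add: continuous_on_eq_continuous_within)
  obtain R where R: "\<And>u. norm u = 1 \<Longrightarrow> \<bar>\<rho> u\<bar> \<le> R"
  proof -
    have "bounded (\<rho> ` sphere 0 1)" by (intro compact_imp_bounded compact_continuous_image rc compact_sphere)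
    then obtain a where "\<forall>u\<in>sphere 0 1. \<bar>\<rho> u\<bar> \<le> a" by (auto simp: bounded_iff)
    thus ?thesis by (intro that[of a]) simp
  qed

  \<comment> \<open>In C(q) the factor m in the sphere area cancels the denominator d - 1,
    2^(1/\<alpha>) is sqrt(2)^m, and the prefactor 1/\<alpha> is the m/2 in
    \<open>intensity_const\<close>.\<close>
  have intensity: "ppp_intensity TYPE('n) \<rho> q \<gamma> \<nu> = S.ppi (\<rho> q)"
  proof -
    have "CARD('n) - 2 = m - 1" using m by simp
    hence sa: "sphere_area (CARD('n) - 2) = real m * unit_ball_vol (real m)"
      using sphere_area_eq_unit_ball_vol[OF m(1)] by (simp only:)
    have d: "real CARD('n) - 1 = real m" using m(2) by simp
    have s2: "sqrt 2 ^ m = 2 powr (real m / 2)" by (rule sqrt_power_eq_powr) simp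
    have C: "C_const TYPE('n) \<rho> q = sqrt 2 ^ m * unit_ball_vol (real m) * \<rho> q"
      unfolding C_const_def alpha sa d s2 using m(1) by simp
    have \<zeta>: "\<zeta> = 1 / \<gamma> powr (real m / 2)" unfolding \<zeta>_def by (rule powr_minus_divide)
    have "C_const TYPE('n) \<rho> q / (alpha_dim TYPE('n) * \<gamma> powr (1 / alpha_dim TYPE('n))) = \<rho> q * S.intensity_const"
      unfolding S.intensity_const_def C alpha unfolding \<zeta> using m(1) gamma_pos by (simp add: mult_ac)
    thus ?thesis by (simp add: ppp_intensity_def S.ppi_def alpha)
  qed
  note ppp = PPP[unfolded intensity]
  interpret P: prob_space P by (rule ppp_prob_space[OF ppp])
  define Z where "Z w = (\<integral>p. mark p \<partial>N w)" for w
  note comp = S.ppp_mark_components[OF ppp rho_q, folded Z_def]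
  have Xi: "AE w in P. ppp_Xi (N w) = ratio (Z w)"
    using comp by eventually_elim (simp add: ppp_Xi_def ratio_def ppp_den_def ppp_num_def)
  have den: "AE w in P. 0 < ppp_den (N w) \<and> ppp_den (N w) < \<infinity>"
    using comp by eventually_elim (simp add: ppp_den_def)
  have Zm [measurable]: "Z \<in> borel_measurable P"
    unfolding Z_def[abs_def]
    by (rule ppp_bochner_integral_measurable[OF ppp S.mark_measurable_ppi[OF ppp rho_q]])
  \<comment> \<open>Measurability is proved on its own, because agreement with
    \<open>ratio (Z w)\<close> holds only almost everywhere.\<close>
  have Xim: "(\<lambda>w. ppp_Xi (N w)) \<in> borel_measurable P"
  proof -
    have b: "borel_measurable (S.ppi (\<rho> q)) = borel_measurable borel"
      by (rule measurable_cong_sets[OF S.sets_ppi refl])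
    have 1: "(\<lambda>w. \<integral>\<^sup>+p. ennreal (exp (- fst p)) \<partial>N w) \<in> borel_measurable P"
      by (rule ppp_integral_measurable[OF ppp], unfold b)
         (intro measurable_compose[OF _ measurable_ennreal] borel_measurable_continuous_onI continuous_intros)
    have 2: "(\<lambda>w. \<integral>p. (exp (- fst p) * sqrt (2 * fst p)) *\<^sub>R snd p \<partial>N w) \<in> borel_measurable P"
      by (rule ppp_bochner_integral_measurable[OF ppp], unfold b)
         (intro borel_measurable_continuous_onI continuous_intros)
    show ?thesis unfolding ppp_Xi_def ppp_den_def ppp_num_def using 1 2 by measurable
  qed

  have xm [measurable]: "x i \<in> borel_measurable M" if "i \<ge> 1" for i
    using indep that by (auto simp: M.indep_vars_def)
  \<comment> \<open>The first coordinate of this sum is the partition function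
    \<open>attn_Z\<close>, and \<open>displacement\<close> recovers the unnormalised numerator
    scaled by \<open>sqrt (\<beta> n)\<close>.\<close>
  define Sn where "Sn n w = (\<Sum>i=1..n. exp (- (\<beta> n * S.T (x i w))) *\<^sub>R feat (sqrt (\<beta> n) *\<^sub>R (x i w - q)))" for n w
  have Snm [measurable]: "Sn n \<in> borel_measurable M" for n
    unfolding Sn_def[abs_def] by (intro borel_measurable_sum) (use xm in measurable)
  have laplace: "(\<lambda>n. \<integral>w. exp (- (U \<bullet> Sn n w)) \<partial>M) \<longlonglongrightarrow> (\<integral>w. exp (- (U \<bullet> Z w)) \<partial>P)"
    if U: "\<And>b. b \<in> Basis \<Longrightarrow> 0 \<le> U \<bullet> b" for U
  proof -
    define f where "f n u = U \<bullet> (exp (- (\<beta> n * S.T u)) *\<^sub>R feat (sqrt (\<beta> n) *\<^sub>R (u - q)))" for n u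
    have fm [measurable]: "f n \<in> borel_measurable borel" for n unfolding f_def[abs_def] by measurable
    have f0: "0 \<le> f n u" for n u unfolding f_def by (simp add: inner_feat_nonneg[OF U])
    have "(\<integral>u. 1 - exp (- f n u) \<partial>density sphere_surface_measure (\<lambda>u. ennreal (\<rho> u)))
        = (\<integral>u. \<rho> u * (1 - exp (- f n u)) \<partial>sphere_surface_measure)" for n
    proof -
      have "AE u in sphere_surface_measure. 0 \<le> \<rho> u"
        using AE_sphere_surface_measure_norm by eventually_elim (use rho_nonneg in simp)
      thus ?thesis using rho_meas by (subst integral_density) auto
    qed
    hence "(\<lambda>n. real n * (\<integral>u. 1 - exp (- f n u) \<partial>density sphere_surface_measure (\<lambda>u. ennreal (\<rho> u))))
        \<longlonglongrightarrow> \<rho> q * (\<integral>y. \<integral>\<theta>. 1 - exp (- (U \<bullet> mark (y, \<theta>))) \<partial>\<nu> \<partial>S.height_intensity)"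
      using S.feature_limit[OF U rho_meas R rcq] by (simp add: f_def)
    from M.iid_laplace_limit[OF indep _ fm f0 this] law
    have "(\<lambda>n. \<integral>w. exp (- (\<Sum>i=1..n. f n (x i w))) \<partial>M)
        \<longlonglongrightarrow> exp (- (\<rho> q * (\<integral>y. \<integral>\<theta>. 1 - exp (- (U \<bullet> mark (y, \<theta>))) \<partial>\<nu> \<partial>S.height_intensity)))" by simp
    moreover have "(\<Sum>i=1..n. f n (x i w)) = U \<bullet> Sn n w" for n w
      by (simp add: f_def Sn_def inner_sum_right)
    ultimately show ?thesis using S.ppp_mark_laplace[OF ppp rho_q U] by (simp add: Z_def)
  qed
  have nonneg: "AE w in P. \<forall>b\<in>Basis. 0 \<le> Z w \<bullet> b"
    using S.ppp_mark_integrable[OF ppp rho_q]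
  proof eventually_elim
    case (elim w)
    have "0 \<le> (\<integral>p. mark p \<bullet> b \<partial>N w)" if "b \<in> Basis" for b
      by (intro integral_nonneg_AE) (simp add: mark_nonneg that)
    thus ?case using elim by (simp add: Z_def)
  qed
  have LL: "laplace_limit (\<lambda>_. M) Sn P Z"
  proof (rule laplace_limit.intro)
    show "AE w in M. \<forall>b\<in>Basis. 0 \<le> Sn n w \<bullet> b" for n
      by (intro AE_I2 ballI) (auto simp: Sn_def inner_sum_left intro!: sum_nonneg mult_nonneg_nonneg feat_nonneg)
  qed (use laplace nonneg in \<open>auto simp: M.finite_measure_axioms P.finite_measure_axioms\<close>)

  have Z_eq: "attn_Z \<beta> q x n w = fst (Sn n w)" for n w
    by (simp add: attn_Z_def Sn_def fst_sum fst_feat S.T_def)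
  have D_eq: "displacement (Sn n w) = sqrt (\<beta> n) *\<^sub>R (\<Sum>i=1..n. exp (- \<beta> n * (1 - q \<bullet> x i w)) *\<^sub>R (x i w - q))" for n w
  proof -
    have "displacement (Sn n w) = (\<Sum>i=1..n. exp (- (\<beta> n * S.T (x i w))) *\<^sub>R (sqrt (\<beta> n) *\<^sub>R (x i w - q)))"
      by (simp add: Sn_def linear_sum[OF bounded_linear.linear[OF bounded_linear_displacement]]
          linear_scale[OF bounded_linear.linear[OF bounded_linear_displacement]] displacement_feat)
    thus ?thesis by (simp add: scaleR_sum_right S.T_def mult.commute)
  qed
  \<comment> \<open>The scale \<open>sqrt (\<beta> n)\<close> sits inside the numerator of
    \<open>ratio\<close>; at n = 0 both sides are 0.\<close>
  have Y_eq: "sqrt (\<beta> n) *\<^sub>R attn_Y V \<beta> q x n w = V *v ratio (Sn n w)" for n w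
  proof -
    have "ratio (Sn n w) = sqrt (\<beta> n) *\<^sub>R (\<Sum>i=1..n. attn_A \<beta> q x n i w *\<^sub>R (x i w - q))"
      by (simp add: ratio_def D_eq attn_A_def Z_eq[symmetric] scaleR_sum_right mult_ac)
    thus ?thesis by (simp add: attn_Y_def matrix_vector_mult_scaleR)
  qed

  have conv: "conv_in_distribution M (\<lambda>n \<omega>. sqrt (\<beta> n) *\<^sub>R attn_Y V \<beta> q x n \<omega>) P (\<lambda>\<omega>. V *v ppp_Xi (N \<omega>))"
    unfolding conv_in_distribution_def Y_eq
  proof (intro conjI allI impI)
    show Ym: "(\<lambda>\<omega>. V *v ratio (Sn n \<omega>)) \<in> borel_measurable M" for n by measurable
    show Xm: "(\<lambda>\<omega>. V *v ppp_Xi (N \<omega>)) \<in> borel_measurable P" using Xim by measurable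
    fix f :: "real^'n \<Rightarrow> real" assume f: "continuous_on UNIV f \<and> bounded (range f)"
    hence fm [measurable]: "f \<in> borel_measurable borel" by (intro borel_measurable_continuous_onI) simp
    obtain B where B: "\<And>z. \<bar>f z\<bar> \<le> B" using f by (auto simp: bounded_iff)
    define h where "h z = f (V *v ratio z)" for z
    \<comment> \<open>This basis vector picks out the denominator, so \<open>limit\<close> asks for
      continuity of \<open>h\<close> only where the ratio is genuinely defined.\<close>
    have b0: "(1, 0) \<in> (Basis :: (real \<times> (real \<times> (real^'n))) set)" by (simp add: Basis_prod_def)
    have "(\<lambda>n. \<integral>w. h (Sn n w) \<partial>M) \<longlonglongrightarrow> (\<integral>w. h (Z w) \<partial>P)"
    proof (rule laplace_limit.limit[OF LL b0])
      show "AE w in P. 0 < Z w \<bullet> (1, 0)"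
        using comp by eventually_elim (auto simp: inner_prod_def enn2real_positive_iff)
      show "h \<in> borel_measurable borel" unfolding h_def[abs_def] by measurable
      show "continuous_on {s. 0 < s \<bullet> (1, 0) \<and> (\<forall>b\<in>Basis. 0 \<le> s \<bullet> b)} h"
        unfolding h_def
      proof (rule continuous_on_compose2[OF conjunct1[OF f]])
        have "continuous_on {s. 0 < s \<bullet> (1, 0) \<and> (\<forall>b\<in>Basis. 0 \<le> s \<bullet> b)} (ratio :: _ \<Rightarrow> real^'n)"
          unfolding ratio_def displacement_def by (intro continuous_intros) (auto simp: inner_prod_def)
        thus "continuous_on {s. 0 < s \<bullet> (1, 0) \<and> (\<forall>b\<in>Basis. 0 \<le> s \<bullet> b)} (\<lambda>z. V *v ratio z)"
          by (rule linear_continuous_on_compose) (rule matrix_vector_mul_linear)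
      qed auto
      show "\<bar>h z\<bar> \<le> B" for z by (simp add: h_def B)
    qed
    moreover have "(\<integral>w. h (Z w) \<partial>P) = (\<integral>w. f (V *v ppp_Xi (N w)) \<partial>P)"
    proof (rule integral_cong_AE)
      show "AE w in P. h (Z w) = f (V *v ppp_Xi (N w))" using Xi by eventually_elim (simp add: h_def)
      show "(\<lambda>w. f (V *v ppp_Xi (N w))) \<in> borel_measurable P" using Xm by measurable
      show "(\<lambda>w. h (Z w)) \<in> borel_measurable P" unfolding h_def by measurable
    qed
    ultimately show "(\<lambda>n. \<integral>z. f z \<partial>distr M borel (\<lambda>\<omega>. V *v ratio (Sn n \<omega>)))
       \<longlonglongrightarrow> (\<integral>z. f z \<partial>distr P borel (\<lambda>\<omega>. V *v ppp_Xi (N \<omega>)))"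
      using Ym Xm by (simp add: integral_distr h_def)
  qed

  have Y_eq': "attn_Y V \<beta> q x n w = (1 / sqrt (\<beta> n)) *\<^sub>R (V *v ratio (Sn n w))" for n w
    using \<beta>[of n] by (simp flip: Y_eq)
  have Ym [measurable]: "attn_Y V \<beta> q x n \<in> borel_measurable M" for n
    unfolding Y_eq'[abs_def] by measurable
  have tail: "(\<lambda>n. measure M {\<omega>\<in>space M. norm (attn_Y V \<beta> q x n \<omega>) > e}) \<longlonglongrightarrow> 0" if e: "e > 0" for e
  proof -
    \<comment> \<open>The event that \<open>attn_Y\<close> exceeds \<open>e\<close> in norm is the
      event that the rescaled vector exceeds \<open>e * sqrt (\<beta> n)\<close>, a level tending to
      infinity.\<close>
    have "filterlim (\<lambda>n. e * sqrt (\<beta> n)) at_top sequentially"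
      by (rule filterlim_tendsto_pos_mult_at_top[OF tendsto_const e filterlim_compose[OF sqrt_at_top scaling(1)]])
    from conv_in_distribution_scaled_tail[OF conv M P.prob_space_axioms this]
    show ?thesis using \<beta> by (simp add: mult.commute[of e] less_imp_le)
  qed
  have probY: "conv_in_probability M (attn_Y V \<beta> q x) 0"
    using tail Ym by (simp add: conv_in_probability_def)
  \<comment> \<open>The weights sum to 1 only for a nonempty sample, so n = 0 is excluded here; it
    affects measurability but not the limit.\<close>
  have ATT_eq: "ATT V \<beta> q x n w = attn_Y V \<beta> q x n w + V *v q" if "n \<ge> 1" for n w
  proof -
    have "attn_Z \<beta> q x n w > 0" unfolding attn_Z_def using that by (intro sum_pos) auto
    hence "(\<Sum>i=1..n. attn_A \<beta> q x n i w) = 1"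
      by (simp add: attn_A_def sum_divide_distrib[symmetric]) (simp add: attn_Z_def)
    hence "(\<Sum>j=1..n. attn_A \<beta> q x n j w *\<^sub>R x j w) = (\<Sum>i=1..n. attn_A \<beta> q x n i w *\<^sub>R (x i w - q)) + q"
      by (simp add: scaleR_diff_right sum_subtractf scaleR_sum_left[symmetric])
    thus ?thesis by (simp add: ATT_def attn_Y_def matrix_vector_right_distrib)
  qed
  have probA: "conv_in_probability M (ATT V \<beta> q x) (V *v q)"
    unfolding conv_in_probability_def
  proof (intro conjI allI impI)
    fix n
    show "ATT V \<beta> q x n \<in> borel_measurable M"
    proof (cases "n = 0")
      case True
      thus ?thesis by (simp add: ATT_def[abs_def])
    next
      case False
      hence "ATT V \<beta> q x n = (\<lambda>w. attn_Y V \<beta> q x n w + V *v q)" by (intro ext ATT_eq) simp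
      thus ?thesis by simp
    qed
  next
    fix e :: real assume e: "e > 0"
    have "eventually (\<lambda>n. measure M {\<omega>\<in>space M. norm (attn_Y V \<beta> q x n \<omega>) > e}
        = measure M {\<omega>\<in>space M. dist (ATT V \<beta> q x n \<omega>) (V *v q) > e}) sequentially"
      using eventually_ge_at_top[of 1] by eventually_elim (simp add: ATT_eq dist_norm)
    thus "(\<lambda>n. measure M {\<omega>\<in>space M. dist (ATT V \<beta> q x n \<omega>) (V *v q) > e}) \<longlonglongrightarrow> 0"
      using tail[OF e] by (rule Lim_transform_eventually[rotated])
  qed
  show ?thesis using conv den probY probA by blast
qed

end
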